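(* Let $\mathbb{K}$ be a field, let $G$ be a graph on the vertex set $[n]=\{1,\ldots,n\}$, let $S=\mathbb{K}[x_1,\ldots,x_n,y_1,\ldots,y_n]$, and let $J_G\subseteq S$ be the binomial edge ideal of $G$. Let $c(G)$ be the number of maximal cliques of $G$. Then $$\operatorname{reg} S/J_G\leq c(G).$$
   Context: All graphs are simple (undirected, no loops, no multiple edges). The binomial edge ideal of a graph $G$ on $[n]$ is the ideal $J_G$ of $S=\mathbb{K}[x_1,\ldots,x_n,y_1,\ldots,y_n]$ generated by all binomials $f_{ij}=x_iy_j-x_jy_i$ with $i<j$ and $\{i,j\}\in E(G)$. The Castelnuovo-Mumford regularity is $\operatorname{reg} S/J_G=\max\{j-i : \beta_{i,j}(S/J_G)\neq 0\}$, where $\beta_{i,j}(S/J_G)$ are the graded Betti numbers of $S/J_G$ over the standard graded polynomial ring $S$. A clique of $G$ is a set of pairwise adjacent vertices; a maximal clique is one that is maximal with respect to inclusion. *)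

theory Defs
  imports
    "HOL-Library.Poly_Mapping"
    "HOL-Library.Ramsey"
    "HOL-Library.Extended_Real"
    "HOL-Algebra.Ideal"
    "Jordan_Normal_Form.Matrix"
begin

section \<open>The polynomial ring in the variables \<open>x\<^sub>1, \<dots>, x\<^sub>n, y\<^sub>1, \<dots>, y\<^sub>n\<close>\<close>

datatype var = X nat | Y nat

text \<open>A monomial is a finitely supported exponent vector, a polynomial a finitely supported
  family of coefficients.\<close>

type_synonym monom = "var \<Rightarrow>\<^sub>0 nat"
type_synonym 'k pol = "monom \<Rightarrow>\<^sub>0 'k"

definition var_set :: "nat \<Rightarrow> var set" where
  "var_set n = X ` {1..n} \<union> Y ` {1..n}"

definition Var :: "var \<Rightarrow> 'k::field pol" where
  "Var v = Poly_Mapping.single (Poly_Mapping.single v 1) 1"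

definition Pol :: "nat \<Rightarrow> 'k::field pol ring" where
  "Pol n = \<lparr>carrier = {p. \<forall>m \<in> Poly_Mapping.keys p. Poly_Mapping.keys m \<subseteq> var_set n},
            monoid.mult = (*), one = 1, zero = 0, add = (+)\<rparr>"

lemma cring_Pol: "cring (Pol n :: 'k::field pol ring)"
proof (rule cringI)
  show "abelian_group (Pol n :: 'k pol ring)"
  proof (rule abelian_groupI)
    fix p q :: "'k pol"
    assume "p \<in> carrier (Pol n)" "q \<in> carrier (Pol n)"
    then show "p \<oplus>\<^bsub>Pol n\<^esub> q \<in> carrier (Pol n)"
      using keys_add[of p q] by (auto simp: Pol_def)
  next
    fix p :: "'k pol"
    assume "p \<in> carrier (Pol n)"
    then show "\<exists>q \<in> carrier (Pol n). q \<oplus>\<^bsub>Pol n\<^esub> p = \<zero>\<^bsub>Pol n\<^esub>"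
      by (intro bexI[of _ "- p"]) (auto simp: Pol_def in_keys_iff)
  qed (auto simp: Pol_def add_ac)
  show "Group.comm_monoid (Pol n :: 'k pol ring)"
  proof (rule comm_monoidI)
    fix p q :: "'k pol"
    assume *: "p \<in> carrier (Pol n)" "q \<in> carrier (Pol n)"
    have "Poly_Mapping.keys m \<subseteq> var_set n" if "m \<in> Poly_Mapping.keys (p * q)" for m
    proof -
      from that obtain a b where "m = a + b" "a \<in> Poly_Mapping.keys p" "b \<in> Poly_Mapping.keys q"
        using keys_mult[of p q] by blast
      then show ?thesis
        using * Poly_Mapping.keys_add[of a b] by (fastforce simp: Pol_def)
    qed
    then show "p \<otimes>\<^bsub>Pol n\<^esub> q \<in> carrier (Pol n)"
      by (auto simp: Pol_def)
  qed (auto simp: Pol_def mult_ac)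
qed (auto simp: Pol_def distrib_right)

text \<open>Standard grading: homogeneous of degree \<open>a\<close>. Zero is homogeneous of every degree, and it
  is the only polynomial that is homogeneous of a negative degree.\<close>

definition homogeneous :: "int \<Rightarrow> 'k::field pol \<Rightarrow> bool" where
  "homogeneous a p \<longleftrightarrow>
     (\<forall>m \<in> Poly_Mapping.keys p. int (\<Sum>v \<in> Poly_Mapping.keys m. Poly_Mapping.lookup m v) = a)"

definition irrelevant_ideal :: "nat \<Rightarrow> 'k::field pol set" where
  "irrelevant_ideal n = Idl\<^bsub>Pol n\<^esub> (Var ` var_set n)"


section \<open>Graded Betti numbers and regularity\<close>

definition free_mod :: "nat \<Rightarrow> nat \<Rightarrow> 'k::field pol vec set" where
  "free_mod n r = {v \<in> carrier_vec r. \<forall>k < r. v $ k \<in> carrier (Pol n)}"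

text \<open>Minimal graded free resolutions
  \<open>\<dots> \<rightarrow> F\<^sub>2 \<rightarrow> F\<^sub>1 \<rightarrow> F\<^sub>0 \<rightarrow> S/I \<rightarrow> 0\<close> of \<open>S/I\<close>, for a homogeneous ideal \<open>I\<close> of \<open>S = Pol n\<close>.
  The list \<open>d i\<close> contains the degrees of the basis elements of \<open>F\<^sub>i\<close>, that is,
  \<open>F\<^sub>i\<close> is the direct sum of the \<open>S(-a)\<close> for \<open>a\<close> in \<open>d i\<close>.
  The matrix \<open>\<phi> i\<close> represents the differential \<open>F\<^sub>i\<^sub>+\<^sub>1 \<rightarrow> F\<^sub>i\<close>.
  The augmentation \<open>F\<^sub>0 \<rightarrow> S/I\<close> sends the \<open>k\<close>-th basis element to the class of the
  homogeneous polynomial \<open>g $ k\<close>; so it sends \<open>v\<close> to the class of \<open>g \<bullet> v\<close>, which is zero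
  iff \<open>g \<bullet> v \<in> I\<close>.
  The conditions say, in this order: the augmentation and the differentials are graded maps,
  the augmentation is surjective, the sequence is exact at \<open>F\<^sub>0\<close> and at \<open>F\<^sub>i\<^sub>+\<^sub>1\<close>,
  and the image of each differential lies in the irrelevant ideal times its target.\<close>

definition minimal_graded_free_resolution ::
  "nat \<Rightarrow> 'k::field pol set \<Rightarrow> (nat \<Rightarrow> int list) \<Rightarrow> 'k pol vec \<Rightarrow> (nat \<Rightarrow> 'k pol mat) \<Rightarrow> bool" where
  "minimal_graded_free_resolution n I d g \<phi> \<longleftrightarrow>
     g \<in> free_mod n (length (d 0)) \<and>
     (\<forall>k < length (d 0). homogeneous (d 0 ! k) (g $ k)) \<and>
     (\<forall>i. \<phi> i \<in> carrier_mat (length (d i)) (length (d (Suc i)))) \<and>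
     (\<forall>i. \<forall>k < length (d i). \<forall>l < length (d (Suc i)).
        \<phi> i $$ (k, l) \<in> carrier (Pol n) \<and>
        homogeneous (d (Suc i) ! l - d i ! k) (\<phi> i $$ (k, l))) \<and>
     (\<forall>p \<in> carrier (Pol n). \<exists>v \<in> free_mod n (length (d 0)). p - g \<bullet> v \<in> I) \<and>
     {v \<in> free_mod n (length (d 0)). g \<bullet> v \<in> I} =
       (\<lambda>w. \<phi> 0 *\<^sub>v w) ` free_mod n (length (d 1)) \<and>
     (\<forall>i. {v \<in> free_mod n (length (d (Suc i))). \<phi> i *\<^sub>v v = 0\<^sub>v (length (d i))} =
       (\<lambda>w. \<phi> (Suc i) *\<^sub>v w) ` free_mod n (length (d (Suc (Suc i))))) \<and>
     (\<forall>i. \<forall>w \<in> free_mod n (length (d (Suc i))). \<forall>k < length (d i).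
        (\<phi> i *\<^sub>v w) $ k \<in> irrelevant_ideal n)"

text \<open>\<open>betti n I i j\<close> is the graded Betti number \<open>\<beta>\<^sub>i\<^sub>,\<^sub>j(S/I)\<close>, the number of summands \<open>S(-j)\<close>
  of \<open>F\<^sub>i\<close> in a minimal graded free resolution of \<open>S/I\<close>. A homogeneous \<open>I\<close> has such a
  resolution, unique up to isomorphism, so the choice does not matter.\<close>

definition betti :: "nat \<Rightarrow> 'k::field pol set \<Rightarrow> nat \<Rightarrow> int \<Rightarrow> nat" where
  "betti n I i j =
     count_list ((SOME d. \<exists>g \<phi>. minimal_graded_free_resolution n I d g \<phi>) i) j"

text \<open>The regularity of \<open>S/I\<close>. The supremum is taken in the extended reals, so that an upper
  bound on it always bounds every \<open>j - i\<close> with \<open>\<beta>\<^sub>i\<^sub>,\<^sub>j(S/I) \<noteq> 0\<close>; \<open>Max\<close> on the integers would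
  be unspecified on an infinite or empty set. When that set is finite and nonempty, as
  it is for a proper homogeneous ideal, the supremum is its maximum.\<close>

definition regularity :: "nat \<Rightarrow> 'k::field pol set \<Rightarrow> ereal" where
  "regularity n I = Sup {ereal (real_of_int (j - int i)) | i j. betti n I i j \<noteq> 0}"


section \<open>Binomial edge ideals and maximal cliques\<close>

definition binomial_edge_ideal :: "nat \<Rightarrow> nat set set \<Rightarrow> 'k::field pol set" where
  "binomial_edge_ideal n E =
     Idl\<^bsub>Pol n\<^esub> {Var (X i) * Var (Y j) - Var (X j) * Var (Y i) | i j. i < j \<and> {i, j} \<in> E}"

definition maximal_cliques :: "'a set \<Rightarrow> 'a set set \<Rightarrow> 'a set set" where
  "maximal_cliques V E =
     {C. C \<subseteq> V \<and> clique C E \<and> (\<forall>D. D \<subseteq> V \<and> clique D E \<and> C \<subseteq> D \<longrightarrow> D = C)}"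

end

theory Submission
  imports Defs
begin

text \<open>
Regularity is measured on the Koszul complex of the variables. An ideal \<open>I\<close> is called
\<open>r\<close>-regular (\<open>koszul_regular\<close>) if every homogeneous Koszul chain whose coefficients have degree
\<open>a > r\<close> and which is a cycle modulo \<open>I\<close> is a boundary modulo \<open>I\<close>. This says that
\<open>Tor\<^sub>i(S/I, K)\<close> vanishes in degree \<open>j\<close> for \<open>j - i > r\<close>, but it mentions nothing besides \<open>I\<close>.
Long exact sequences therefore become chases with explicit chains, and three of them carry the proof:
for an intersection \<open>A \<inter> B\<close> (\<open>koszul_regular_Int\<close>), for a colon by a variable
(\<open>koszul_regular_colon\<close>), and for a variable that is a nonzerodivisor
(\<open>koszul_regular_nonzerodivisor\<close>).

The combinatorial bound behind the theorem is sharper than the number of maximal cliques: it is the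
largest size \<open>\<eta>(G)\<close> of a set of edges no two of which lie in a common clique. Choosing a
maximal clique around each edge of such a set is injective, so \<open>\<eta>(G)\<close> is at most the number of
maximal cliques (\<open>eta_le_maximal_cliques\<close>).

The inequality \<open>reg S/J\<^sub>G \<le> \<eta>(G)\<close> is proved by induction on the number of vertices whose
neighbourhood is not a clique. Let \<open>v\<close> be such a vertex and let \<open>G\<^sub>v\<close> be \<open>G\<close> with the neighbourhood
of \<open>v\<close> completed to a clique. Then \<open>J\<^sub>G\<close> is the intersection of \<open>J\<close> of \<open>G\<^sub>v\<close> with
\<open>(x\<^sub>v, y\<^sub>v)\<close> plus \<open>J\<close> of \<open>G - v\<close>, and the sum of these two ideals is \<open>(x\<^sub>v, y\<^sub>v)\<close> plus \<open>J\<close> of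
\<open>G\<^sub>v - v\<close> (\<open>edge_ideal_Int\<close>, \<open>edge_ideal_sum\<close>). The first two graphs have \<open>\<eta>\<close> at most
\<open>\<eta>(G)\<close>, and the third has \<open>\<eta>\<close> at most \<open>\<eta>(G) - 1\<close>, because edges from \<open>v\<close> to two nonadjacent
neighbours can replace the at most one edge that lies inside the completed neighbourhood.

If there is no such vertex, \<open>G\<close> is a disjoint union of cliques. Take a vertex \<open>m\<close> of a clique with
at least two vertices. Then \<open>x\<^sub>m\<close> is a nonzerodivisor, since \<open>J\<^sub>G\<close> is the kernel of a monomial
parametrization (\<open>edge_ideal_iff_param\<close>). Modulo \<open>x\<^sub>m\<close>, the colon by \<open>y\<^sub>m\<close> replaces the whole
clique by its \<open>x\<close>-variables, which lowers \<open>\<eta>\<close> by one, and adding \<open>y\<^sub>m\<close> deletes the vertex \<open>m\<close>.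
All ideals in both inductions have the form \<open>edge_ideal n E Z\<close>, edge binomials plus variables, so
that the polynomial ring never changes.

The passage to minimal resolutions uses the same notion for quotients \<open>F/U\<close> of graded free modules
(\<open>module_regular\<close>). Regularity passes to the next syzygy module with \<open>r\<close> raised by one
(\<open>module_regular_syzygy\<close>), and a basis element of degree above \<open>r\<close> contradicts minimality
(\<open>module_regular_degree_bound\<close>); this bounds the Betti numbers of every minimal resolution. Since
\<open>betti\<close> selects some minimal resolution, one must also exist: regularity forces each syzygy module to
be generated in bounded degrees, hence by finitely many homogeneous elements, and a generating set of
least size gives the next differential (\<open>minimal_presentation\<close>).
\<close>

section \<open>Polynomials\<close>

abbreviation keys where "keys \<equiv> Poly_Mapping.keys"
abbreviation lookup where "lookup \<equiv> Poly_Mapping.lookup"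
abbreviation single where "single \<equiv> Poly_Mapping.single"

abbreviation polys :: "nat \<Rightarrow> 'k::field pol set" where
  "polys n \<equiv> carrier (Pol n)"

lemma poly_mapping_sum_singles: "(\<Sum>m\<in>keys p. single m (lookup p m)) = p"
  by (rule poly_mapping_eqI) (simp add: lookup_sum lookup_single when_def in_keys_iff)

lemma poly_mapping_induct [case_names zero single add]:
  assumes "P 0" "\<And>m c. P (single m c)" "\<And>p q. P p \<Longrightarrow> P q \<Longrightarrow> P (p + q)"
  shows "P (p :: 'a \<Rightarrow>\<^sub>0 'b::comm_monoid_add)"
proof -
  have "P (\<Sum>m\<in>M. single m (lookup p m))" if "finite M" for M
    using that by (induction M) (auto intro: assms)
  from this[of "keys p"] show ?thesis
    by (simp add: poly_mapping_sum_singles)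
qed

lemma polys_iff: "p \<in> polys n \<longleftrightarrow> (\<forall>m \<in> keys p. keys m \<subseteq> var_set n)"
  by (simp add: Pol_def)

lemma polys_zero [simp]: "0 \<in> polys n"
  and polys_one [simp]: "1 \<in> polys n"
  by (auto simp: Pol_def)

lemma polys_add [intro]: "p \<in> polys n \<Longrightarrow> q \<in> polys n \<Longrightarrow> p + q \<in> polys n"
  using cring.cring_simprules(1)[OF cring_Pol, of p n q] by (simp add: Pol_def)

lemma polys_mult [intro]: "p \<in> polys n \<Longrightarrow> q \<in> polys n \<Longrightarrow> p * q \<in> polys n"
  using cring.cring_simprules(5)[OF cring_Pol, of p n q] by (simp add: Pol_def)

lemma polys_uminus [intro]: "p \<in> polys n \<Longrightarrow> - p \<in> polys n"
  by (auto simp: Pol_def in_keys_iff)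

lemma polys_diff [intro]: "p \<in> polys n \<Longrightarrow> q \<in> polys n \<Longrightarrow> p - q \<in> polys n"
  using polys_add[of p n "- q"] polys_uminus[of q n] by simp

lemma polys_sum [intro]: "(\<And>i. i \<in> A \<Longrightarrow> f i \<in> polys n) \<Longrightarrow> sum f A \<in> polys n"
  by (induction A rule: infinite_finite_induct) auto

lemma polys_power [intro]: "p \<in> polys n \<Longrightarrow> p ^ k \<in> polys n"
  by (induction k) auto

lemma polys_single: "single m c \<in> polys n \<longleftrightarrow> c = 0 \<or> keys m \<subseteq> var_set n"
  by (auto simp: polys_iff)

lemma polys_Var [simp]: "Var v \<in> polys n \<longleftrightarrow> v \<in> var_set n"
  by (simp add: Var_def polys_single)

lemma polys_induct [consumes 1, case_names zero single add]:
  assumes "p \<in> polys n" "P 0" "\<And>m c. keys m \<subseteq> var_set n \<Longrightarrow> P (single m c)"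
    "\<And>p q. p \<in> polys n \<Longrightarrow> q \<in> polys n \<Longrightarrow> P p \<Longrightarrow> P q \<Longrightarrow> P (p + q)"
  shows "P p"
proof -
  have "(\<Sum>m\<in>M. single m (lookup p m)) \<in> polys n \<and> P (\<Sum>m\<in>M. single m (lookup p m))"
    if "finite M" "M \<subseteq> keys p" for M
    using that
  proof (induction M)
    case (insert m M)
    then have "keys m \<subseteq> var_set n"
      using assms(1) by (auto simp: polys_iff)
    with insert show ?case
      by (auto intro!: assms(3,4) polys_add simp: polys_single)
  qed (use assms(2) in simp)
  from this[of "keys p"] show ?thesis
    by (simp add: poly_mapping_sum_singles)
qed

lemma Var_mult_left_cancel: "Var v * p = Var v * q \<Longrightarrow> p = (q :: 'k::field pol)"
proof (rule poly_mapping_eqI)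
  fix k
  have *: "lookup (Var v * f) (single v 1 + k) = lookup f k" for f :: "'k pol"
  proof (induction f rule: poly_mapping_induct)
    case (single m c)
    show ?case
      by (auto simp: Var_def mult_single lookup_single when_def)
  qed (simp_all add: distrib_left lookup_add)
  assume "Var v * p = Var v * q"
  then show "lookup p k = lookup q k"
    using *[of p] *[of q] by simp
qed

lemma single_eq_Var_mult:
  assumes "lookup m v \<noteq> 0"
  shows "single m c = Var v * single (m - single v 1) c"
proof -
  have "single v 1 + (m - single v 1) = m"
    using assms by (intro poly_mapping_eqI) (auto simp: lookup_add lookup_minus lookup_single when_def)
  then show ?thesis
    by (simp add: Var_def mult_single)
qed


section \<open>Monomial substitutions\<close>

text \<open>Linear extension of a monomial map: terms on monomials that violate \<open>ok\<close> are dropped, the others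
are moved along \<open>\<pi>\<close>. It covers both setting variables to zero and the parametrization of a union of
cliques, so multiplicativity is proved once.\<close>

definition mono_subst :: "(monom \<Rightarrow> monom) \<Rightarrow> (monom \<Rightarrow> bool) \<Rightarrow> 'k::field pol \<Rightarrow> 'k pol" where
  "mono_subst \<pi> ok p = (\<Sum>m\<in>keys p. if ok m then single (\<pi> m) (lookup p m) else 0)"

lemma mono_subst_superset:
  assumes "finite M" "keys p \<subseteq> M"
  shows "mono_subst \<pi> ok p = (\<Sum>m\<in>M. if ok m then single (\<pi> m) (lookup p m) else 0)"
  unfolding mono_subst_def using assms by (intro sum.mono_neutral_left) (auto simp: in_keys_iff)

lemma mono_subst_0 [simp]: "mono_subst \<pi> ok 0 = 0"
  by (simp add: mono_subst_def)

lemma mono_subst_single [simp]: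
  "mono_subst \<pi> ok (single m c) = (if ok m then single (\<pi> m) c else 0)"
  by (simp add: mono_subst_def)

lemma mono_subst_add: "mono_subst \<pi> ok (p + q) = mono_subst \<pi> ok p + mono_subst \<pi> ok q"
proof -
  let ?M = "keys p \<union> keys q"
  have "keys (p + q) \<subseteq> ?M"
    by (rule Poly_Mapping.keys_add)
  then show ?thesis
    by (simp add: mono_subst_superset[of ?M])
       (auto simp: lookup_add single_add simp flip: sum.distrib intro: sum.cong)
qed

lemma mono_subst_uminus: "mono_subst \<pi> ok (- p) = - mono_subst \<pi> ok p"
  using mono_subst_add[of \<pi> ok p "- p"] by (simp add: eq_neg_iff_add_eq_0 add.commute)

lemma mono_subst_diff: "mono_subst \<pi> ok (p - q) = mono_subst \<pi> ok p - mono_subst \<pi> ok q"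
  using mono_subst_add[of \<pi> ok p "- q"] by (simp add: mono_subst_uminus)

lemma mono_subst_mult:
  assumes "\<And>m m'. \<pi> (m + m') = \<pi> m + \<pi> m'" "\<And>m m'. ok (m + m') \<longleftrightarrow> ok m \<and> ok m'"
  shows "mono_subst \<pi> ok (p * q) = mono_subst \<pi> ok p * mono_subst \<pi> ok q"
proof (induction p rule: poly_mapping_induct)
  case (single m c)
  show ?case
    by (induction q rule: poly_mapping_induct)
       (simp_all add: assms mult_single distrib_left mono_subst_add)
qed (simp_all add: distrib_right mono_subst_add)

definition set_zero :: "var set \<Rightarrow> 'k::field pol \<Rightarrow> 'k pol" where
  "set_zero Z = mono_subst (\<lambda>m. m) (\<lambda>m. keys m \<inter> Z = {})"

lemma keys_add_monom: "keys (m + m' :: monom) = keys m \<union> keys m'"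
  by (auto simp: in_keys_iff lookup_add)

lemma set_zero_0 [simp]: "set_zero Z 0 = 0"
  by (simp add: set_zero_def)

lemma set_zero_add: "set_zero Z (p + q) = set_zero Z p + set_zero Z q"
  by (simp add: set_zero_def mono_subst_add)

lemma set_zero_diff: "set_zero Z (p - q) = set_zero Z p - set_zero Z q"
  by (simp add: set_zero_def mono_subst_diff)

lemma set_zero_mult: "set_zero Z (p * q) = set_zero Z p * set_zero Z q"
  unfolding set_zero_def by (rule mono_subst_mult) (auto simp: keys_add_monom)

lemma set_zero_single: "set_zero Z (single m c) = (if keys m \<inter> Z = {} then single m c else 0)"
  by (simp add: set_zero_def)

lemma set_zero_Var [simp]: "set_zero Z (Var v) = (if v \<in> Z then 0 else Var v)"
  by (simp add: Var_def set_zero_single)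

lemma set_zero_in_polys [intro]: "p \<in> polys n \<Longrightarrow> set_zero Z p \<in> polys n"
  unfolding set_zero_def mono_subst_def by (intro polys_sum) (auto simp: polys_single polys_iff)

text \<open>Division with remainder by a variable; the existential form suffices because the quotient is
determined by cancellation.\<close>

lemma set_zero_one_var:
  assumes "p \<in> polys n"
  obtains q where "q \<in> polys n" "p = set_zero {v} p + Var v * q"
proof -
  have "\<exists>q \<in> polys n. p = set_zero {v} p + Var v * q"
    using assms
  proof (induction rule: polys_induct)
    case zero
    show ?case by (intro bexI[of _ 0]) auto
  next
    case (single m c)
    show ?case
    proof (cases "v \<in> keys m")
      case True
      have "keys (m - single v 1) \<subseteq> keys m"
        by (auto simp: in_keys_iff lookup_minus)
      with True single show ?thesis
        by (intro bexI[of _ "single (m - single v 1) c"])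
           (auto simp: set_zero_single polys_single in_keys_iff single_eq_Var_mult[symmetric, of _ v, simplified])
    next
      case False
      then show ?thesis by (intro bexI[of _ 0]) (auto simp: set_zero_single)
    qed
  next
    case (add p q)
    then obtain p' q' where "p' \<in> polys n" "q' \<in> polys n"
      "p = set_zero {v} p + Var v * p'" "q = set_zero {v} q + Var v * q'" by blast
    have "p + q = set_zero {v} p + Var v * p' + (set_zero {v} q + Var v * q')"
      using \<open>p = _\<close> \<open>q = _\<close> by (rule arg_cong2)
    also have "\<dots> = set_zero {v} (p + q) + Var v * (p' + q')"
      by (simp only: set_zero_add distrib_left ac_simps)
    finally have "p + q = set_zero {v} (p + q) + Var v * (p' + q')" .
    then show ?case
      using \<open>p' \<in> _\<close> \<open>q' \<in> _\<close> by blast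
  qed
  then show ?thesis using that by blast
qed


section \<open>Homogeneous components\<close>

definition mdeg :: "monom \<Rightarrow> nat" where
  "mdeg m = (\<Sum>v\<in>keys m. lookup m v)"

lemma mdeg_add: "mdeg (m + m') = mdeg m + mdeg m'"
  unfolding mdeg_def by (rule setsum_keys_plus_distrib) auto

lemma mdeg_single [simp]: "mdeg (single v k) = k"
  by (cases "k = 0") (simp_all add: mdeg_def)

lemma mdeg_0 [simp]: "mdeg 0 = 0"
  by (simp add: mdeg_def)

lemma mdeg_eq_0_iff [simp]: "mdeg m = 0 \<longleftrightarrow> m = 0"
  by (auto simp: mdeg_def in_keys_iff intro: poly_mapping_eqI)

lemma homogeneous_iff: "homogeneous a p \<longleftrightarrow> (\<forall>m. lookup p m \<noteq> 0 \<longrightarrow> int (mdeg m) = a)"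
  by (auto simp: homogeneous_def mdeg_def in_keys_iff)

lift_definition restrict_terms :: "('a \<Rightarrow> bool) \<Rightarrow> ('a \<Rightarrow>\<^sub>0 'b::zero) \<Rightarrow> 'a \<Rightarrow>\<^sub>0 'b" is
  "\<lambda>Q f k. if Q k then f k else 0"
  by (rule finite_subset) auto

definition hom_part :: "int \<Rightarrow> 'k::field pol \<Rightarrow> 'k pol" where
  "hom_part a = restrict_terms (\<lambda>m. int (mdeg m) = a)"

lemma lookup_hc: "lookup (hom_part a p) m = (if int (mdeg m) = a then lookup p m else 0)"
  by (simp add: hom_part_def restrict_terms.rep_eq)

lemma hom_part_0 [simp]: "hom_part a 0 = 0"
  by (rule poly_mapping_eqI) (simp add: lookup_hc)

lemma hom_part_add: "hom_part a (p + q) = hom_part a p + hom_part a q"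
  by (rule poly_mapping_eqI) (simp add: lookup_hc lookup_add)

lemma hom_part_diff: "hom_part a (p - q) = hom_part a p - hom_part a q"
  by (rule poly_mapping_eqI) (simp add: lookup_hc lookup_minus)

lemma hom_part_uminus: "hom_part a (- p) = - hom_part a p"
  by (rule poly_mapping_eqI) (simp add: lookup_hc)

lemma hom_part_sum: "hom_part a (sum f A) = (\<Sum>i\<in>A. hom_part a (f i))"
  by (induction A rule: infinite_finite_induct) (simp_all add: hom_part_add)

lemma hom_part_in_polys [intro]: "p \<in> polys n \<Longrightarrow> hom_part a p \<in> polys n"
  by (auto simp: polys_iff in_keys_iff lookup_hc split: if_splits)

lemma homogeneous_hc [simp]: "homogeneous a (hom_part a p)"
  by (simp add: homogeneous_iff lookup_hc)

lemma hom_part_homogeneous: "homogeneous b p \<Longrightarrow> hom_part a p = (if a = b then p else 0)"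
  by (rule poly_mapping_eqI) (auto simp: lookup_hc homogeneous_iff)

lemma homogeneous_iff_hc: "homogeneous a p \<longleftrightarrow> hom_part a p = p"
  using hom_part_homogeneous[of a p a] homogeneous_hc[of a p] by metis

lemma homogeneous_0 [simp]: "homogeneous a 0"
  by (simp add: homogeneous_iff)

lemma homogeneous_1 [simp]: "homogeneous 0 1"
  by (simp add: homogeneous_iff lookup_one when_def)

lemma homogeneous_Var [simp]: "homogeneous 1 (Var v)"
  by (auto simp: homogeneous_iff Var_def lookup_single when_def)

lemma homogeneous_diff: "homogeneous a p \<Longrightarrow> homogeneous a q \<Longrightarrow> homogeneous a (p - q)"
  by (simp add: homogeneous_iff_hc hom_part_diff)

lemma homogeneous_uminus: "homogeneous a p \<Longrightarrow> homogeneous a (- p)"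
  by (simp add: homogeneous_iff_hc hom_part_uminus)

lemma homogeneous_sum: "(\<And>i. i \<in> A \<Longrightarrow> homogeneous a (f i)) \<Longrightarrow> homogeneous a (sum f A)"
  by (simp add: homogeneous_iff_hc hom_part_sum)

lemma homogeneous_negative: "a < 0 \<Longrightarrow> homogeneous a p \<Longrightarrow> p = 0"
  by (rule poly_mapping_eqI) (auto simp: homogeneous_iff)

text \<open>It is enough to compare single terms, after writing \<open>q\<close> as its own homogeneous component so that
the homogeneity hypothesis disappears from the induction.\<close>

lemma hom_part_mult_homogeneous:
  assumes "homogeneous b q"
  shows "hom_part a (p * q) = hom_part (a - b) p * q"
proof -
  have hs: "hom_part a (single m c) = (if int (mdeg m) = a then single m c else 0)" for a m and c :: 'a
    by (rule poly_mapping_eqI) (auto simp: lookup_hc lookup_single when_def)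
  have "hom_part a (p * hom_part b q) = hom_part (a - b) p * hom_part b q"
  proof (induction p rule: poly_mapping_induct)
    case (single m c)
    show ?case
      by (induction q rule: poly_mapping_induct)
         (auto simp: hs mult_single mdeg_add hom_part_add distrib_left)
  qed (simp_all add: hom_part_add distrib_right)
  then show ?thesis
    using assms by (simp add: homogeneous_iff_hc)
qed

lemma homogeneous_mult:
  assumes "homogeneous a p" "homogeneous b q" shows "homogeneous (a + b) (p * q)"
  using assms hom_part_mult_homogeneous[OF assms(2), of "a + b" p] by (simp add: homogeneous_iff_hc)

lemma hom_part_Var_mult: "hom_part a (Var v * p) = Var v * hom_part (a - 1) p"
  using hom_part_mult_homogeneous[OF homogeneous_Var[of v], of a p] by (simp add: mult.commute)

lemma sum_hc:
  assumes "finite D" "\<And>m. m \<in> keys p \<Longrightarrow> int (mdeg m) \<in> D"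
  shows "(\<Sum>a\<in>D. hom_part a p) = p"
proof (rule poly_mapping_eqI)
  fix m show "lookup (\<Sum>a\<in>D. hom_part a p) m = lookup p m"
    using assms by (cases "m \<in> keys p") (auto simp: lookup_sum lookup_hc in_keys_iff)
qed


section \<open>Ideals\<close>

lemma ideal_PolI:
  fixes I :: "'k::field pol set"
  assumes "I \<subseteq> polys n" "0 \<in> I" "\<And>p q. p \<in> I \<Longrightarrow> q \<in> I \<Longrightarrow> p + q \<in> I"
    "\<And>p q. p \<in> polys n \<Longrightarrow> q \<in> I \<Longrightarrow> p * q \<in> I"
  shows "ideal I (Pol n)"
proof (rule idealI)
  show "ring (Pol n :: 'k pol ring)"
    using cring_Pol cring.axioms(1) by blast
  interpret cring "Pol n :: 'k pol ring" by (rule cring_Pol)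
  have neg: "\<ominus>\<^bsub>Pol n\<^esub> p = - p" if "p \<in> polys n" for p :: "'k pol"
  proof -
    have "- p \<oplus>\<^bsub>Pol n\<^esub> p = \<zero>\<^bsub>Pol n\<^esub>" by (simp add: Pol_def)
    then show ?thesis using that polys_uminus[OF that] minus_equality by blast
  qed
  show "subgroup I (add_monoid (Pol n))"
  proof (rule subgroup.intro)
    fix p assume "p \<in> I"
    moreover have "- p = (- 1) * p" by simp
    ultimately have "- p \<in> I"
      using assms(4)[of "-1" p] polys_uminus[OF polys_one, of n] by simp
    then show "inv\<^bsub>add_monoid (Pol n)\<^esub> p \<in> I"
      using neg[of p] \<open>p \<in> I\<close> assms(1) by (auto simp: a_inv_def)
  qed (use assms in \<open>auto simp: Pol_def\<close>)
next
  fix a x :: "'k pol" assume *: "a \<in> I" "x \<in> polys n"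
  then show "x \<otimes>\<^bsub>Pol n\<^esub> a \<in> I"
    using assms(4)[of x a] by (simp add: Pol_def)
  show "a \<otimes>\<^bsub>Pol n\<^esub> x \<in> I"
    using assms(4)[of x a] * by (simp add: Pol_def mult.commute)
qed

locale pol_ideal =
  fixes n :: nat and I :: "'k::field pol set"
  assumes is_ideal: "ideal I (Pol n)"
begin

lemma sub: "I \<subseteq> polys n"
  using ideal.Icarr[OF is_ideal] by blast

lemma zero_mem [simp]: "0 \<in> I"
  using additive_subgroup.zero_closed[OF ideal.axioms(1)[OF is_ideal]] by (simp add: Pol_def)

lemma add_mem: "p \<in> I \<Longrightarrow> q \<in> I \<Longrightarrow> p + q \<in> I"
  using additive_subgroup.a_closed[OF ideal.axioms(1)[OF is_ideal], of p q] by (simp add: Pol_def)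

lemma mult_mem: "p \<in> polys n \<Longrightarrow> q \<in> I \<Longrightarrow> p * q \<in> I"
  using ideal.I_l_closed[OF is_ideal, of q p] by (simp add: Pol_def)

lemma mult_mem': "p \<in> I \<Longrightarrow> q \<in> polys n \<Longrightarrow> p * q \<in> I"
  using mult_mem[of q p] by (simp add: mult.commute)

lemma uminus_mem: "p \<in> I \<Longrightarrow> - p \<in> I"
  using mult_mem[of "-1" p] polys_uminus[OF polys_one, of n] by simp

lemma diff_mem: "p \<in> I \<Longrightarrow> q \<in> I \<Longrightarrow> p - q \<in> I"
  using add_mem[of p "- q"] uminus_mem[of q] by simp

lemma sum_mem: "(\<And>i. i \<in> A \<Longrightarrow> f i \<in> I) \<Longrightarrow> sum f A \<in> I"
  by (induction A rule: infinite_finite_induct) (auto intro: add_mem)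

end

lemma pol_ideal_iff: "pol_ideal n I \<longleftrightarrow> ideal I (Pol n)"
  by (simp add: pol_ideal_def)

lemmas pol_idealI = ideal_PolI[folded pol_ideal_iff]

lemma pol_ideal_Idl: "G \<subseteq> polys n \<Longrightarrow> pol_ideal n (Idl\<^bsub>Pol n\<^esub> G)"
  unfolding pol_ideal_iff by (rule ring.genideal_ideal[OF cring.axioms(1)[OF cring_Pol]])

lemma Idl_incl: "G \<subseteq> polys n \<Longrightarrow> g \<in> G \<Longrightarrow> g \<in> Idl\<^bsub>Pol n\<^esub> G"
  using ring.genideal_self cring_Pol cring.axioms(1) by blast

lemma Idl_subset: "pol_ideal n I \<Longrightarrow> G \<subseteq> I \<Longrightarrow> Idl\<^bsub>Pol n\<^esub> G \<subseteq> I"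
  by (metis pol_ideal_iff ring.genideal_minimal cring_Pol cring.axioms(1))

lemma pol_ideal_vimage:
  assumes "pol_ideal n J" "\<And>p q. f (p + q) = f p + f q" "\<And>p q. f (p * q) = f p * f q"
    "\<And>p. p \<in> polys n \<Longrightarrow> f p \<in> polys n" "f 0 = 0"
  shows "pol_ideal n {p \<in> polys n. f p \<in> J}"
proof -
  interpret pol_ideal n J by fact
  show ?thesis
    by (rule pol_idealI) (auto simp: assms intro: add_mem mult_mem)
qed

locale graded_ideal = pol_ideal +
  assumes hom_part_mem: "p \<in> I \<Longrightarrow> hom_part a p \<in> I"

text \<open>The polynomials whose multiples have all their homogeneous components in the ideal form an ideal, and
it contains the homogeneous generators.\<close>

lemma graded_Idl:
  fixes G :: "'k::field pol set"
  assumes G: "G \<subseteq> polys n" and h: "\<And>g. g \<in> G \<Longrightarrow> \<exists>b. homogeneous b g"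
  shows "graded_ideal n (Idl\<^bsub>Pol n\<^esub> G)"
proof -
  interpret pol_ideal n "Idl\<^bsub>Pol n\<^esub> G" using G by (rule pol_ideal_Idl)
  define M where "M = {p \<in> polys n. \<forall>q \<in> polys n. \<forall>a. hom_part a (q * p) \<in> Idl\<^bsub>Pol n\<^esub> G}"
  have "pol_ideal n M"
  proof (rule pol_idealI)
    fix p q :: "'k pol" assume "p \<in> polys n" "q \<in> M"
    then show "p * q \<in> M"
      by (auto simp: M_def mult.assoc[symmetric])
  qed (auto simp: M_def distrib_left hom_part_add intro: add_mem)
  moreover have "G \<subseteq> M"
  proof
    fix g assume g: "g \<in> G"
    then obtain b where "homogeneous b g" using h by blast
    with g G show "g \<in> M"
      by (auto simp: M_def hom_part_mult_homogeneous intro!: mult_mem intro: Idl_incl)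
  qed
  ultimately have "Idl\<^bsub>Pol n\<^esub> G \<subseteq> M" by (rule Idl_subset)
  then show ?thesis
    by unfold_locales (auto simp: M_def dest!: subsetD bspec[of _ _ 1])
qed

lemma irrelevant_ideal_iff: "p \<in> irrelevant_ideal n \<longleftrightarrow> p \<in> polys n \<and> lookup p 0 = 0"
proof -
  let ?G = "Var ` var_set n :: 'a pol set"
  have G: "?G \<subseteq> polys n" by auto
  interpret pol_ideal n "irrelevant_ideal n :: 'a pol set"
    unfolding irrelevant_ideal_def using G by (rule pol_ideal_Idl)
  have hc0: "lookup (p * q) 0 = 0" if "lookup q 0 = 0" for p q :: "'a pol"
  proof -
    have l: "lookup (single m c * q) 0 = (if m = 0 then c * lookup q 0 else 0)" for m c and q :: "'a pol"
      by (induction q rule: poly_mapping_induct)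
         (auto simp: mult_single lookup_single when_def distrib_left lookup_add
               simp flip: mdeg_eq_0_iff simp: mdeg_add)
    show ?thesis
      by (induction p rule: poly_mapping_induct) (simp_all add: l that distrib_right lookup_add)
  qed
  have "pol_ideal n {p \<in> polys n. lookup p (0::monom) = (0 :: 'a)}"
    by (rule pol_idealI) (auto simp: lookup_add hc0)
  moreover have "?G \<subseteq> {p \<in> polys n. lookup p (0::monom) = 0}"
    by (auto simp: Var_def lookup_single when_def polys_single simp flip: mdeg_eq_0_iff)
  ultimately have 1: "irrelevant_ideal n \<subseteq> {p \<in> polys n. lookup p (0::monom) = (0::'a)}"
    unfolding irrelevant_ideal_def by (rule Idl_subset)
  have 2: "p - single 0 (lookup p 0) \<in> irrelevant_ideal n" if "p \<in> polys n" for p :: "'a pol"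
    using that
  proof (induction rule: polys_induct)
    case (single m c)
    show ?case
    proof (cases "m = 0")
      case False
      then obtain v where v: "lookup m v \<noteq> 0"
        by (metis poly_mapping_eqI lookup_zero)
      have "keys (m - single v 1) \<subseteq> keys m"
        by (auto simp: in_keys_iff lookup_minus)
      moreover have "v \<in> var_set n"
        using v single by (auto simp: in_keys_iff)
      then have "Var v \<in> (irrelevant_ideal n :: 'a pol set)"
        unfolding irrelevant_ideal_def by (intro Idl_incl[OF G] imageI)
      ultimately have "Var v * single (m - single v 1) c \<in> irrelevant_ideal n"
        using single by (intro mult_mem') (auto simp: polys_single)
      then have "single m c \<in> irrelevant_ideal n"
        by (simp only: single_eq_Var_mult[OF v, of c])
      with False show ?thesis
        by (simp add: lookup_single_not_eq)
    qed simp
  next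
    case (add p q)
    then show ?case
      using add_mem[of "p - single 0 (lookup p 0)" "q - single 0 (lookup q 0)"]
      by (simp add: lookup_add single_add algebra_simps)
  qed simp
  show ?thesis
    using 1 2[of p] sub by auto
qed


section \<open>The Koszul complex\<close>

text \<open>An arbitrary linear order on the variables, which fixes the signs of the Koszul complex.\<close>

fun var_index :: "var \<Rightarrow> nat" where
  "var_index (X i) = 2 * i"
| "var_index (Y i) = 2 * i + 1"

lemma var_index_inject [simp]: "var_index u = var_index v \<longleftrightarrow> u = v"
  by (cases u; cases v) (auto, presburger+)

definition ksign :: "var \<Rightarrow> var set \<Rightarrow> 'k::field pol" where
  "ksign v T = (- 1) ^ card {u \<in> T. var_index u < var_index v}"

text \<open>A chain assigns to each set \<open>T\<close> of variables the coefficient of the exterior monomial of \<open>T\<close>; chains of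
all exterior degrees are treated at once. The sum ranges over the variables outside \<open>T\<close> because the
differential is written by its coefficient at \<open>T\<close>, so that it is defined for every set \<open>T\<close>.\<close>

definition bd :: "nat \<Rightarrow> (var set \<Rightarrow> 'k::field pol) \<Rightarrow> var set \<Rightarrow> 'k pol" where
  "bd n c T = (\<Sum>v \<in> var_set n - T. ksign v T * Var v * c (insert v T))"

definition wedge :: "var \<Rightarrow> (var set \<Rightarrow> 'k::field pol) \<Rightarrow> var set \<Rightarrow> 'k pol" where
  "wedge l c T = (if l \<in> T then ksign l T * c (T - {l}) else 0)"

lemma finite_var_set [simp]: "finite (var_set n)"
  by (simp add: var_set_def)

lemma ksign_in_polys [simp]: "ksign v T \<in> polys n"
  unfolding ksign_def by (intro polys_power polys_uminus polys_one)

lemma ksign_square: "ksign v T * ksign v T = 1"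
  by (simp add: ksign_def flip: power_mult_distrib)

lemma ksign_insert:
  assumes "u \<notin> T"
  shows "ksign v (insert u T) =
    (if var_index u < var_index v then - ksign v T else ksign v T)"
proof -
  have "finite {u \<in> T. var_index u < var_index v}"
    by (rule finite_imageD[of var_index]) (auto intro: finite_subset[of _ "{..<var_index v}"] inj_onI)
  moreover have "{w \<in> insert u T. var_index w < var_index v} =
      (if var_index u < var_index v then insert u {w \<in> T. var_index w < var_index v}
       else {w \<in> T. var_index w < var_index v})"
    by auto
  ultimately show ?thesis
    using assms by (simp add: ksign_def)
qed

lemma ksign_insert_same [simp]: "ksign v (insert v T) = ksign v T"
  unfolding ksign_def by (intro arg_cong[where f = "\<lambda>A. (- 1) ^ card A"]) auto

lemma ksign_swap:
  assumes "u \<notin> T" "v \<notin> T" "u \<noteq> v"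
  shows "ksign v T * ksign u (insert v T) = - (ksign u T * ksign v (insert u T))"
proof -
  have "var_index u < var_index v \<or> var_index v < var_index u"
    using assms(3) by (metis linorder_neqE_nat var_index_inject)
  then show ?thesis
    using assms by (auto simp: ksign_insert mult.commute)
qed

text \<open>The terms cancel in pairs. Peeling off one index at a time avoids dividing by two, so this holds in
every characteristic.\<close>

lemma sum_antisymmetric:
  fixes f :: "'a \<Rightarrow> 'a \<Rightarrow> 'b::ab_group_add"
  assumes "finite A" "\<And>u v. u \<in> A \<Longrightarrow> v \<in> A \<Longrightarrow> u \<noteq> v \<Longrightarrow> f u v = - f v u"
  shows "(\<Sum>v\<in>A. \<Sum>u\<in>A - {v}. f v u) = 0"
  using assms
proof (induction A)
  case (insert a A)
  have "(\<Sum>v\<in>A. \<Sum>u\<in>insert a A - {v}. f v u) = (\<Sum>v\<in>A. f v a + (\<Sum>u\<in>A - {v}. f v u))"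
  proof (rule sum.cong)
    fix v assume "v \<in> A"
    then have "insert a A - {v} = insert a (A - {v})" "a \<notin> A - {v}"
      using insert.hyps by auto
    then show "(\<Sum>u\<in>insert a A - {v}. f v u) = f v a + (\<Sum>u\<in>A - {v}. f v u)"
      using insert.hyps by simp
  qed simp
  also have "\<dots> = (\<Sum>v\<in>A. f v a)"
    using insert.IH[OF insert.prems, OF insertI2 insertI2] by (simp add: sum.distrib)
  also have "\<dots> = - (\<Sum>u\<in>A. f a u)"
    unfolding sum_negf[symmetric]
    by (rule sum.cong[OF refl], rule insert.prems) (use insert.hyps in auto)
  finally show ?case
    using insert.hyps by simp
qed simp

lemma bd_bd [simp]: "bd n (bd n c) T = 0"
proof -
  let ?f = "\<lambda>v u. ksign v T * ksign u (insert v T) * (Var v * Var u * c (insert u (insert v T)))"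
  have "bd n (bd n c) T = (\<Sum>v\<in>var_set n - T. \<Sum>u\<in>var_set n - T - {v}. ?f v u)"
    unfolding bd_def sum_distrib_left
    by (intro sum.cong) (auto simp: mult_ac)
  also have "\<dots> = 0"
  proof (rule sum_antisymmetric)
    fix u v assume "u \<in> var_set n - T" "v \<in> var_set n - T" "u \<noteq> v"
    then have *: "ksign u T * ksign v (insert u T) =
        (- (ksign v T * ksign u (insert v T)) :: 'a pol)"
      by (intro ksign_swap) auto
    show "?f u v = - ?f v u"
      unfolding * by (simp add: insert_commute mult.commute)
  qed simp
  finally show ?thesis .
qed

lemma bd_cong: "(\<And>T. c T = d T) \<Longrightarrow> bd n c T = bd n d T"
  by (simp add: bd_def)

lemma bd_0 [simp]: "bd n (\<lambda>T. 0) T = 0"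
  by (simp add: bd_def)

lemma bd_add: "bd n (\<lambda>T. c T + d T) T = bd n c T + bd n d T"
  by (simp add: bd_def distrib_left sum.distrib)

lemma bd_diff: "bd n (\<lambda>T. c T - d T) T = bd n c T - bd n d T"
  by (simp add: bd_def right_diff_distrib sum_subtractf)

lemma bd_mult: "bd n (\<lambda>T. p * c T) T = p * bd n c T"
  by (simp add: bd_def sum_distrib_left mult_ac)

lemma bd_sum: "bd n (\<lambda>T. \<Sum>i\<in>A. c i T) T = (\<Sum>i\<in>A. bd n (c i) T)"
  by (induction A rule: infinite_finite_induct) (simp_all add: bd_add)

lemma homogeneous_ksign: "homogeneous 0 (ksign v T)"
proof -
  have "homogeneous 0 ((- 1 :: 'a pol) ^ k)" for k
    by (induction k) (auto dest: homogeneous_uminus)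
  then show ?thesis by (simp add: ksign_def)
qed

lemma hom_part_bd: "hom_part a (bd n c T) = bd n (\<lambda>T. hom_part (a - 1) (c T)) T"
proof -
  have "hom_part a (ksign v T * Var v * p) = ksign v T * Var v * hom_part (a - 1) p" for v and p :: "'a pol"
  proof -
    have "hom_part a (ksign v T * Var v * p) = hom_part a ((Var v * p) * ksign v T)"
      by (simp only: mult_ac)
    also have "\<dots> = Var v * hom_part (a - 1) p * ksign v T"
      by (simp add: hom_part_mult_homogeneous[OF homogeneous_ksign] hom_part_Var_mult)
    finally show ?thesis by (simp only: mult_ac)
  qed
  then show ?thesis
    by (simp add: bd_def hom_part_sum)
qed

lemma homogeneous_bd: "(\<And>T. homogeneous (a - 1) (c T)) \<Longrightarrow> homogeneous a (bd n c T)"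
  by (simp add: homogeneous_iff_hc hom_part_bd)

lemma (in pol_ideal) bd_mem: "(\<And>T. c T \<in> I) \<Longrightarrow> bd n c T \<in> I"
  unfolding bd_def by (intro sum_mem mult_mem polys_mult) auto

lemma pol_ideal_polys: "pol_ideal n (polys n)"
  by (rule pol_idealI) auto

lemmas bd_in_polys = pol_ideal.bd_mem[OF pol_ideal_polys]

lemma wedge_in_polys: "(\<And>T. c T \<in> polys n) \<Longrightarrow> wedge l c T \<in> polys n"
  by (auto simp: wedge_def)

lemma (in pol_ideal) wedge_mem: "(\<And>T. c T \<in> I) \<Longrightarrow> wedge l c T \<in> I"
  by (auto simp: wedge_def intro!: mult_mem)

text \<open>Exterior multiplication by \<open>l\<close> is a homotopy from multiplication by \<open>l\<close> to zero: variables act as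
zero on Koszul homology.\<close>

lemma bd_wedge:
  assumes "l \<in> var_set n"
  shows "bd n (wedge l c) T + wedge l (bd n c) T = Var l * c T"
proof (cases "l \<in> T")
  case False
  have "bd n (wedge l c) T = (\<Sum>v\<in>{l}. ksign v T * Var v * wedge l c (insert v T))"
    unfolding bd_def using False assms by (intro sum.mono_neutral_right) (auto simp: wedge_def)
  also have "\<dots> = (ksign l T * ksign l T) * (Var l * c T)"
    using False by (simp add: wedge_def mult_ac)
  finally show ?thesis
    using False by (simp add: ksign_square wedge_def)
next
  case True
  define T' where "T' = T - {l}"
  have T: "T = insert l T'" "l \<notin> T'"
    using True by (auto simp: T'_def)
  have "wedge l (bd n c) T = ksign l T' * (\<Sum>v\<in>var_set n - T'. ksign v T' * Var v * c (insert v T'))"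
    using T by (simp add: wedge_def bd_def)
  also have "var_set n - T' = insert l (var_set n - T)"
    using T assms by auto
  also have "(\<Sum>v\<in>insert l (var_set n - T). ksign v T' * Var v * c (insert v T')) =
      ksign l T' * Var l * c T + (\<Sum>v\<in>var_set n - T. ksign v T' * Var v * c (insert v T'))"
    using T by simp
  also have "ksign l T' * \<dots> = (ksign l T' * ksign l T') * (Var l * c T)
      + (\<Sum>v\<in>var_set n - T. ksign l T' * ksign v T' * (Var v * c (insert v T')))"
    by (simp add: distrib_left sum_distrib_left mult_ac)
  finally have 1: "wedge l (bd n c) T = Var l * c T
      + (\<Sum>v\<in>var_set n - T. ksign l T' * ksign v T' * (Var v * c (insert v T')))"
    by (simp add: ksign_square)
  have 2: "bd n (wedge l c) T =
      (\<Sum>v\<in>var_set n - T. - (ksign l T' * ksign v T' * (Var v * c (insert v T'))))"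
    unfolding bd_def
  proof (rule sum.cong)
    fix v assume v: "v \<in> var_set n - T"
    then have "insert v T - {l} = insert v T'" "v \<notin> T'" "v \<noteq> l"
      using T by auto
    then have "ksign v T * Var v * wedge l c (insert v T) =
        ksign v (insert l T') * ksign l (insert v T') * (Var v * c (insert v T'))"
      using T by (simp add: wedge_def insert_commute[of v l] mult_ac)
    also have "ksign v (insert l T') * ksign l (insert v T') =
        (ksign l T' * ksign l T') * (ksign v (insert l T') * ksign l (insert v T'))"
      by (simp add: ksign_square)
    also have "\<dots> = ksign l T' * (ksign l T' * ksign v (insert l T')) * ksign l (insert v T')"
      by (simp only: mult_ac)
    also have "ksign l T' * ksign v (insert l T') = - (ksign v T' * ksign l (insert v T'))"
      using T \<open>v \<notin> T'\<close> \<open>v \<noteq> l\<close> by (intro ksign_swap) auto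
    also have "ksign l T' * - (ksign v T' * ksign l (insert v T')) * ksign l (insert v T')
       = - (ksign l T' * ksign v T' * (ksign l (insert v T') * ksign l (insert v T')))"
      by (simp add: mult_ac)
    finally show "ksign v T * Var v * wedge l c (insert v T) =
        - (ksign l T' * ksign v T' * (Var v * c (insert v T')))"
      by (simp add: ksign_square)
  qed simp
  show ?thesis
    unfolding 1 2 by (simp add: sum_negf)
qed


section \<open>Koszul regularity and exact sequences\<close>

text \<open>The chain \<open>e\<close> may be arbitrary: for a graded ideal its component of degree \<open>a - 1\<close> serves as well
(\<open>koszul_regularD\<close>).\<close>

definition koszul_regular :: "nat \<Rightarrow> 'k::field pol set \<Rightarrow> int \<Rightarrow> bool" where
  "koszul_regular n I r \<longleftrightarrow>
     (\<forall>a > r. \<forall>c. (\<forall>T. c T \<in> polys n \<and> homogeneous a (c T) \<and> bd n c T \<in> I) \<longrightarrow>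
        (\<exists>e. \<forall>T. e T \<in> polys n \<and> c T - bd n e T \<in> I))"

lemma koszul_regularE:
  assumes "koszul_regular n I r" "a > r"
    "\<And>T. c T \<in> polys n" "\<And>T. homogeneous a (c T)" "\<And>T. bd n c T \<in> I"
  shows "\<exists>e. \<forall>T. e T \<in> polys n \<and> c T - bd n e T \<in> I"
  using assms(1)[unfolded koszul_regular_def, rule_format, of a c] assms(2-5) by simp

lemma koszul_regularD:
  assumes "koszul_regular n I r" "graded_ideal n I" "a > r"
    "\<And>T. c T \<in> polys n" "\<And>T. homogeneous a (c T)" "\<And>T. bd n c T \<in> I"
  shows "\<exists>e. \<forall>T. e T \<in> polys n \<and> homogeneous (a - 1) (e T) \<and> c T - bd n e T \<in> I"
proof -
  interpret graded_ideal n I by fact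
  obtain e where "\<forall>T. e T \<in> polys n \<and> c T - bd n e T \<in> I"
    using koszul_regularE[OF assms(1,3-6)] by blast
  then have e: "\<And>T. e T \<in> polys n" "\<And>T. c T - bd n e T \<in> I"
    by auto
  have "c T - bd n (\<lambda>T. hom_part (a - 1) (e T)) T \<in> I" for T
  proof -
    have "hom_part a (c T - bd n e T) \<in> I" using e(2) by (rule hom_part_mem)
    also have "hom_part a (c T - bd n e T) = c T - bd n (\<lambda>T. hom_part (a - 1) (e T)) T"
      using assms(5)[of T] by (simp add: hom_part_diff hom_part_bd homogeneous_iff_hc)
    finally show ?thesis .
  qed
  then show ?thesis
    using e(1) by (intro exI[of _ "\<lambda>T. hom_part (a - 1) (e T)"]) auto
qed

text \<open>This is the long exact sequence of \<open>0 \<rightarrow> S/(A \<inter> B) \<rightarrow> S/A \<oplus> S/B \<rightarrow> S/(A + B) \<rightarrow> 0\<close>, with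
\<open>C = A + B\<close>: if a chain is the boundary of \<open>e\<close> modulo \<open>A\<close> and of \<open>f\<close> modulo \<open>B\<close>, then \<open>e - f\<close> is
a cycle modulo \<open>C\<close>.\<close>

lemma koszul_regular_Int:
  assumes A: "graded_ideal n A" and B: "graded_ideal n B" and C: "graded_ideal n C"
    and "A \<subseteq> C" "B \<subseteq> C" and dec: "\<And>p. p \<in> C \<Longrightarrow> \<exists>x\<in>A. \<exists>y\<in>B. p = x + y"
    and reg: "koszul_regular n A r" "koszul_regular n B r" "koszul_regular n C (r - 1)"
  shows "koszul_regular n (A \<inter> B) r"
  unfolding koszul_regular_def
proof safe
  interpret A: graded_ideal n A by fact
  interpret B: graded_ideal n B by fact
  interpret C: graded_ideal n C by fact
  fix a c assume a: "a > r" and "\<forall>T. c T \<in> polys n \<and> homogeneous a (c T) \<and> bd n c T \<in> A \<inter> B"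
  then have c: "\<And>T. c T \<in> polys n" "\<And>T. homogeneous a (c T)" "\<And>T. bd n c T \<in> A" "\<And>T. bd n c T \<in> B"
    by auto
  obtain e where "\<forall>T. e T \<in> polys n \<and> homogeneous (a - 1) (e T) \<and> c T - bd n e T \<in> A"
    using koszul_regularD[OF reg(1) A a c(1-3)] by blast
  then have e: "\<And>T. e T \<in> polys n" "\<And>T. homogeneous (a - 1) (e T)" "\<And>T. c T - bd n e T \<in> A"
    by auto
  obtain f where "\<forall>T. f T \<in> polys n \<and> homogeneous (a - 1) (f T) \<and> c T - bd n f T \<in> B"
    using koszul_regularD[OF reg(2) B a c(1,2,4)] by blast
  then have f: "\<And>T. f T \<in> polys n" "\<And>T. homogeneous (a - 1) (f T)" "\<And>T. c T - bd n f T \<in> B"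
    by auto
  have ef: "bd n (\<lambda>T. e T - f T) T \<in> C" for T
  proof -
    have "bd n (\<lambda>T. e T - f T) T = (c T - bd n f T) - (c T - bd n e T)"
      by (simp add: bd_diff)
    then show ?thesis
      using C.diff_mem[OF subsetD[OF \<open>B \<subseteq> C\<close> f(3)[of T]] subsetD[OF \<open>A \<subseteq> C\<close> e(3)[of T]]]
      by (simp only:)
  qed
  have a': "a - 1 > r - 1" using a by simp
  obtain g where "\<forall>T. g T \<in> polys n \<and> e T - f T - bd n g T \<in> C"
    using koszul_regularD[OF reg(3) C a' polys_diff[OF e(1) f(1)] homogeneous_diff[OF e(2) f(2)] ef] by blast
  then have g: "\<And>T. g T \<in> polys n" "\<And>T. e T - f T - bd n g T \<in> C"
    by auto
  have "\<exists>x y. x \<in> A \<and> y \<in> B \<and> e T - f T - bd n g T = x + y" for T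
    using dec[OF g(2)[of T]] by blast
  then obtain x y where xy: "\<And>T. x T \<in> A" "\<And>T. y T \<in> B" "\<And>T. e T - f T - bd n g T = x T + y T"
    by metis
  \<comment> \<open>The corrected chain \<open>e - x\<close> equals \<open>f + y\<close> up to a boundary, so it serves for both ideals.\<close>
  have "c T - bd n (\<lambda>T. e T - x T) T \<in> A" for T
  proof -
    have "c T - bd n (\<lambda>T. e T - x T) T = (c T - bd n e T) + bd n x T"
      by (simp add: bd_diff)
    then show ?thesis using A.add_mem[OF e(3)[of T] A.bd_mem[OF xy(1)]] by (simp only:)
  qed
  moreover have "c T - bd n (\<lambda>T. e T - x T) T \<in> B" for T
  proof -
    have "bd n (\<lambda>T. e T - x T) T = bd n (\<lambda>T. f T + y T + bd n g T) T"
      by (rule bd_cong) (use xy(3) in \<open>auto simp: algebra_simps\<close>)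
    then have "c T - bd n (\<lambda>T. e T - x T) T = (c T - bd n f T) - bd n y T"
      by (simp add: bd_add)
    then show ?thesis using B.diff_mem[OF f(3)[of T] B.bd_mem[OF xy(2)]] by (simp only:)
  qed
  moreover have "e T - x T \<in> polys n" for T
    using e(1) xy(1)[of T] A.sub by blast
  ultimately show "\<exists>e. \<forall>T. e T \<in> polys n \<and> c T - bd n e T \<in> A \<inter> B"
    by (intro exI[of _ "\<lambda>T. e T - x T"]) auto
qed

text \<open>This is the long exact sequence of \<open>0 \<rightarrow> S/(I : l)(-1) \<rightarrow> S/I \<rightarrow> S/(I + (l)) \<rightarrow> 0\<close>, where
\<open>J\<close> stands for \<open>I : l\<close> and \<open>K\<close> for \<open>I + (l)\<close>.\<close>

lemma koszul_regular_colon: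
  assumes I: "graded_ideal n I" and K: "graded_ideal n K"
    and "I \<subseteq> K" and dec: "\<And>p. p \<in> K \<Longrightarrow> \<exists>x\<in>I. \<exists>y\<in>polys n. p = x + Var l * y"
    and colon: "\<And>p. p \<in> polys n \<Longrightarrow> Var l * p \<in> I \<Longrightarrow> p \<in> J" "\<And>p. p \<in> J \<Longrightarrow> Var l * p \<in> I"
    and reg: "koszul_regular n J (r - 1)" "koszul_regular n K r" and l: "l \<in> var_set n"
  shows "koszul_regular n I r"
  unfolding koszul_regular_def
proof safe
  interpret I: graded_ideal n I by fact
  fix a c assume a: "a > r" and "\<forall>T. c T \<in> polys n \<and> homogeneous a (c T) \<and> bd n c T \<in> I"
  then have c: "\<And>T. c T \<in> polys n" "\<And>T. homogeneous a (c T)" "\<And>T. bd n c T \<in> I"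
    by auto
  obtain e where "\<forall>T. e T \<in> polys n \<and> homogeneous (a - 1) (e T) \<and> c T - bd n e T \<in> K"
    using koszul_regularD[OF reg(2) K a c(1,2) subsetD[OF \<open>I \<subseteq> K\<close> c(3)]] by blast
  then have e: "\<And>T. e T \<in> polys n" "\<And>T. homogeneous (a - 1) (e T)" "\<And>T. c T - bd n e T \<in> K"
    by auto
  have "\<exists>x y. x \<in> I \<and> y \<in> polys n \<and> homogeneous (a - 1) y \<and> c T - bd n e T = x + Var l * y" for T
  proof -
    obtain x y where xy: "x \<in> I" "y \<in> polys n" "c T - bd n e T = x + Var l * y"
      using dec[OF e(3)[of T]] by blast
    have "c T - bd n e T = hom_part a (c T - bd n e T)"
      using homogeneous_diff[OF c(2)[of T] homogeneous_bd[OF e(2)]] by (simp add: homogeneous_iff_hc)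
    also have "\<dots> = hom_part a x + Var l * hom_part (a - 1) y"
      unfolding xy(3) by (simp add: hom_part_add hom_part_Var_mult)
    finally show ?thesis
      using xy by (intro exI[of _ "hom_part a x"] exI[of _ "hom_part (a - 1) y"]) (auto intro: I.hom_part_mem)
  qed
  then obtain x s where x: "\<And>T. x T \<in> I" and s: "\<And>T. s T \<in> polys n" "\<And>T. homogeneous (a - 1) (s T)"
    and xs: "\<And>T. c T - bd n e T = x T + Var l * s T"
    by metis
  have s': "bd n s T \<in> J" for T
  proof (rule colon(1))
    have "bd n c T - bd n (bd n e) T = bd n x T + Var l * bd n s T"
      unfolding bd_diff[symmetric] bd_mult[symmetric] bd_add[symmetric] using xs by (rule bd_cong)
    then have "Var l * bd n s T = bd n c T - bd n x T" by (simp add: algebra_simps)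
    then show "Var l * bd n s T \<in> I" using I.diff_mem[OF c(3)[of T] I.bd_mem[OF x]] by (simp only:)
  qed (rule bd_in_polys[OF s(1)])
  have a': "a - 1 > r - 1" using a by simp
  obtain f where "\<forall>T. f T \<in> polys n \<and> s T - bd n f T \<in> J"
    using koszul_regularE[OF reg(1) a' s s'] by blast
  then have f: "\<And>T. f T \<in> polys n" "\<And>T. s T - bd n f T \<in> J"
    by auto
  have "c T - bd n (\<lambda>T. e T + Var l * f T) T \<in> I" for T
  proof -
    have "c T - bd n (\<lambda>T. e T + Var l * f T) T = x T + Var l * (s T - bd n f T)"
      using xs[of T] by (simp add: bd_add bd_mult algebra_simps)
    then show ?thesis using I.add_mem[OF x[of T] colon(2)[OF f(2)[of T]]] by (simp only:)
  qed
  moreover have "e T + Var l * f T \<in> polys n" for T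
    using l by (intro polys_add polys_mult e(1) f(1)) simp
  ultimately show "\<exists>e. \<forall>T. e T \<in> polys n \<and> c T - bd n e T \<in> I"
    by (intro exI[of _ "\<lambda>T. e T + Var l * f T"]) auto
qed

text \<open>Here \<open>K\<close> stands for \<open>I + (l)\<close>, and \<open>I : l = I\<close>, so the colon sequence would return the bound for \<open>I\<close> itself.
Instead, multiplication by \<open>l\<close> is zero on Koszul homology, and hence the homology of \<open>S/I\<close> embeds into
that of \<open>S/K\<close>; on chains, \<open>Var l * s\<close> is a boundary modulo \<open>I\<close> by \<open>bd_wedge\<close>.\<close>

lemma koszul_regular_nonzerodivisor:
  assumes I: "pol_ideal n I"
    and "I \<subseteq> K" and dec: "\<And>p. p \<in> K \<Longrightarrow> \<exists>x\<in>I. \<exists>y\<in>polys n. p = x + Var l * y"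
    and nzd: "\<And>p. p \<in> polys n \<Longrightarrow> Var l * p \<in> I \<Longrightarrow> p \<in> I"
    and reg: "koszul_regular n K r" and l: "l \<in> var_set n"
  shows "koszul_regular n I r"
  unfolding koszul_regular_def
proof safe
  interpret I: pol_ideal n I by fact
  fix a c assume a: "a > r" and "\<forall>T. c T \<in> polys n \<and> homogeneous a (c T) \<and> bd n c T \<in> I"
  then have c: "\<And>T. c T \<in> polys n" "\<And>T. homogeneous a (c T)" "\<And>T. bd n c T \<in> I"
    by auto
  obtain e where "\<forall>T. e T \<in> polys n \<and> c T - bd n e T \<in> K"
    using koszul_regularE[OF reg a c(1,2) subsetD[OF \<open>I \<subseteq> K\<close> c(3)]] by blast
  then have e: "\<And>T. e T \<in> polys n" "\<And>T. c T - bd n e T \<in> K"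
    by auto
  have "\<exists>x y. x \<in> I \<and> y \<in> polys n \<and> c T - bd n e T = x + Var l * y" for T
    using dec[OF e(2)[of T]] by blast
  then obtain x s where x: "\<And>T. x T \<in> I" and s: "\<And>T. s T \<in> polys n"
    and xs: "\<And>T. c T - bd n e T = x T + Var l * s T"
    by metis
  have s': "bd n s T \<in> I" for T
  proof (rule nzd)
    have "bd n c T - bd n (bd n e) T = bd n x T + Var l * bd n s T"
      unfolding bd_diff[symmetric] bd_mult[symmetric] bd_add[symmetric] using xs by (rule bd_cong)
    then have "Var l * bd n s T = bd n c T - bd n x T" by (simp add: algebra_simps)
    then show "Var l * bd n s T \<in> I" using I.diff_mem[OF c(3)[of T] I.bd_mem[OF x]] by (simp only:)
  qed (rule bd_in_polys[OF s])
  have "c T - bd n (\<lambda>T. e T + wedge l s T) T \<in> I" for T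
  proof -
    have "c T - bd n (\<lambda>T. e T + wedge l s T) T = x T + wedge l (bd n s) T"
      using xs[of T] bd_wedge[OF l, of s T] by (simp add: bd_add algebra_simps)
    then show ?thesis using I.add_mem[OF x[of T] I.wedge_mem[OF s']] by (simp only:)
  qed
  moreover have "e T + wedge l s T \<in> polys n" for T
    by (intro polys_add wedge_in_polys e(1) s)
  ultimately show "\<exists>e. \<forall>T. e T \<in> polys n \<and> c T - bd n e T \<in> I"
    by (intro exI[of _ "\<lambda>T. e T + wedge l s T"]) auto
qed

text \<open>A chain whose coefficients have positive degree already vanishes modulo the irrelevant ideal.\<close>

lemma koszul_regular_irrelevant_ideal: "koszul_regular n (irrelevant_ideal n) 0"
  unfolding koszul_regular_def
  by (auto intro!: exI[of _ "\<lambda>T. 0"] simp: irrelevant_ideal_iff homogeneous_iff) (metis mdeg_0 less_irrefl of_nat_0)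


section \<open>Ideals generated by edge binomials and variables\<close>

abbreviation (input) graph_on :: "nat \<Rightarrow> nat set set \<Rightarrow> bool" where
  "graph_on n E \<equiv> E \<subseteq> [{1..n}]\<^bsup>2\<^esup>"

definition bin :: "nat \<Rightarrow> nat \<Rightarrow> 'k::field pol" where
  "bin i j = Var (X i) * Var (Y j) - Var (X j) * Var (Y i)"

text \<open>Unlike in \<open>binomial_edge_ideal\<close>, both orientations of an edge are generators; they differ by a sign.\<close>

definition edge_ideal_gens :: "nat set set \<Rightarrow> var set \<Rightarrow> 'k::field pol set" where
  "edge_ideal_gens E Z = {bin i j | i j. {i, j} \<in> E} \<union> Var ` Z"

definition edge_ideal :: "nat \<Rightarrow> nat set set \<Rightarrow> var set \<Rightarrow> 'k::field pol set" where
  "edge_ideal n E Z = Idl\<^bsub>Pol n\<^esub> (edge_ideal_gens E Z)"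

lemma var_set_iff [simp]: "X i \<in> var_set n \<longleftrightarrow> i \<in> {1..n}" "Y i \<in> var_set n \<longleftrightarrow> i \<in> {1..n}"
  by (auto simp: var_set_def)

lemma bin_swap: "bin j i = - bin i j"
  by (simp add: bin_def mult.commute)

lemma homogeneous_bin: "homogeneous 2 (bin i j)"
  using homogeneous_mult[OF homogeneous_Var homogeneous_Var]
  by (auto simp: bin_def intro: homogeneous_diff)

lemma bin_in_polys: "i \<in> {1..n} \<Longrightarrow> j \<in> {1..n} \<Longrightarrow> bin i j \<in> polys n"
  unfolding bin_def by (intro polys_diff polys_mult) auto

lemma edge_in_range: "graph_on n E \<Longrightarrow> {i, j} \<in> E \<Longrightarrow> i \<in> {1..n} \<and> j \<in> {1..n} \<and> i \<noteq> j"
  by (metis doubleton_in_nsets_2 subsetD)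

lemma edge_ideal_gens_in_polys:
  assumes "graph_on n E" "Z \<subseteq> var_set n"
  shows "edge_ideal_gens E Z \<subseteq> polys n"
proof
  fix p :: "'a pol" assume "p \<in> edge_ideal_gens E Z"
  then consider i j where "p = bin i j" "{i, j} \<in> E" | z where "p = Var z" "z \<in> Z"
    by (auto simp: edge_ideal_gens_def)
  then show "p \<in> polys n"
    using assms edge_in_range[OF assms(1)] bin_in_polys by cases (blast, auto)
qed

lemma graded_edge_ideal:
  assumes "graph_on n E" "Z \<subseteq> var_set n"
  shows "graded_ideal n (edge_ideal n E Z)"
  unfolding edge_ideal_def
proof (rule graded_Idl[OF edge_ideal_gens_in_polys[OF assms]])
  show "\<exists>b. homogeneous b g" if "g \<in> edge_ideal_gens E Z" for g :: "'a pol"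
    using that homogeneous_bin homogeneous_Var unfolding edge_ideal_gens_def by blast
qed

lemma pol_ideal_edge_ideal:
  assumes "graph_on n E" "Z \<subseteq> var_set n"
  shows "pol_ideal n (edge_ideal n E Z)"
  using graded_edge_ideal[OF assms] by (rule graded_ideal.axioms(1))

lemma bin_in_edge_ideal:
  assumes "graph_on n E" "Z \<subseteq> var_set n" "{i, j} \<in> E"
  shows "bin i j \<in> edge_ideal n E Z"
  unfolding edge_ideal_def using assms(3)
  by (intro Idl_incl[OF edge_ideal_gens_in_polys[OF assms(1,2)]]) (auto simp: edge_ideal_gens_def)

lemma Var_in_edge_ideal:
  assumes "graph_on n E" "Z \<subseteq> var_set n" "z \<in> Z"
  shows "Var z \<in> edge_ideal n E Z"
  unfolding edge_ideal_def using assms(3)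
  by (intro Idl_incl[OF edge_ideal_gens_in_polys[OF assms(1,2)]]) (auto simp: edge_ideal_gens_def)

lemma edge_ideal_subset:
  assumes "pol_ideal n J" "\<And>i j. {i, j} \<in> E \<Longrightarrow> bin i j \<in> J" "\<And>z. z \<in> Z \<Longrightarrow> Var z \<in> J"
  shows "edge_ideal n E Z \<subseteq> J"
  unfolding edge_ideal_def using assms by (intro Idl_subset) (auto simp: edge_ideal_gens_def)

lemma edge_ideal_mono:
  assumes "graph_on n E'" "Z' \<subseteq> var_set n" "E \<subseteq> E'" "Z \<subseteq> Z'"
  shows "edge_ideal n E Z \<subseteq> edge_ideal n E' Z'"
  using assms by (intro edge_ideal_subset pol_ideal_edge_ideal bin_in_edge_ideal Var_in_edge_ideal) auto

lemma binomial_edge_ideal_eq: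
  assumes "graph_on n E"
  shows "(binomial_edge_ideal n E :: 'k::field pol set) = edge_ideal n E {}"
proof
  let ?G = "{bin i j | i j. i < j \<and> {i, j} \<in> E} :: 'k pol set"
  have b: "(binomial_edge_ideal n E :: 'k pol set) = Idl\<^bsub>Pol n\<^esub> ?G"
    by (simp add: binomial_edge_ideal_def bin_def)
  have G: "?G \<subseteq> edge_ideal_gens E {}"
    by (auto simp: edge_ideal_gens_def)
  also have "edge_ideal_gens E {} \<subseteq> (polys n :: 'k pol set)"
    using assms by (intro edge_ideal_gens_in_polys) auto
  finally have G': "?G \<subseteq> polys n" .
  interpret J: pol_ideal n "Idl\<^bsub>Pol n\<^esub> ?G" using G' by (rule pol_ideal_Idl)
  show "binomial_edge_ideal n E \<subseteq> (edge_ideal n E {} :: 'k pol set)"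
    unfolding b by (rule Idl_subset[OF pol_ideal_edge_ideal[OF assms]])
      (use bin_in_edge_ideal[OF assms] in auto)
  show "edge_ideal n E {} \<subseteq> (binomial_edge_ideal n E :: 'k pol set)"
    unfolding b
  proof (rule edge_ideal_subset[OF J.pol_ideal_axioms])
    fix i j assume ij: "{i, j} \<in> E"
    show "bin i j \<in> Idl\<^bsub>Pol n\<^esub> ?G"
    proof (cases "i < j")
      case True
      then show ?thesis using ij by (intro Idl_incl[OF G']) auto
    next
      case False
      then have "j < i" "{j, i} \<in> E"
        using edge_in_range[OF assms ij] ij by (auto simp: insert_commute)
      then have "bin j i \<in> Idl\<^bsub>Pol n\<^esub> ?G"
        by (intro Idl_incl[OF G']) auto
      then have "- bin j i \<in> Idl\<^bsub>Pol n\<^esub> ?G"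
        by (rule J.uminus_mem)
      also have "- bin j i = (bin i j :: 'k pol)"
        by (rule bin_swap[symmetric])
      finally show ?thesis .
    qed
  qed simp
qed

lemma pol_ideal_sum:
  assumes "pol_ideal n A" "pol_ideal n B"
  shows "pol_ideal n {x + y | x y. x \<in> A \<and> y \<in> B}"
    (is "pol_ideal n ?S")
proof -
  interpret A: pol_ideal n A by fact
  interpret B: pol_ideal n B by fact
  show ?thesis
  proof (rule pol_idealI)
    show "?S \<subseteq> polys n"
      using A.sub B.sub by auto
    show "0 \<in> ?S"
      by (auto intro!: exI[of _ 0])
    fix p q :: "'a pol"
    assume "q \<in> ?S"
    then obtain x y where xy: "q = x + y" "x \<in> A" "y \<in> B" by blast
    show "p * q \<in> ?S" if "p \<in> polys n"
      using xy that A.mult_mem[of p x] B.mult_mem[of p y] by (auto simp: distrib_left)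
    assume "p \<in> ?S"
    then obtain x' y' where xy': "p = x' + y'" "x' \<in> A" "y' \<in> B" by blast
    have "p + q = (x' + x) + (y' + y)"
      by (simp add: xy xy' ac_simps)
    then show "p + q \<in> ?S"
      using xy xy' A.add_mem B.add_mem by blast
  qed
qed

lemma pol_ideal_principal: "l \<in> polys n \<Longrightarrow> pol_ideal n {l * y | y. y \<in> polys n}"
  by (rule pol_idealI)
     (auto intro: exI[of _ 0] distrib_left[symmetric] polys_mult simp: mult.left_commute[of _ l])

lemma edge_ideal_insert_Var:
  assumes "graph_on n E" "Z \<subseteq> var_set n" "z \<in> var_set n" "p \<in> edge_ideal n E (insert z Z)"
  shows "\<exists>x\<in>edge_ideal n E Z. \<exists>y\<in>polys n. p = x + Var z * y"
proof -
  let ?I = "edge_ideal n E Z :: 'a pol set" and ?B = "{Var z * y | y. y \<in> polys n} :: 'a pol set"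
  let ?S = "{x + y | x y. x \<in> ?I \<and> y \<in> ?B}"
  have B: "pol_ideal n ?B"
    using assms by (intro pol_ideal_principal) simp
  interpret I: pol_ideal n ?I using assms by (intro pol_ideal_edge_ideal)
  interpret B: pol_ideal n ?B by fact
  have "edge_ideal n E (insert z Z) \<subseteq> ?S"
  proof (rule edge_ideal_subset[OF pol_ideal_sum[OF I.pol_ideal_axioms B]])
    show "bin i j \<in> ?S" if "{i, j} \<in> E" for i j
      using bin_in_edge_ideal[OF assms(1,2) that] B.zero_mem by (metis (mono_tags, lifting) CollectI add_0_right)
    fix u assume "u \<in> insert z Z"
    then consider "u = z" | "u \<in> Z" by blast
    then show "Var u \<in> ?S"
    proof cases
      case 1
      then have "Var u \<in> ?B" by (auto intro!: exI[of _ 1])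
      then show ?thesis using I.zero_mem by (metis (mono_tags, lifting) CollectI add_0)
    next
      case 2
      then show ?thesis
        using Var_in_edge_ideal[OF assms(1,2)] B.zero_mem by (metis (mono_tags, lifting) CollectI add_0_right)
    qed
  qed
  then show ?thesis using assms(4) by blast
qed

text \<open>A colon ideal is computed on generators: the polynomials whose remainder and quotient by \<open>l\<close> both lie
in \<open>J\<close> form an ideal, and for \<open>Var l * p\<close> the quotient is \<open>p\<close>.\<close>

lemma Var_colon_Idl:
  assumes J: "pol_ideal n J" and G: "G \<subseteq> polys n" and l: "l \<in> var_set n"
    and gen: "\<And>g. g \<in> G \<Longrightarrow> set_zero {l} g \<in> J \<and> (\<exists>q\<in>J. g = set_zero {l} g + Var l * q)"
    and p: "p \<in> polys n" "Var l * p \<in> Idl\<^bsub>Pol n\<^esub> G"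
  shows "p \<in> J"
proof -
  interpret J: pol_ideal n J by fact
  define Q where "Q = {q \<in> polys n. set_zero {l} q \<in> J \<and> (\<exists>q'\<in>J. q = set_zero {l} q + Var l * q')}"
  have "pol_ideal n Q"
  proof (rule pol_idealI)
    fix p q :: "'a pol"
    assume "q \<in> Q"
    then obtain q' where q: "q \<in> polys n" "set_zero {l} q \<in> J" "q' \<in> J" "q = set_zero {l} q + Var l * q'"
      by (auto simp: Q_def)
    show "p * q \<in> Q" if pn: "p \<in> polys n"
    proof -
      obtain p' where p': "p' \<in> polys n" "p = set_zero {l} p + Var l * p'"
        using set_zero_one_var[OF pn] by blast
      have "p * q = p * set_zero {l} q + p * (Var l * q')"
        using q(4) by (metis distrib_left)
      also have "p * set_zero {l} q = set_zero {l} p * set_zero {l} q + Var l * p' * set_zero {l} q"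
        using p'(2) by (metis distrib_right)
      also have "set_zero {l} p * set_zero {l} q + Var l * p' * set_zero {l} q + p * (Var l * q') =
          set_zero {l} (p * q) + Var l * (p' * set_zero {l} q + p * q')"
        by (simp add: set_zero_mult algebra_simps)
      finally have "p * q = set_zero {l} (p * q) + Var l * (p' * set_zero {l} q + p * q')" .
      moreover have "p' * set_zero {l} q + p * q' \<in> J"
        using q p' pn by (intro J.add_mem J.mult_mem)
      moreover have "set_zero {l} (p * q) \<in> J"
        unfolding set_zero_mult using q pn by (intro J.mult_mem set_zero_in_polys)
      ultimately show ?thesis
        using q pn unfolding Q_def by blast
    qed
    assume "p \<in> Q"
    then obtain p' where p: "p \<in> polys n" "set_zero {l} p \<in> J" "p' \<in> J" "p = set_zero {l} p + Var l * p'"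
      by (auto simp: Q_def)
    have "p + q = set_zero {l} p + Var l * p' + (set_zero {l} q + Var l * q')"
      using p(4) q(4) by (rule arg_cong2)
    then have "p + q = set_zero {l} (p + q) + Var l * (p' + q')"
      by (subst set_zero_add) (simp only: distrib_left ac_simps)
    moreover have "p + q \<in> polys n" "set_zero {l} (p + q) \<in> J" "p' + q' \<in> J"
      using p(1-3) q(1-3) by (auto simp: set_zero_add intro: J.add_mem)
    ultimately show "p + q \<in> Q"
      unfolding Q_def by blast
  qed (auto simp: Q_def intro: bexI[of _ 0])
  moreover have "G \<subseteq> Q"
    using G gen unfolding Q_def by blast
  ultimately have "Var l * p \<in> Q"
    using Idl_subset p(2) by blast
  then obtain q where "q \<in> J" "Var l * p = set_zero {l} (Var l * p) + Var l * q"
    unfolding Q_def by blast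
  then have "Var l * p = Var l * q" by (simp add: set_zero_mult)
  then show ?thesis using \<open>q \<in> J\<close> Var_mult_left_cancel by metis
qed

lemma koszul_regular_mono: "koszul_regular n I r \<Longrightarrow> r \<le> r' \<Longrightarrow> koszul_regular n I r'"
  unfolding koszul_regular_def by (meson le_less_trans)

lemma irrelevant_ideal_eq: "irrelevant_ideal n = edge_ideal n {} (var_set n)"
  by (simp add: irrelevant_ideal_def edge_ideal_def edge_ideal_gens_def)

text \<open>The irrelevant ideal is the trivial case, and its variables are removed one by one as
nonzerodivisors. For \<open>Z = {}\<close> the result is the acyclicity of the Koszul complex of \<open>S\<close> in positive
coefficient degree.\<close>

lemma koszul_regular_variables:
  assumes "Z \<subseteq> var_set n"
  shows "koszul_regular n (edge_ideal n {} Z :: 'k::field pol set) 0"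
  using assms
proof (induction "card (var_set n - Z)" arbitrary: Z)
  case 0
  then have "Z = var_set n" by auto
  then show ?case
    using koszul_regular_irrelevant_ideal by (simp add: irrelevant_ideal_eq)
next
  case (Suc k)
  then obtain z where z: "z \<in> var_set n" "z \<notin> Z"
    by (metis DiffE card.empty equals0I nat.distinct(1))
  let ?K = "edge_ideal n {} (insert z Z) :: 'k pol set"
  have "var_set n - insert z Z = (var_set n - Z) - {z}" by auto
  then have "k = card (var_set n - insert z Z)"
    using Suc.hyps(2) z by simp
  then have K: "koszul_regular n ?K 0"
    using Suc z by (intro Suc.hyps(1)) auto
  have I: "pol_ideal n (edge_ideal n {} Z :: 'k pol set)"
    using Suc.prems by (intro pol_ideal_edge_ideal) auto
  show ?case
  proof (rule koszul_regular_nonzerodivisor[OF I _ _ _ K z(1)])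
    show "edge_ideal n {} Z \<subseteq> ?K"
      using Suc.prems z by (intro edge_ideal_mono) auto
    show "\<exists>x\<in>edge_ideal n {} Z. \<exists>y\<in>polys n. p = x + Var z * y" if "p \<in> ?K" for p
      using that Suc.prems z by (intro edge_ideal_insert_Var) auto
    fix p :: "'k pol" assume p: "p \<in> polys n" "Var z * p \<in> edge_ideal n {} Z"
    show "p \<in> edge_ideal n {} Z"
    proof (rule Var_colon_Idl[OF I _ z(1) _ p(1)])
      show "Var z * p \<in> Idl\<^bsub>Pol n\<^esub> (Var ` Z)"
        using p(2) by (simp add: edge_ideal_def edge_ideal_gens_def)
      show "Var ` Z \<subseteq> (polys n :: 'k pol set)"
        using Suc.prems by auto
      fix g :: "'k pol" assume "g \<in> Var ` Z"
      then obtain u where u: "g = Var u" "u \<in> Z" by blast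
      moreover have "Var u \<in> (edge_ideal n {} Z :: 'k pol set)"
        using Suc.prems u by (intro Var_in_edge_ideal) auto
      ultimately show "set_zero {z} g \<in> edge_ideal n {} Z \<and> (\<exists>q\<in>edge_ideal n {} Z. g = set_zero {z} g + Var z * q)"
        using z pol_ideal.zero_mem[OF I] by (auto intro!: bexI[of _ 0])
    qed
  qed
qed

lemma koszul_regular_zero_ideal: "koszul_regular n ({0} :: 'k::field pol set) 0"
proof -
  have "edge_ideal n {} {} = ({0} :: 'k pol set)"
  proof
    show "edge_ideal n {} {} \<subseteq> ({0} :: 'k pol set)"
      by (rule edge_ideal_subset) (auto intro!: pol_idealI)
    show "{0} \<subseteq> (edge_ideal n {} {} :: 'k pol set)"
      using pol_ideal.zero_mem[OF pol_ideal_edge_ideal[of "{}" n "{}"]] by auto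
  qed
  then show ?thesis using koszul_regular_variables[of "{}" n, where ?'k = 'k] by simp
qed


section \<open>Decomposition at a vertex\<close>

definition del_vertex :: "nat \<Rightarrow> nat set set \<Rightarrow> nat set set" where
  "del_vertex v E = {e \<in> E. v \<notin> e}"

definition complete_nbhd :: "nat \<Rightarrow> nat set set \<Rightarrow> nat set set" where
  "complete_nbhd v E = E \<union> {{a, b} | a b. a \<noteq> b \<and> {v, a} \<in> E \<and> {v, b} \<in> E}"

lemma del_vertex_range: "E \<subseteq> [A]\<^bsup>2\<^esup> \<Longrightarrow> del_vertex v E \<subseteq> [A]\<^bsup>2\<^esup>"
  by (auto simp: del_vertex_def)

abbreviation (input) del_ideal :: "nat \<Rightarrow> nat \<Rightarrow> nat set set \<Rightarrow> var set \<Rightarrow> 'k::field pol set" where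
  "del_ideal n v E Z \<equiv> edge_ideal n (del_vertex v E) (Z \<union> {X v, Y v})"

lemma complete_nbhd_range: "graph_on n E \<Longrightarrow> graph_on n (complete_nbhd v E)"
  unfolding complete_nbhd_def using edge_in_range[of E n] by auto

lemma complete_nbhd_iff:
  "{a, b} \<in> complete_nbhd v E \<longleftrightarrow> {a, b} \<in> E \<or> a \<noteq> b \<and> {v, a} \<in> E \<and> {v, b} \<in> E"
  by (auto simp: complete_nbhd_def doubleton_eq_iff)

lemma complete_nbhd_iff_self:
  assumes "graph_on n E"
  shows "{v, b} \<in> complete_nbhd v E \<longleftrightarrow> {v, b} \<in> E"
  using edge_in_range[OF assms, of v v] by (auto simp: complete_nbhd_iff)

text \<open>For two neighbours \<open>i\<close> and \<open>j\<close> of \<open>v\<close>, the Pluecker relations express \<open>x\<^sub>v f\<^sub>i\<^sub>j\<close> and \<open>y\<^sub>v f\<^sub>i\<^sub>j\<close> by the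
binomials of the edges at \<open>v\<close>.\<close>

lemma Var_mult_complete_nbhd:
  assumes E: "graph_on n E" and Z: "Z \<subseteq> var_set n" and u: "u = X v \<or> u = Y v" and v: "v \<in> {1..n}"
    and q: "q \<in> edge_ideal n (complete_nbhd v E) Z"
  shows "Var u * q \<in> edge_ideal n E Z"
proof -
  let ?I = "edge_ideal n E Z :: 'a pol set"
  interpret I: pol_ideal n ?I using E Z by (rule pol_ideal_edge_ideal)
  let ?Q = "{q \<in> polys n. Var u * q \<in> ?I} :: 'a pol set"
  have uv: "u \<in> var_set n" using u v by auto
  have "pol_ideal n ?Q"
    using uv by (intro pol_idealI) (auto simp: distrib_left mult.left_commute intro: I.add_mem I.mult_mem)
  then have "edge_ideal n (complete_nbhd v E) Z \<subseteq> ?Q"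
  proof (rule edge_ideal_subset)
    fix i j assume ij: "{i, j} \<in> complete_nbhd v E"
    then have r: "i \<in> {1..n}" "j \<in> {1..n}"
      using edge_in_range[OF complete_nbhd_range[OF E] ij] by auto
    have "Var u * bin i j \<in> ?I"
    proof (cases "{i, j} \<in> E")
      case True
      then show ?thesis using bin_in_edge_ideal[OF E Z] uv by (intro I.mult_mem) auto
    next
      case False
      then have "{v, i} \<in> E" "{v, j} \<in> E"
        using ij by (auto simp: complete_nbhd_iff)
      then have b: "bin v i \<in> ?I" "bin v j \<in> ?I"
        using bin_in_edge_ideal[OF E Z] by auto
      have "Var (X v) * bin i j = (Var (X i) * bin v j - Var (X j) * bin v i :: 'a pol)"
        "Var (Y v) * bin i j = (Var (Y i) * bin v j - Var (Y j) * bin v i :: 'a pol)"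
        by (simp_all add: bin_def algebra_simps)
      moreover have "Var (X i) * bin v j - Var (X j) * bin v i \<in> ?I"
        "Var (Y i) * bin v j - Var (Y j) * bin v i \<in> ?I"
        using r b by (auto intro!: I.diff_mem I.mult_mem)
      ultimately show ?thesis using u by metis
    qed
    then show "bin i j \<in> ?Q"
      using bin_in_polys r by blast
  next
    fix z assume "z \<in> Z"
    then have "Var z \<in> ?I" "z \<in> var_set n"
      using Var_in_edge_ideal[OF E Z] Z by auto
    then show "Var z \<in> ?Q"
      using uv I.mult_mem[of "Var u" "Var z"] by simp
  qed
  then show ?thesis using q by blast
qed

lemma set_zero_decomp:
  assumes "p \<in> polys n"
  shows "\<exists>q1\<in>polys n. \<exists>q2\<in>polys n. p - set_zero {X v, Y v} p = Var (X v) * q1 + Var (Y v) * q2"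
proof -
  obtain q1 where q1: "q1 \<in> polys n" "p = set_zero {X v} p + Var (X v) * q1"
    using set_zero_one_var[OF assms] by blast
  have "set_zero {X v} p \<in> polys n" using assms by blast
  then obtain q2 where q2: "q2 \<in> polys n" "set_zero {X v} p = set_zero {Y v} (set_zero {X v} p) + Var (Y v) * q2"
    using set_zero_one_var by blast
  have "set_zero {Y v} (set_zero {X v} p) = set_zero {X v, Y v} p"
    by (induction p rule: poly_mapping_induct) (auto simp: set_zero_add set_zero_single)
  then have "set_zero {X v} p = set_zero {X v, Y v} p + Var (Y v) * q2" using q2(2) by simp
  then have "p - set_zero {X v, Y v} p = (p - set_zero {X v} p) + Var (Y v) * q2"
    by simp
  also have "p - set_zero {X v} p = Var (X v) * q1"
    using q1(2) by (metis add_diff_cancel_left')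
  finally show ?thesis using q1 q2 by blast
qed

lemma set_zero_bin_other: "i \<noteq> v \<Longrightarrow> j \<noteq> v \<Longrightarrow> set_zero {X v, Y v} (bin i j) = bin i j"
  by (simp add: bin_def set_zero_diff set_zero_mult)

lemma set_zero_bin_same: "set_zero {X v, Y v} (bin v j) = 0" "set_zero {X v, Y v} (bin j v) = 0"
  by (simp_all add: bin_def set_zero_diff set_zero_mult)

text \<open>Let \<open>s\<close> set \<open>x\<^sub>v\<close> and \<open>y\<^sub>v\<close> to zero. If \<open>p\<close> lies in the first ideal, then \<open>p - s p\<close> lies in
\<open>edge_ideal n E Z\<close>: modulo the binomials at \<open>v\<close> it is \<open>(x\<^sub>v, y\<^sub>v)\<close> times the first ideal, to which
\<open>Var_mult_complete_nbhd\<close> applies. If \<open>p\<close> also lies in the second ideal, then \<open>s p\<close> is a combination of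
generators that do not involve \<open>v\<close>, so it lies in \<open>edge_ideal n E Z\<close> too.\<close>

lemma edge_ideal_Int:
  assumes E: "graph_on n E" and Z: "Z \<subseteq> var_set n" and v: "v \<in> {1..n}"
  shows "edge_ideal n (complete_nbhd v E) Z \<inter> del_ideal n v E Z =
    (edge_ideal n E Z :: 'k::field pol set)" (is "?A \<inter> ?B = ?I")
proof
  let ?s = "set_zero {X v, Y v} :: 'k pol \<Rightarrow> 'k pol"
  have Z': "Z \<union> {X v, Y v} \<subseteq> var_set n" using Z v by auto
  interpret I: pol_ideal n ?I using E Z by (rule pol_ideal_edge_ideal)
  interpret A: pol_ideal n ?A using complete_nbhd_range[OF E] Z by (rule pol_ideal_edge_ideal)
  interpret B: pol_ideal n ?B using del_vertex_range[OF E] Z' by (rule pol_ideal_edge_ideal)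
  have IA: "?I \<subseteq> ?A"
    using complete_nbhd_range[OF E] Z by (intro edge_ideal_mono) (auto simp: complete_nbhd_def)
  show "?I \<subseteq> ?A \<inter> ?B"
  proof (rule Int_greatest[OF IA], rule edge_ideal_subset[OF B.pol_ideal_axioms])
    fix i j assume ij: "{i, j} \<in> E"
    then have r: "i \<in> {1..n}" "j \<in> {1..n}"
      using edge_in_range[OF E ij] by auto
    show "bin i j \<in> ?B"
    proof (cases "v \<in> {i, j}")
      case False
      then show ?thesis
        using ij by (intro bin_in_edge_ideal[OF del_vertex_range[OF E] Z']) (auto simp: del_vertex_def)
    next
      case True
      have "Var (X v) \<in> ?B" "Var (Y v) \<in> ?B"
        by (rule Var_in_edge_ideal[OF del_vertex_range[OF E] Z'], simp)+
      moreover have "Var (X i) \<in> polys n" "Var (X j) \<in> polys n" "Var (Y i) \<in> polys n" "Var (Y j) \<in> polys n"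
        using r by auto
      moreover have "v = i \<or> v = j" using True by auto
      ultimately show ?thesis
        unfolding bin_def by (metis B.diff_mem B.mult_mem B.mult_mem')
    qed
  qed (use Var_in_edge_ideal[OF del_vertex_range[OF E] Z'] in auto)
  \<comment> \<open>Multiples by \<open>p\<close> stay in \<open>Q\<close> because \<open>p - s p\<close> is in \<open>(x\<^sub>v, y\<^sub>v)\<close>, which multiplies \<open>A\<close> into \<open>I\<close>.\<close>
  have *: "p - ?s p \<in> ?I" if p: "p \<in> ?A" for p
  proof -
    define Q where "Q = {p \<in> ?A. p - ?s p \<in> ?I}"
    have "pol_ideal n Q"
    proof (rule pol_idealI)
      fix p q :: "'k pol" assume "q \<in> Q"
      then have q: "q \<in> ?A" "q - ?s q \<in> ?I" "q \<in> polys n" using A.sub by (auto simp: Q_def)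
      have sq: "?s q \<in> ?A"
        using A.diff_mem[OF q(1) subsetD[OF IA q(2)]] by simp
      show "p * q \<in> Q" if p: "p \<in> polys n"
      proof -
        obtain p1 p2 where p12: "p1 \<in> polys n" "p2 \<in> polys n"
          "p - ?s p = Var (X v) * p1 + Var (Y v) * p2"
          using set_zero_decomp[OF p] by blast
        have "p * q - ?s (p * q) = p * (q - ?s q) + (p - ?s p) * ?s q"
          by (simp add: set_zero_mult algebra_simps)
        also have "\<dots> = p * (q - ?s q) + (Var (X v) * p1 + Var (Y v) * p2) * ?s q"
          by (simp only: p12(3))
        also have "\<dots> = p * (q - ?s q) + (p1 * (Var (X v) * ?s q) + p2 * (Var (Y v) * ?s q))"
          by (simp add: algebra_simps)
        also have "\<dots> \<in> ?I"
          using Var_mult_complete_nbhd[OF E Z _ v sq, of "X v"] Var_mult_complete_nbhd[OF E Z _ v sq, of "Y v"]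
          by (intro I.add_mem I.mult_mem[OF p q(2)] I.mult_mem[OF p12(1)] I.mult_mem[OF p12(2)]) auto
        finally show ?thesis
          using p q A.mult_mem by (auto simp: Q_def)
      qed
      assume "p \<in> Q"
      then have p: "p \<in> ?A" "p - ?s p \<in> ?I" by (auto simp: Q_def)
      have "(p - ?s p) + (q - ?s q) = p + q - ?s (p + q)" by (simp add: set_zero_add)
      then have "p + q - ?s (p + q) \<in> ?I"
        using I.add_mem[OF p(2) q(2)] by (simp only:)
      then show "p + q \<in> Q"
        using A.add_mem[OF p(1) q(1)] by (simp only: Q_def mem_Collect_eq)
    qed (use A.sub in \<open>auto simp: Q_def\<close>)
    then have "?A \<subseteq> Q"
    proof (rule edge_ideal_subset)
      fix i j assume ij: "{i, j} \<in> complete_nbhd v E"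
      have A: "bin i j \<in> ?A" by (rule bin_in_edge_ideal[OF complete_nbhd_range[OF E] Z ij])
      have "bin i j - ?s (bin i j) \<in> ?I"
      proof (cases "v \<in> {i, j}")
        case True
        then have "{i, j} \<in> E" "?s (bin i j) = 0"
          using ij complete_nbhd_iff_self[OF E, of v i] complete_nbhd_iff_self[OF E, of v j] set_zero_bin_same
          by (auto simp: insert_commute)
        then show ?thesis using bin_in_edge_ideal[OF E Z] by simp
      next
        case False
        then show ?thesis by (simp add: set_zero_bin_other)
      qed
      with A show "bin i j \<in> Q" by (simp add: Q_def)
    next
      fix z assume "z \<in> Z"
      then show "Var z \<in> Q"
        using Var_in_edge_ideal[OF E Z] IA unfolding Q_def by auto
    qed
    then show ?thesis using p by (auto simp: Q_def)
  qed
  have "pol_ideal n {p \<in> polys n. ?s p \<in> ?I}"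
    by (rule pol_ideal_vimage[OF I.pol_ideal_axioms]) (auto simp: set_zero_add set_zero_mult)
  then have **: "?B \<subseteq> {p \<in> polys n. ?s p \<in> ?I}"
  proof (rule edge_ideal_subset)
    fix i j assume ij: "{i, j} \<in> del_vertex v E"
    then have "{i, j} \<in> E" "i \<noteq> v" "j \<noteq> v" by (auto simp: del_vertex_def)
    then show "bin i j \<in> {p \<in> polys n. ?s p \<in> ?I}"
      using bin_in_edge_ideal[OF E Z] I.sub by (auto simp: set_zero_bin_other)
  next
    fix z assume "z \<in> Z \<union> {X v, Y v}"
    then show "Var z \<in> {p \<in> polys n. ?s p \<in> ?I}"
      using Z' Var_in_edge_ideal[OF E Z] by auto
  qed
  show "?A \<inter> ?B \<subseteq> ?I"
  proof
    fix p assume "p \<in> ?A \<inter> ?B"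
    then have "p - ?s p \<in> ?I" "?s p \<in> ?I" using * ** by auto
    then show "p \<in> ?I" using I.add_mem by fastforce
  qed
qed

lemma edge_ideal_sum:
  assumes E: "graph_on n E" and Z: "Z \<subseteq> var_set n" and v: "v \<in> {1..n}"
    and p: "p \<in> del_ideal n v (complete_nbhd v E) Z"
  shows "\<exists>x \<in> edge_ideal n (complete_nbhd v E) Z.
    \<exists>y \<in> del_ideal n v E Z. p = x + y"
proof -
  let ?A = "edge_ideal n (complete_nbhd v E) Z :: 'a pol set"
    and ?B = "del_ideal n v E Z :: 'a pol set"
  let ?S = "{x + y | x y. x \<in> ?A \<and> y \<in> ?B}"
  have Z': "Z \<union> {X v, Y v} \<subseteq> var_set n" using Z v by auto
  interpret A: pol_ideal n ?A using complete_nbhd_range[OF E] Z by (rule pol_ideal_edge_ideal)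
  interpret B: pol_ideal n ?B using del_vertex_range[OF E] Z' by (rule pol_ideal_edge_ideal)
  have "del_ideal n v (complete_nbhd v E) Z \<subseteq>
    ?S"
  proof (rule edge_ideal_subset[OF pol_ideal_sum[OF A.pol_ideal_axioms B.pol_ideal_axioms]])
    fix i j assume "{i, j} \<in> del_vertex v (complete_nbhd v E)"
    then have "bin i j \<in> ?A"
      by (intro bin_in_edge_ideal[OF complete_nbhd_range[OF E] Z]) (auto simp: del_vertex_def)
    then show "bin i j \<in> ?S"
      using B.zero_mem by (metis (mono_tags, lifting) CollectI add_0_right)
  next
    fix z assume "z \<in> Z \<union> {X v, Y v}"
    then have "Var z \<in> ?B" by (rule Var_in_edge_ideal[OF del_vertex_range[OF E] Z'])
    then show "Var z \<in> ?S"
      using A.zero_mem by (metis (mono_tags, lifting) CollectI add_0_left)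
  qed
  then show ?thesis using p by blast
qed

lemma edge_ideal_del_subset:
  assumes E: "graph_on n E" and Z: "Z \<subseteq> var_set n" and v: "v \<in> {1..n}"
  shows "edge_ideal n E Z \<subseteq> del_ideal n v E Z"
proof -
  have "Z \<union> {X v, Y v} \<subseteq> var_set n" using Z v by auto
  then have "edge_ideal n (complete_nbhd v E) Z \<inter> del_ideal n v E Z
    = edge_ideal n E Z"
    using edge_ideal_Int[OF E Z v] by blast
  then show ?thesis by blast
qed

lemma koszul_regular_split:
  assumes E: "graph_on n E" and Z: "Z \<subseteq> var_set n" and v: "v \<in> {1..n}"
    and "koszul_regular n (edge_ideal n (complete_nbhd v E) Z :: 'k::field pol set) r"
    and "koszul_regular n (del_ideal n v E Z :: 'k pol set) r"
    and "koszul_regular n (del_ideal n v (complete_nbhd v E) Z :: 'k pol set) (r - 1)"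
  shows "koszul_regular n (edge_ideal n E Z :: 'k pol set) r"
proof -
  note E' = complete_nbhd_range[OF E]
  have Z': "Z \<union> {X v, Y v} \<subseteq> var_set n" using Z v by auto
  have "koszul_regular n (edge_ideal n (complete_nbhd v E) Z
      \<inter> del_ideal n v E Z :: 'k pol set) r"
  proof (rule koszul_regular_Int[OF _ _ _ _ _ _ assms(4-6)])
    show "del_ideal n v E Z
        \<subseteq> (del_ideal n v (complete_nbhd v E) Z :: 'k pol set)"
      using Z' by (intro edge_ideal_mono del_vertex_range[OF E']) (auto simp: del_vertex_def complete_nbhd_def)
    show "\<exists>x \<in> edge_ideal n (complete_nbhd v E) Z.
        \<exists>y \<in> del_ideal n v E Z. p = x + y"
      if "p \<in> del_ideal n v (complete_nbhd v E) Z" for p :: "'k pol"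
      using edge_ideal_sum[OF E Z v that] .
  qed (intro graded_edge_ideal edge_ideal_del_subset del_vertex_range E E' Z Z' v)+
  then show ?thesis by (simp only: edge_ideal_Int[OF E Z v])
qed


section \<open>Disjoint unions of cliques\<close>

definition transitive_edges :: "nat set set \<Rightarrow> bool" where
  "transitive_edges E \<longleftrightarrow> (\<forall>a b c. {a, b} \<in> E \<and> {b, c} \<in> E \<and> a \<noteq> c \<longrightarrow> {a, c} \<in> E)"

text \<open>For transitive \<open>E\<close> this is the least vertex of the clique of \<open>i\<close>.\<close>

definition component_label :: "nat set set \<Rightarrow> nat \<Rightarrow> nat" where
  "component_label E i = (LEAST j. j = i \<or> {i, j} \<in> E)"

text \<open>The parametrization \<open>x\<^sub>i \<mapsto> x\<^sub>i\<close>, \<open>y\<^sub>i \<mapsto> x\<^sub>i t\<close> of the rank one matrices, with one parameter \<open>t\<close> for each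
clique; the parameter of the clique with label \<open>l\<close> is stored in the variable \<open>Y l\<close>.\<close>

definition param_var :: "nat set set \<Rightarrow> var \<Rightarrow> monom" where
  "param_var E v = (case v of X i \<Rightarrow> single (X i) 1
     | Y i \<Rightarrow> single (X i) 1 + single (Y (component_label E i)) 1)"

definition param :: "nat set set \<Rightarrow> monom \<Rightarrow> monom" where
  "param E m = (\<Sum>v\<in>keys m. Poly_Mapping.map ((*) (lookup m v)) (param_var E v))"

lemma component_label_adjacent:
  assumes "transitive_edges E" "{i, j} \<in> E"
  shows "component_label E i = component_label E j"
proof -
  have "(k = i \<or> {i, k} \<in> E) \<longleftrightarrow> (k = j \<or> {j, k} \<in> E)" for k
    using assms unfolding transitive_edges_def by (metis insert_commute)
  then show ?thesis by (simp add: component_label_def)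
qed

lemma component_label_eq_D:
  assumes "transitive_edges E" "component_label E i = component_label E j" "i \<noteq> j"
  shows "{i, j} \<in> E"
proof -
  have *: "component_label E i = i \<or> {i, component_label E i} \<in> E" for i
    unfolding component_label_def by (rule LeastI[of _ i]) simp
  define l where "l = component_label E i"
  have "l = i \<or> {i, l} \<in> E" "l = j \<or> {l, j} \<in> E"
    using *[of i] *[of j] assms(2) by (simp_all add: l_def insert_commute)
  then show ?thesis
    using assms(1)[unfolded transitive_edges_def, rule_format, of i l j] assms(3) by metis
qed

lemma lookup_map_mult: "lookup (Poly_Mapping.map ((*) k) m) v = k * lookup m v" for m :: monom
  by (simp add: Poly_Mapping.map.rep_eq when_def)

lemma param_add: "param E (m + m') = param E m + param E m'"
proof -
  have "(\<Sum>v\<in>keys (m + m'). Poly_Mapping.map ((*) (lookup (m + m') v)) (param_var E v)) =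
    (\<Sum>v\<in>keys m. Poly_Mapping.map ((*) (lookup m v)) (param_var E v)) +
    (\<Sum>v\<in>keys m'. Poly_Mapping.map ((*) (lookup m' v)) (param_var E v))"
    by (rule setsum_keys_plus_distrib[where f = "\<lambda>v k. Poly_Mapping.map ((*) k) (param_var E v)"])
       (auto intro!: poly_mapping_eqI simp: lookup_map_mult lookup_add distrib_right)
  then show ?thesis by (simp add: param_def)
qed

lemma param_single: "param E (single v 1) = param_var E v"
  by (auto simp: param_def lookup_map_mult intro!: poly_mapping_eqI)

lemma lookup_param_X: "lookup (param E m) (X i) = lookup m (X i) + lookup m (Y i)"
proof -
  have "lookup (param E m) (X i) =
    (\<Sum>v\<in>keys m. (if v = X i then lookup m v else 0) + (if v = Y i then lookup m v else 0))"
    unfolding param_def lookup_sum lookup_map_mult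
    by (rule sum.cong) (auto simp: param_var_def lookup_add lookup_single when_def split: var.splits)
  then show ?thesis
    by (simp add: sum.distrib in_keys_iff)
qed

lemma lookup_param_Y:
  assumes "keys m \<subseteq> var_set n"
  shows "lookup (param E m) (Y l) = (\<Sum>i\<in>{i\<in>{1..n}. component_label E i = l}. lookup m (Y i))"
proof -
  let ?L = "{i\<in>{1..n}. component_label E i = l}"
  have "lookup (param E m) (Y l) = (\<Sum>v\<in>keys m. if v \<in> Y ` ?L then lookup m v else 0)"
    unfolding param_def lookup_sum lookup_map_mult using assms
    by (intro sum.cong) (auto simp: param_var_def lookup_add lookup_single when_def var_set_def split: var.splits)
  also have "\<dots> = (\<Sum>v\<in>Y ` ?L. lookup m v)"
    by (simp add: sum.If_cases Int_def) (rule sum.mono_neutral_left, auto simp: in_keys_iff)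
  also have "\<dots> = (\<Sum>i\<in>?L. lookup m (Y i))"
    by (rule sum.reindex_cong[of Y]) (auto intro: inj_onI)
  finally show ?thesis .
qed

text \<open>If \<open>y\<^sub>v\<close> occurs too often in \<open>m\<close>, then some \<open>y\<^sub>w\<close> with \<open>w\<close> in the same clique occurs too rarely, and
replacing \<open>x\<^sub>w y\<^sub>v\<close> by \<open>x\<^sub>v y\<^sub>w\<close> changes \<open>m\<close> by a multiple of an edge binomial and brings it closer to
\<open>m'\<close>.\<close>

lemma single_diff_in_edge_ideal:
  assumes E: "graph_on n E" "transitive_edges E" and Z: "Z \<subseteq> var_set n"
    and "keys m \<subseteq> var_set n" "keys m' \<subseteq> var_set n" "param E m = param E m'"
  shows "single m c - single m' c \<in> (edge_ideal n E Z :: 'k::field pol set)"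
  using assms(4-6)
proof (induction "\<Sum>i=1..n. lookup m (Y i) - lookup m' (Y i)" arbitrary: m rule: less_induct)
  case less
  interpret I: pol_ideal n "edge_ideal n E Z :: 'k pol set" using E Z by (intro pol_ideal_edge_ideal)
  have xy: "lookup m (X i) + lookup m (Y i) = lookup m' (X i) + lookup m' (Y i)" for i
    using less.prems(3) lookup_param_X[of E m i] lookup_param_X[of E m' i] by simp
  have lab: "(\<Sum>i\<in>{i\<in>{1..n}. component_label E i = l}. lookup m (Y i)) =
      (\<Sum>i\<in>{i\<in>{1..n}. component_label E i = l}. lookup m' (Y i))" for l
    using less.prems(3) lookup_param_Y[OF less.prems(1), of E l] lookup_param_Y[OF less.prems(2), of E l]
    by simp
  show ?case
  proof (cases "\<exists>v. lookup m (Y v) > lookup m' (Y v)")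
    case False
    have eq: "lookup m (Y v) = lookup m' (Y v)" for v
    proof (rule ccontr)
      assume ne: "lookup m (Y v) \<noteq> lookup m' (Y v)"
      then have v: "lookup m (Y v) < lookup m' (Y v)"
        using False by (meson linorder_neqE_nat)
      then have "v \<in> {1..n}"
        using less.prems(2) by (metis gr_implies_not0 in_keys_iff subsetD var_set_iff(2))
      with v have "(\<Sum>i\<in>{i\<in>{1..n}. component_label E i = component_label E v}. lookup m (Y i)) <
        (\<Sum>i\<in>{i\<in>{1..n}. component_label E i = component_label E v}. lookup m' (Y i))"
        using False by (intro sum_strict_mono_ex1) (auto simp: not_less)
      then show False using lab by simp
    qed
    have "m = m'"
    proof (rule poly_mapping_eqI)
      fix u show "lookup m u = lookup m' u"
      proof (cases u)
        case (X i)
        then show ?thesis using xy[of i] eq[of i] by simp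
      qed (simp add: eq)
    qed
    then show ?thesis by simp
  next
    case True
    then obtain v where v: "lookup m (Y v) > lookup m' (Y v)" ..
    then have vn: "v \<in> {1..n}"
      using less.prems(1) by (metis gr_implies_not0 in_keys_iff subsetD var_set_iff(2))
    let ?L = "{i\<in>{1..n}. component_label E i = component_label E v}"
    have "\<exists>w\<in>?L. lookup m (Y w) < lookup m' (Y w)"
    proof (rule ccontr)
      assume "\<not> ?thesis"
      then have "(\<Sum>i\<in>?L. lookup m' (Y i)) < (\<Sum>i\<in>?L. lookup m (Y i))"
        using v vn by (intro sum_strict_mono_ex1) (auto simp: not_less)
      then show False using lab by simp
    qed
    then obtain w where w: "w \<in> {1..n}" "component_label E w = component_label E v"
      "lookup m (Y w) < lookup m' (Y w)" by blast
    then have "w \<noteq> v" using v by auto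
    have edge: "{w, v} \<in> E"
      using component_label_eq_D[OF E(2) w(2) \<open>w \<noteq> v\<close>] .
    have Xw: "lookup m (X w) > 0" using xy[of w] w(3) by simp
    \<comment> \<open>The common part of the old monomial \<open>m\<close> and the new monomial \<open>m1\<close>.\<close>
    define m0 where "m0 = m - single (Y v) 1 - single (X w) 1"
    have m: "m = m0 + (single (Y v) 1 + single (X w) 1)"
      using Xw v by (intro poly_mapping_eqI) (auto simp: m0_def lookup_add lookup_minus lookup_single when_def)
    define m1 where "m1 = m0 + (single (X v) 1 + single (Y w) 1)"
    have m0n: "keys m0 \<subseteq> var_set n"
      using less.prems(1) by (auto simp: m keys_add_monom)
    have m1n: "keys m1 \<subseteq> var_set n"
      using m0n vn w(1) by (auto simp: m1_def keys_add_monom)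
    have par: "param E m1 = param E m"
      by (simp add: m m1_def param_add param_single param_var_def w(2) ac_simps del: One_nat_def)
    have "(\<Sum>i=1..n. lookup m1 (Y i) - lookup m' (Y i)) < (\<Sum>i=1..n. lookup m (Y i) - lookup m' (Y i))"
    proof (rule sum_strict_mono_ex1)
      show "\<forall>i\<in>{1..n}. lookup m1 (Y i) - lookup m' (Y i) \<le> lookup m (Y i) - lookup m' (Y i)"
        using w(3) \<open>w \<noteq> v\<close> by (auto simp: m m1_def lookup_add lookup_single when_def)
      show "\<exists>i\<in>{1..n}. lookup m1 (Y i) - lookup m' (Y i) < lookup m (Y i) - lookup m' (Y i)"
        using v vn \<open>w \<noteq> v\<close> by (intro bexI[of _ v]) (auto simp: m m1_def lookup_add lookup_single when_def)
    qed simp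
    then have IH: "single m1 c - single m' c \<in> (edge_ideal n E Z :: 'k pol set)"
      using less.hyps m1n less.prems par by simp
    have "single m c - single m1 c = single m0 c * bin w v"
      by (simp add: m m1_def bin_def Var_def mult_single right_diff_distrib ac_simps)
    also have "\<dots> \<in> edge_ideal n E Z"
      using m0n bin_in_edge_ideal[OF E(1) Z edge] by (intro I.mult_mem) (simp add: polys_single)
    finally show ?thesis
      using I.add_mem[OF _ IH] by fastforce
  qed
qed

text \<open>A polynomial in the kernel has, for every term that avoids \<open>Z\<close>, another term with the same image.
Subtracting a binomial from \<open>single_diff_in_edge_ideal\<close> removes a term without creating a new
monomial.\<close>

lemma edge_ideal_iff_param:
  assumes E: "graph_on n E" "transitive_edges E" and Z: "Z \<subseteq> var_set n"
    and EZ: "\<And>e i. e \<in> E \<Longrightarrow> i \<in> e \<Longrightarrow> X i \<notin> Z \<and> Y i \<notin> Z"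
  shows "p \<in> (edge_ideal n E Z :: 'k::field pol set) \<longleftrightarrow>
    p \<in> polys n \<and> mono_subst (param E) (\<lambda>m. keys m \<inter> Z = {}) p = 0"
proof -
  let ?ok = "\<lambda>m :: monom. keys m \<inter> Z = {}"
  let ?s = "mono_subst (param E) ?ok :: 'k pol \<Rightarrow> 'k pol"
  have mult: "?s (p * q) = ?s p * ?s q" for p q
    by (rule mono_subst_mult) (auto simp: param_add keys_add_monom)
  have sVar: "?s (Var v) = (if v \<in> Z then 0 else single (param_var E v) 1)" for v
    by (simp add: Var_def param_single[unfolded One_nat_def])
  interpret I: pol_ideal n "edge_ideal n E Z :: 'k pol set" using E Z by (intro pol_ideal_edge_ideal)
  have "pol_ideal n {p \<in> polys n. ?s p = 0}"
    by (rule pol_idealI) (auto simp: mono_subst_add mult)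
  then have "edge_ideal n E Z \<subseteq> {p \<in> polys n. ?s p = 0}"
  proof (rule edge_ideal_subset)
    fix i j assume ij: "{i, j} \<in> E"
    have "?s (bin i j) = 0"
      using EZ[OF ij] component_label_adjacent[OF E(2) ij]
      by (simp add: bin_def mono_subst_diff mult sVar mult_single param_var_def add_ac)
    then show "bin i j \<in> {p \<in> polys n. ?s p = 0}"
      using edge_in_range[OF E(1) ij] bin_in_polys by blast
  qed (use Z in \<open>auto simp: sVar\<close>)
  moreover have "p \<in> edge_ideal n E Z" if "p \<in> polys n" "?s p = 0" for p
    using that
  proof (induction "card (keys p)" arbitrary: p rule: less_induct)
    case less
    show ?case
    proof (cases "p = 0")
      case False
      then obtain m where m: "m \<in> keys p" by (metis ex_in_conv keys_eq_empty)
      have reduce: "p \<in> edge_ideal n E Z"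
        if q: "q \<in> edge_ideal n E Z" "?s q = 0" "keys (p - q) \<subseteq> keys p - {m}" for q
      proof -
        have "card (keys (p - q)) < card (keys p)"
          using q(3) m by (metis Diff_subset card_Diff1_less finite_keys finite_Diff card_mono order_le_less_trans)
        moreover have "p - q \<in> polys n" using less.prems q I.sub by blast
        ultimately have "p - q \<in> edge_ideal n E Z"
          using less q by (intro less.hyps) (auto simp: mono_subst_diff)
        then show ?thesis using I.add_mem[OF _ q(1)] by fastforce
      qed
      have mn: "keys m \<subseteq> var_set n" using m less.prems by (auto simp: polys_iff)
      show ?thesis
      proof (cases "?ok m")
        case False
        then obtain v where v: "v \<in> keys m" "v \<in> Z" by blast
        have "single m (lookup p m) = Var v * single (m - single v 1) (lookup p m)"
          using v by (intro single_eq_Var_mult) (simp add: in_keys_iff)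
        also have "keys (m - single v 1) \<subseteq> keys m"
          by (auto simp: in_keys_iff lookup_minus)
        then have "Var v * single (m - single v 1) (lookup p m) \<in> edge_ideal n E Z"
          using v mn by (intro I.mult_mem' Var_in_edge_ideal E Z) (auto simp: polys_single)
        finally show ?thesis
        proof (rule reduce)
          show "?s (single m (lookup p m)) = 0" using False by simp
        qed (auto simp: in_keys_iff lookup_minus lookup_single when_def split: if_splits)
      next
        case True
        have "\<exists>m'\<in>keys p. m' \<noteq> m \<and> ?ok m' \<and> param E m' = param E m"
        proof (rule ccontr)
          assume *: "\<not> ?thesis"
          have "lookup (?s p) (param E m) =
              (\<Sum>m'\<in>keys p. lookup (if ?ok m' then single (param E m') (lookup p m') else 0) (param E m))"
            by (simp add: mono_subst_def lookup_sum)
          also have "\<dots> = (\<Sum>m'\<in>keys p. if m' = m then lookup p m else 0)"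
            using * True by (intro sum.cong) (auto simp: lookup_single when_def)
          also have "\<dots> = lookup p m" using m by simp
          finally show False using less.prems m by (simp add: in_keys_iff)
        qed
        then obtain m' where m': "m' \<in> keys p" "m' \<noteq> m" "?ok m'" "param E m' = param E m" by blast
        have "keys m' \<subseteq> var_set n" using m' less.prems by (auto simp: polys_iff)
        with m' mn have "single m (lookup p m) - single m' (lookup p m) \<in> edge_ideal n E Z"
          by (intro single_diff_in_edge_ideal E Z) auto
        then show ?thesis
          using m' True
          by (intro reduce)
             (auto simp: mono_subst_diff in_keys_iff lookup_minus lookup_single when_def split: if_splits)
      qed
    qed simp
  qed
  ultimately show ?thesis by blast
qed

lemma X_nonzerodivisor:
  assumes E: "graph_on n E" "transitive_edges E" and Z: "Z \<subseteq> var_set n"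
    and EZ: "\<And>e i. e \<in> E \<Longrightarrow> i \<in> e \<Longrightarrow> X i \<notin> Z \<and> Y i \<notin> Z"
    and p: "X v \<notin> Z" "p \<in> polys n" "Var (X v) * p \<in> (edge_ideal n E Z :: 'k::field pol set)"
  shows "p \<in> edge_ideal n E Z"
proof -
  let ?s = "mono_subst (param E) (\<lambda>m. keys m \<inter> Z = {}) :: 'k pol \<Rightarrow> 'k pol"
  have iff: "q \<in> edge_ideal n E Z \<longleftrightarrow> q \<in> polys n \<and> ?s q = 0" for q
    using E Z EZ by (rule edge_ideal_iff_param)
  have "?s (Var (X v) * p) = ?s (Var (X v)) * ?s p"
    by (rule mono_subst_mult) (auto simp: param_add keys_add_monom)
  also have "?s (Var (X v)) = Var (X v)"
    using p(1) by (simp add: Var_def param_single[unfolded One_nat_def] param_var_def)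
  finally have "Var (X v) * ?s p = Var (X v) * 0"
    using p(3) iff by simp
  then have "?s p = 0" by (rule Var_mult_left_cancel)
  then show ?thesis using p(2) iff by blast
qed


section \<open>Clique-disjoint sets of edges\<close>

definition clique_disjoint :: "nat set set \<Rightarrow> nat set set \<Rightarrow> bool" where
  "clique_disjoint E H \<longleftrightarrow> H \<subseteq> E \<and> (\<forall>e\<in>H. \<forall>f\<in>H. e \<noteq> f \<longrightarrow> \<not> clique (e \<union> f) E)"

text \<open>The relation \<open>\<eta>(E) \<le> r\<close>, in the form in which bounds are passed on in the inductions.\<close>

definition eta_le :: "nat set set \<Rightarrow> int \<Rightarrow> bool" where
  "eta_le E r \<longleftrightarrow> (\<forall>H. clique_disjoint E H \<longrightarrow> int (card H) \<le> r)"

lemma clique_disjoint_subgraph: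
  assumes "clique_disjoint E' H" "E' \<subseteq> E" "\<And>e f. e \<in> E' \<Longrightarrow> f \<in> E' \<Longrightarrow> clique (e \<union> f) E \<Longrightarrow> clique (e \<union> f) E'"
  shows "clique_disjoint E H"
  using assms unfolding clique_disjoint_def by (meson subset_iff)

lemma clique_disjoint_del_vertex: "clique_disjoint (del_vertex v E) H \<Longrightarrow> clique_disjoint E H"
  by (erule clique_disjoint_subgraph) (auto simp: del_vertex_def clique_def)

lemma eta_le_del_vertex:
  "eta_le E r \<Longrightarrow> eta_le (del_vertex v E) r"
  using clique_disjoint_del_vertex unfolding eta_le_def by blast

text \<open>An edge \<open>{v, a}\<close> and an edge that leaves the closed neighbourhood of \<open>v\<close> are never in a common
clique, so a star at \<open>v\<close> with pairwise nonadjacent leaves extends \<open>F\<close>.\<close>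

lemma clique_disjoint_add_star:
  assumes E: "graph_on n E" and F: "clique_disjoint E F"
    and FN: "\<And>f. f \<in> F \<Longrightarrow> \<not> f \<subseteq> {w. w = v \<or> {v, w} \<in> E}"
    and A: "\<And>a. a \<in> A \<Longrightarrow> {v, a} \<in> E" "\<And>a b. a \<in> A \<Longrightarrow> b \<in> A \<Longrightarrow> a \<noteq> b \<Longrightarrow> {a, b} \<notin> E"
    and r: "eta_le E r"
  shows "int (card F) + int (card A) \<le> r"
proof -
  let ?S = "(\<lambda>a. {v, a}) ` A"
  have fin: "finite E" using E by (rule finite_subset) (simp add: finite_imp_finite_nsets)
  have sub: "F \<subseteq> E" "?S \<subseteq> E" using F A by (auto simp: clique_disjoint_def)
  have SF: "\<not> clique ({v, a} \<union> f) E" if "f \<in> F" for a f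
  proof
    assume "clique ({v, a} \<union> f) E"
    then have "f \<subseteq> {w. w = v \<or> {v, w} \<in> E}" by (auto simp: clique_def)
    then show False using FN that by blast
  qed
  have SS: "\<not> clique ({v, a} \<union> {v, b}) E" if "a \<in> A" "b \<in> A" "a \<noteq> b" for a b
    using A(2)[OF that] that by (auto simp: clique_def)
  have "clique_disjoint E (F \<union> ?S)"
    unfolding clique_disjoint_def
  proof (intro conjI ballI impI)
    show "F \<union> ?S \<subseteq> E" using sub by blast
    fix e f assume "e \<in> F \<union> ?S" "f \<in> F \<union> ?S" "e \<noteq> f"
    then consider "e \<in> F" "f \<in> F" | a where "e = {v, a}" "f \<in> F" | a where "f = {v, a}" "e \<in> F"
      | a b where "e = {v, a}" "f = {v, b}" "a \<in> A" "b \<in> A" "a \<noteq> b" by blast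
    then show "\<not> clique (e \<union> f) E"
    proof cases
      case 1
      then show ?thesis using F \<open>e \<noteq> f\<close> by (simp add: clique_disjoint_def)
    next
      case 3
      then show ?thesis using SF[of e a] by (metis Un_commute)
    qed (use SF SS in auto)
  qed
  then have "int (card (F \<union> ?S)) \<le> r" using r by (auto simp: eta_le_def)
  moreover have "card (F \<union> ?S) = card F + card ?S"
  proof (rule card_Un_disjoint)
    show "F \<inter> ?S = {}" using FN A(1) by auto
  qed (use sub fin in \<open>auto intro: finite_subset\<close>)
  moreover have "card ?S = card A"
    by (rule card_image) (auto intro!: inj_onI simp: doubleton_eq_iff)
  ultimately show ?thesis by simp
qed

lemma clique_disjoint_local:
  assumes H: "clique_disjoint E H" and N: "clique N E" and "finite H"
  shows "int (card H) \<le> int (card {e \<in> H. \<not> e \<subseteq> N}) + 1"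
proof -
  have "e = f" if "e \<in> H" "f \<in> H" "e \<subseteq> N" "f \<subseteq> N" for e f
    using H smaller_clique[OF N, of "e \<union> f"] that unfolding clique_disjoint_def by blast
  then have "card {e \<in> H. e \<subseteq> N} \<le> 1"
    using \<open>finite H\<close> by (intro card_le_Suc0_iff_eq[THEN iffD2, folded One_nat_def]) auto
  moreover have "card H = card {e \<in> H. e \<subseteq> N} + card {e \<in> H. \<not> e \<subseteq> N}"
    using \<open>finite H\<close> by (subst card_Un_disjoint[symmetric]) (auto intro: arg_cong[where f = card])
  ultimately show ?thesis by simp
qed


lemma clique_closed_nbhd: "clique {w. w = v \<or> {v, w} \<in> E} (complete_nbhd v E)"
  unfolding clique_def
proof (intro ballI impI)
  fix a b assume "a \<in> {w. w = v \<or> {v, w} \<in> E}" "b \<in> {w. w = v \<or> {v, w} \<in> E}" "a \<noteq> b"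
  then consider "a = v" "{v, b} \<in> E" | "b = v" "{v, a} \<in> E" | "{v, a} \<in> E" "{v, b} \<in> E" by blast
  then show "{a, b} \<in> complete_nbhd v E"
    using \<open>a \<noteq> b\<close> by cases (simp_all add: complete_nbhd_iff insert_commute[of a v])
qed

lemma clique_disjoint_outside_nbhd:
  assumes "clique_disjoint (complete_nbhd v E) H"
  shows "clique_disjoint E {e \<in> H. \<not> e \<subseteq> {w. w = v \<or> {v, w} \<in> E}}"
  unfolding clique_disjoint_def
proof (intro conjI ballI impI)
  show "{e \<in> H. \<not> e \<subseteq> {w. w = v \<or> {v, w} \<in> E}} \<subseteq> E"
    using assms by (auto simp: clique_disjoint_def complete_nbhd_def)
  fix e f assume "e \<in> {e \<in> H. \<not> e \<subseteq> {w. w = v \<or> {v, w} \<in> E}}"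
    "f \<in> {e \<in> H. \<not> e \<subseteq> {w. w = v \<or> {v, w} \<in> E}}" "e \<noteq> f"
  then have "\<not> clique (e \<union> f) (complete_nbhd v E)"
    using assms by (simp add: clique_disjoint_def)
  then show "\<not> clique (e \<union> f) E"
    by (auto simp: clique_def complete_nbhd_def)
qed

text \<open>All but at most one edge of \<open>H\<close> leave the closed neighbourhood of \<open>v\<close>, and the exceptional one is
traded for a star at \<open>v\<close>.\<close>

lemma clique_disjoint_trade_star:
  assumes E: "graph_on n E" and r: "eta_le E r"
    and H: "clique_disjoint (complete_nbhd v E) H"
    and A: "\<And>a. a \<in> A \<Longrightarrow> {v, a} \<in> E" "\<And>a b. a \<in> A \<Longrightarrow> b \<in> A \<Longrightarrow> a \<noteq> b \<Longrightarrow> {a, b} \<notin> E"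
  shows "int (card H) + int (card A) \<le> r + 1"
proof -
  let ?N = "{w. w = v \<or> {v, w} \<in> E}"
  have fin: "finite H"
    using H complete_nbhd_range[OF E, of v] finite_imp_finite_nsets[of "{1..n}" 2]
    by (auto simp: clique_disjoint_def intro: finite_subset)
  have "int (card H) \<le> int (card {e \<in> H. \<not> e \<subseteq> ?N}) + 1"
    using H clique_closed_nbhd fin by (rule clique_disjoint_local)
  moreover have "int (card {e \<in> H. \<not> e \<subseteq> ?N}) + int (card A) \<le> r"
    by (rule clique_disjoint_add_star[OF E clique_disjoint_outside_nbhd[OF H] _ A r]) auto
  ultimately show ?thesis by simp
qed

lemma eta_le_complete_nbhd:
  assumes "graph_on n E" "eta_le E r" "{v, w} \<in> E"
  shows "eta_le (complete_nbhd v E) r"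
  unfolding eta_le_def
proof (intro allI impI)
  fix H assume "clique_disjoint (complete_nbhd v E) H"
  then have "int (card H) + int (card {w}) \<le> r + 1"
    using assms(3) by (intro clique_disjoint_trade_star[OF assms(1,2)]) auto
  then show "int (card H) \<le> r" by simp
qed

text \<open>Two nonadjacent neighbours give a star with two edges, a gain of one.\<close>

lemma eta_le_del_complete_nbhd:
  assumes "graph_on n E" "eta_le E r"
    and w: "{v, w} \<in> E" "{v, w'} \<in> E" "w \<noteq> w'" "{w, w'} \<notin> E"
  shows "eta_le (del_vertex v (complete_nbhd v E)) (r - 1)"
  unfolding eta_le_def
proof (intro allI impI)
  fix H assume "clique_disjoint (del_vertex v (complete_nbhd v E)) H"
  then have "int (card H) + int (card {w, w'}) \<le> r + 1"
  proof (intro clique_disjoint_trade_star[OF assms(1,2) clique_disjoint_del_vertex])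
    show "{v, a} \<in> E" if "a \<in> {w, w'}" for a using that w by auto
    show "{a, b} \<notin> E" if "a \<in> {w, w'}" "b \<in> {w, w'}" "a \<noteq> b" for a b
      using that w(4) by (auto simp: insert_commute[of w' w])
  qed
  then show "int (card H) \<le> r - 1" using w(3) by simp
qed

text \<open>Two distinct edges inside the same maximal clique would have a clique as their union, so edges of
\<open>H\<close> are separated by the maximal cliques chosen around them.\<close>

lemma eta_le_maximal_cliques:
  assumes E: "graph_on n E"
  shows "eta_le E (int (card (maximal_cliques {1..n} E)))"
  unfolding eta_le_def
proof safe
  fix H assume H: "clique_disjoint E H"
  let ?M = "maximal_cliques {1..n} E"
  have finM: "finite ?M"
    by (rule finite_subset[of _ "Pow {1..n}"]) (auto simp: maximal_cliques_def)
  have ex: "\<exists>C\<in>?M. e \<subseteq> C" if "e \<in> H" for e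
  proof -
    have "e \<in> E" using that H by (auto simp: clique_disjoint_def)
    then obtain a b where ab: "e = {a, b}" "a \<in> {1..n}" "b \<in> {1..n}"
      using E by (meson nsets2_E subsetD)
    with \<open>e \<in> E\<close> have e: "e \<subseteq> {1..n}" "clique e E"
      by (simp_all add: clique_def insert_commute[of b a])
    let ?S = "{D. D \<subseteq> {1..n} \<and> clique D E \<and> e \<subseteq> D}"
    have "finite ?S" by (rule finite_subset[of _ "Pow {1..n}"]) auto
    moreover have "?S \<noteq> {}" using e by blast
    ultimately have "\<exists>C\<in>?S. \<forall>D\<in>?S. C \<subseteq> D \<longrightarrow> C = D" by (rule finite_has_maximal)
    then obtain C where C: "C \<in> ?S" and max: "\<And>D. D \<in> ?S \<Longrightarrow> C \<subseteq> D \<Longrightarrow> C = D" by auto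
    have "D = C" if "D \<subseteq> {1..n}" "clique D E" "C \<subseteq> D" for D
      using max[of D] C that by auto
    with C show ?thesis
      by (intro bexI[of _ C]) (auto simp: maximal_cliques_def)
  qed
  then have "\<forall>e\<in>H. \<exists>C. C \<in> ?M \<and> e \<subseteq> C" by blast
  from bchoice[OF this] obtain C where C: "\<forall>e\<in>H. C e \<in> ?M \<and> e \<subseteq> C e" ..
  have "inj_on C H"
  proof (rule inj_onI, rule ccontr)
    fix e f assume ef: "e \<in> H" "f \<in> H" "C e = C f" "e \<noteq> f"
    then have "clique (C e) E" "e \<union> f \<subseteq> C e"
      using C by (simp add: maximal_cliques_def, blast)
    then have "clique (e \<union> f) E" by (rule smaller_clique)
    then show False using H ef by (auto simp: clique_disjoint_def)
  qed
  then show "int (card H) \<le> int (card ?M)"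
    using C finM card_inj_on_le[of C H ?M] by auto
qed


section \<open>Koszul regularity of binomial edge ideals\<close>

text \<open>Together with \<open>Y_mult_edge_ideal\<close>: in the presence of \<open>x\<^sub>m\<close>, an edge binomial at \<open>m\<close> reduces to
\<open>x\<^sub>w y\<^sub>m\<close>, so the colon by \<open>y\<^sub>m\<close> contains \<open>x\<^sub>w\<close> for all \<open>w\<close> in the clique of \<open>m\<close>, and these variables
absorb all binomials of that clique.\<close>

lemma Y_colon_edge_ideal:
  fixes m :: nat and E :: "nat set set"
  defines "N \<equiv> {w. w = m \<or> {m, w} \<in> E}"
  assumes E: "graph_on n E" "transitive_edges E" and Z: "Z \<subseteq> var_set n" "Y m \<notin> Z" "X m \<in> Z"
    and m: "m \<in> {1..n}"
    and p: "p \<in> polys n" "Var (Y m) * p \<in> (edge_ideal n E Z :: 'k::field pol set)"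
  shows "p \<in> edge_ideal n {e \<in> E. e \<inter> N = {}} (Z \<union> X ` N)"
proof -
  let ?E' = "{e \<in> E. e \<inter> N = {}}" and ?Z' = "Z \<union> X ` N"
  let ?J = "edge_ideal n ?E' ?Z' :: 'k pol set"
  have E': "graph_on n ?E'" using E by auto
  have Nn: "N \<subseteq> {1..n}" using m edge_in_range[OF E(1)] by (auto simp: N_def)
  have Z': "?Z' \<subseteq> var_set n" using Z Nn by auto
  interpret J: pol_ideal n ?J using E' Z' by (rule pol_ideal_edge_ideal)
  have XJ: "Var (X i) \<in> ?J" if "i \<in> N" for i
    using that by (intro Var_in_edge_ideal[OF E' Z']) auto
  show ?thesis
  proof (rule Var_colon_Idl[OF J.pol_ideal_axioms edge_ideal_gens_in_polys[OF E(1) Z(1)] _ _ p(1)])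
    show "Var (Y m) * p \<in> Idl\<^bsub>Pol n\<^esub> (edge_ideal_gens E Z)"
      using p(2) by (simp add: edge_ideal_def)
    show "Y m \<in> var_set n" using m by simp
    fix g :: "'k pol" assume "g \<in> edge_ideal_gens E Z"
    then consider i j where "g = bin i j" "{i, j} \<in> E" | z where "g = Var z" "z \<in> Z"
      by (auto simp: edge_ideal_gens_def)
    then show "set_zero {Y m} g \<in> ?J \<and> (\<exists>q\<in>?J. g = set_zero {Y m} g + Var (Y m) * q)"
    proof cases
      case 2
      then show ?thesis
        using Z(2) Var_in_edge_ideal[OF E' Z', of z] by (auto intro!: bexI[of _ 0])
    next
      case 1
      then have ij: "i \<in> {1..n}" "j \<in> {1..n}" "i \<noteq> j" using edge_in_range[OF E(1)] by auto
      have vars: "Var (Y i) \<in> (polys n :: 'k pol set)" "Var (Y j) \<in> (polys n :: 'k pol set)"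
        using ij by simp_all
      have N: "i \<in> N \<longleftrightarrow> j \<in> N"
        using 1(2) E(2)[unfolded transitive_edges_def, rule_format, of m i j]
          E(2)[unfolded transitive_edges_def, rule_format, of m j i] ij
        by (auto simp: N_def insert_commute[of j i] insert_commute[of i m] insert_commute[of j m])
      have "bin i j \<in> ?J"
      proof (cases "i \<in> N")
        case True
        then show ?thesis
          using N XJ[of i] XJ[of j] vars unfolding bin_def by (intro J.diff_mem J.mult_mem') auto
      next
        case False
        then show ?thesis
          using N 1 by (intro bin_in_edge_ideal[OF E' Z']) auto
      qed
      consider "i = m" | "j = m" | "i \<noteq> m" "j \<noteq> m" by blast
      then show ?thesis
      proof cases
        case 1
        then have "i \<in> N" "j \<in> N" using N by (auto simp: N_def)
        have "set_zero {Y m} g = Var (X i) * Var (Y j)" "g = set_zero {Y m} g + Var (Y m) * (- Var (X j))"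
          using \<open>g = bin i j\<close> 1 ij by (simp_all add: bin_def set_zero_diff set_zero_mult mult.commute)
        note set_zero = this
        show ?thesis
        proof (intro conjI bexI)
          show "set_zero {Y m} g \<in> ?J"
            unfolding set_zero(1) by (rule J.mult_mem'[OF XJ[OF \<open>i \<in> N\<close>] vars(2)])
        qed (rule set_zero(2), rule J.uminus_mem[OF XJ[OF \<open>j \<in> N\<close>]])
      next
        case 2
        then have "i \<in> N" "j \<in> N" using N by (auto simp: N_def)
        have "set_zero {Y m} g = - (Var (X j) * Var (Y i))" "g = set_zero {Y m} g + Var (Y m) * Var (X i)"
          using \<open>g = bin i j\<close> 2 ij by (simp_all add: bin_def set_zero_diff set_zero_mult mult.commute)
        note set_zero = this
        show ?thesis
        proof (intro conjI bexI)
          show "set_zero {Y m} g \<in> ?J"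
            unfolding set_zero(1) by (rule J.uminus_mem[OF J.mult_mem'[OF XJ[OF \<open>j \<in> N\<close>] vars(1)]])
        qed (rule set_zero(2), rule XJ[OF \<open>i \<in> N\<close>])
      next
        case 3
        then have "set_zero {Y m} g = g"
          using \<open>g = bin i j\<close> by (simp add: bin_def set_zero_diff set_zero_mult)
        then show ?thesis
          using \<open>bin i j \<in> ?J\<close> \<open>g = bin i j\<close> by (auto intro!: bexI[of _ 0])
      qed
    qed
  qed
qed

lemma Y_mult_edge_ideal:
  fixes m :: nat and E :: "nat set set"
  defines "N \<equiv> {w. w = m \<or> {m, w} \<in> E}"
  assumes E: "graph_on n E" and Z: "Z \<subseteq> var_set n" "X m \<in> Z" and m: "m \<in> {1..n}"
    and p: "p \<in> (edge_ideal n {e \<in> E. e \<inter> N = {}} (Z \<union> X ` N) :: 'k::field pol set)"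
  shows "Var (Y m) * p \<in> edge_ideal n E Z"
proof -
  let ?I = "edge_ideal n E Z :: 'k pol set"
  let ?Q = "{p \<in> polys n. Var (Y m) * p \<in> ?I}"
  interpret I: pol_ideal n ?I using E Z(1) by (rule pol_ideal_edge_ideal)
  have Ym: "Var (Y m) \<in> (polys n :: 'k pol set)" using m by simp
  have "pol_ideal n ?Q"
    using Ym by (intro pol_idealI) (auto simp: distrib_left mult.left_commute intro: I.add_mem I.mult_mem)
  then have "edge_ideal n {e \<in> E. e \<inter> N = {}} (Z \<union> X ` N) \<subseteq> ?Q"
  proof (rule edge_ideal_subset)
    fix i j assume "{i, j} \<in> {e \<in> E. e \<inter> N = {}}"
    then have "bin i j \<in> ?I" by (intro bin_in_edge_ideal[OF E Z(1)]) auto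
    then show "bin i j \<in> ?Q"
      using I.mult_mem[OF Ym] I.sub by auto
  next
    fix z assume "z \<in> Z \<union> X ` N"
    then consider "z \<in> Z" | w where "z = X w" "{m, w} \<in> E"
      using Z(2) by (auto simp: N_def)
    then show "Var z \<in> ?Q"
    proof cases
      case 1
      then have "Var z \<in> ?I" by (rule Var_in_edge_ideal[OF E Z(1)])
      then show ?thesis using I.mult_mem[OF Ym] I.sub by auto
    next
      case 2
      then have w: "w \<in> {1..n}" using edge_in_range[OF E] by auto
      have "Var (Y m) * Var z = Var (Y w) * Var (X m) - bin m w"
        by (simp add: 2 bin_def mult.commute)
      also have "\<dots> \<in> ?I"
        using w Z bin_in_edge_ideal[OF E Z(1) 2(2)] Var_in_edge_ideal[OF E Z]
        by (intro I.diff_mem I.mult_mem) auto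
      finally show ?thesis using w 2 by simp
    qed
  qed
  then show ?thesis using p by blast
qed

lemma transitive_edges_filter:
  assumes "transitive_edges E" "\<And>a b c. P {a, b} \<Longrightarrow> P {b, c} \<Longrightarrow> P {a, c}"
  shows "transitive_edges {e \<in> E. P e}"
  unfolding transitive_edges_def
proof (intro allI impI)
  fix a b c assume "{a, b} \<in> {e \<in> E. P e} \<and> {b, c} \<in> {e \<in> E. P e} \<and> a \<noteq> c"
  then show "{a, c} \<in> {e \<in> E. P e}"
    using assms(1)[unfolded transitive_edges_def, rule_format, of a b c] assms(2)[of a b c] by simp
qed

text \<open>For a vertex \<open>m\<close> of an edge, the nonzerodivisor \<open>x\<^sub>m\<close> is added first. The colon by \<open>y\<^sub>m\<close> and the sum
with \<open>y\<^sub>m\<close> then lead to two graphs with fewer edges, both again disjoint unions of cliques.\<close>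

lemma koszul_regular_cliques:
  assumes "graph_on n E" "transitive_edges E" "Z \<subseteq> var_set n"
    and "\<And>e i. e \<in> E \<Longrightarrow> i \<in> e \<Longrightarrow> X i \<notin> Z \<and> Y i \<notin> Z"
    and "eta_le E r"
  shows "koszul_regular n (edge_ideal n E Z :: 'k::field pol set) r"
  using assms
proof (induction "card E" arbitrary: E Z r rule: less_induct)
  case less
  note E = less.prems(1) and tr = less.prems(2) and Z = less.prems(3) and EZ = less.prems(4)
    and bound = less.prems(5)
  have fin: "finite E" using E by (rule finite_subset) (simp add: finite_imp_finite_nsets)
  show ?case
  proof (cases "E = {}")
    case True
    have "clique_disjoint E {}" by (simp add: clique_disjoint_def)
    then have "int (card ({} :: nat set set)) \<le> r"
      using bound unfolding eta_le_def by blast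
    then show ?thesis
      using koszul_regular_mono[OF koszul_regular_variables[OF Z], of r] True by simp
  next
    case False
    then obtain e where "e \<in> E" by blast
    then obtain m u where mu: "{m, u} \<in> E"
      using E by (metis nsets2_E subsetD)
    then have mn: "m \<in> {1..n}" and "m \<noteq> u" using edge_in_range[OF E] by auto
    have mZ: "X m \<notin> Z" "Y m \<notin> Z" using EZ[OF mu] by auto
    define N where "N = {w. w = m \<or> {m, w} \<in> E}"
    have NZ: "X w \<notin> Z \<and> Y w \<notin> Z" if "w \<in> N" for w
      using that EZ[OF mu] EZ[of "{m, w}"] by (auto simp: N_def)
    define E1 where "E1 = {e \<in> E. e \<inter> N = {}}"
    let ?Zx = "insert (X m) Z"
    let ?Zxy = "insert (Y m) ?Zx"
    have Zx: "?Zx \<subseteq> var_set n" and Zxy: "?Zxy \<subseteq> var_set n"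
      using Z mn by auto
    have Nn: "N \<subseteq> {1..n}" using mn edge_in_range[OF E] by (auto simp: N_def)
    have Z1: "?Zx \<union> X ` N \<subseteq> var_set n" using Zx Nn by auto
    have E1: "graph_on n E1" using E by (auto simp: E1_def)
    have "eta_le E1 (r - 1)"
      unfolding eta_le_def
    proof safe
      fix H assume H: "clique_disjoint E1 H"
      have HE: "H \<subseteq> E1" using H by (simp add: clique_disjoint_def)
      have finH: "finite H" using HE fin by (auto simp: E1_def intro: finite_subset)
      have "clique_disjoint E H"
        using H by (rule clique_disjoint_subgraph) (auto simp: E1_def clique_def)
      moreover have "\<not> f \<subseteq> {w. w = m \<or> {m, w} \<in> E}" if "f \<in> H" for f
      proof -
        have "f \<inter> N = {}" "f \<in> E" using that HE by (auto simp: E1_def)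
        moreover from \<open>f \<in> E\<close> have "f \<noteq> {}" using E by (metis nsets2_E subsetD insert_not_empty)
        ultimately show ?thesis by (auto simp: N_def)
      qed
      ultimately have "int (card H) + int (card {u}) \<le> r"
        using mu by (intro clique_disjoint_add_star[OF E _ _ _ _ bound]) auto
      then show "int (card H) \<le> r - 1" by simp
    qed
    moreover have "transitive_edges E1"
      unfolding E1_def using tr by (rule transitive_edges_filter) auto
    moreover have "card E1 < card E"
    proof (rule psubset_card_mono[OF fin])
      have "{m, u} \<notin> E1" by (simp add: E1_def N_def)
      with mu have "E1 \<noteq> E" by blast
      moreover have "E1 \<subseteq> E" unfolding E1_def by blast
      ultimately show "E1 \<subset> E" by blast
    qed
    moreover have "X i \<notin> ?Zx \<union> X ` N \<and> Y i \<notin> ?Zx \<union> X ` N" if "e \<in> E1" "i \<in> e" for e i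
    proof -
      have "e \<in> E" "i \<notin> N" using that by (auto simp: E1_def)
      then show ?thesis using EZ[of e i] that(2) by (auto simp: N_def)
    qed
    ultimately have reg1: "koszul_regular n (edge_ideal n E1 (?Zx \<union> X ` N) :: 'k pol set) (r - 1)"
      using E1 Z1 by (intro less.hyps) auto
    have "koszul_regular n (edge_ideal n (del_vertex m E) ?Zxy :: 'k pol set) r"
    proof (rule less.hyps)
      show "card (del_vertex m E) < card E"
      proof (rule psubset_card_mono[OF fin])
        have "{m, u} \<notin> del_vertex m E" by (simp add: del_vertex_def)
        with mu have "del_vertex m E \<noteq> E" by blast
        moreover have "del_vertex m E \<subseteq> E" unfolding del_vertex_def by blast
        ultimately show "del_vertex m E \<subset> E" by blast
      qed
      show "transitive_edges (del_vertex m E)"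
        unfolding del_vertex_def using tr by (rule transitive_edges_filter) auto
      show "X i \<notin> ?Zxy \<and> Y i \<notin> ?Zxy" if "e \<in> del_vertex m E" "i \<in> e" for e i
        using that EZ[of e i] by (auto simp: del_vertex_def)
    qed (rule del_vertex_range[OF E] Zxy eta_le_del_vertex[OF bound])+
    moreover have "edge_ideal n (del_vertex m E) ?Zxy = (edge_ideal n E ?Zxy :: 'k pol set)"
    proof
      show "edge_ideal n (del_vertex m E) ?Zxy \<subseteq> (edge_ideal n E ?Zxy :: 'k pol set)"
        using E Zxy by (intro edge_ideal_mono) (auto simp: del_vertex_def)
      have "?Zxy \<union> {X m, Y m} = ?Zxy" by auto
      then show "(edge_ideal n E ?Zxy :: 'k pol set) \<subseteq> edge_ideal n (del_vertex m E) ?Zxy"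
        using edge_ideal_del_subset[OF E Zxy mn, where ?'a = 'k] by simp
    qed
    ultimately have regK: "koszul_regular n (edge_ideal n E ?Zxy :: 'k pol set) r" by simp
    have regx: "koszul_regular n (edge_ideal n E ?Zx :: 'k pol set) r"
    proof (rule koszul_regular_colon[OF graded_edge_ideal[OF E Zx] graded_edge_ideal[OF E Zxy]
          _ _ _ _ reg1 regK])
      show "edge_ideal n E ?Zx \<subseteq> (edge_ideal n E ?Zxy :: 'k pol set)"
        using E Zxy by (intro edge_ideal_mono) auto
      show "\<exists>x\<in>edge_ideal n E ?Zx. \<exists>y\<in>polys n. p = x + Var (Y m) * y"
        if "p \<in> edge_ideal n E ?Zxy" for p :: "'k pol"
        using that mn by (intro edge_ideal_insert_Var[OF E Zx]) auto
      show "p \<in> edge_ideal n E1 (?Zx \<union> X ` N)"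
        if "p \<in> polys n" "Var (Y m) * p \<in> edge_ideal n E ?Zx" for p :: "'k pol"
        unfolding E1_def N_def
        by (rule Y_colon_edge_ideal[OF E tr Zx _ _ mn that]) (use mZ in auto)
      show "Var (Y m) * p \<in> edge_ideal n E ?Zx"
        if "p \<in> edge_ideal n E1 (?Zx \<union> X ` N)" for p :: "'k pol"
        by (rule Y_mult_edge_ideal[OF E Zx _ mn that[unfolded E1_def N_def]]) simp
      show "Y m \<in> var_set n" using mn by simp
    qed
    show ?thesis
    proof (rule koszul_regular_nonzerodivisor[OF pol_ideal_edge_ideal[OF E Z] _ _ _ regx])
      show "edge_ideal n E Z \<subseteq> (edge_ideal n E ?Zx :: 'k pol set)"
        using E Zx by (intro edge_ideal_mono) auto
      show "\<exists>x\<in>edge_ideal n E Z. \<exists>y\<in>polys n. p = x + Var (X m) * y"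
        if "p \<in> edge_ideal n E ?Zx" for p :: "'k pol"
        using that mn by (intro edge_ideal_insert_Var[OF E Z]) auto
      show "p \<in> edge_ideal n E Z"
        if "p \<in> polys n" "Var (X m) * p \<in> edge_ideal n E Z" for p :: "'k pol"
        by (rule X_nonzerodivisor[OF E tr Z EZ mZ(1) that])
      show "X m \<in> var_set n" using mn by simp
    qed
  qed
qed

text \<open>The vertices whose neighbourhood is not a clique; equivalently, those in at least two maximal
cliques.\<close>

definition internal_vertices :: "nat set set \<Rightarrow> nat set" where
  "internal_vertices E = {v. \<exists>a b. {v, a} \<in> E \<and> {v, b} \<in> E \<and> a \<noteq> b \<and> {a, b} \<notin> E}"

lemma internal_vertices_del_vertex: "internal_vertices (del_vertex v E) \<subseteq> internal_vertices E - {v}"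
  unfolding internal_vertices_def del_vertex_def by auto

text \<open>If the neighbourhood of \<open>u\<close> is a clique and grows, then \<open>u\<close> is a neighbour of \<open>v\<close>; its neighbours are
then neighbours of \<open>v\<close> as well, so its new neighbourhood lies in the completed one.\<close>

lemma internal_vertices_complete_nbhd:
  assumes E: "graph_on n E"
  shows "internal_vertices (complete_nbhd v E) \<subseteq> internal_vertices E - {v}"
proof
  fix u assume "u \<in> internal_vertices (complete_nbhd v E)"
  then obtain a b where ab: "{u, a} \<in> complete_nbhd v E" "{u, b} \<in> complete_nbhd v E" "a \<noteq> b"
    "{a, b} \<notin> complete_nbhd v E"
    by (auto simp: internal_vertices_def)
  have notboth: "{a, b} \<notin> E" "\<not> ({v, a} \<in> E \<and> {v, b} \<in> E)"
    using ab by (auto simp: complete_nbhd_iff)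
  have "u \<noteq> v"
    using ab notboth complete_nbhd_iff_self[OF E] by auto
  moreover have "u \<in> internal_vertices E"
  proof (rule ccontr)
    assume "u \<notin> internal_vertices E"
    then have free: "{x, y} \<in> E" if "{u, x} \<in> E" "{u, y} \<in> E" "x \<noteq> y" for x y
      using that unfolding internal_vertices_def by blast
    have vu: "{v, u} \<in> E"
      using ab(1-3) free[of a b] notboth(1) by (auto simp: complete_nbhd_iff)
    then have "{u, v} \<in> E" by (simp add: insert_commute)
    then have "{v, y} \<in> E" if "{u, y} \<in> complete_nbhd v E" "y \<noteq> v" for y
      using that free[of v y] by (auto simp: complete_nbhd_iff)
    then have "a = v \<and> {v, b} \<in> E \<or> b = v \<and> {v, a} \<in> E"
      using ab(1-3) notboth(2) by blast
    then show False
      using notboth(1) by (metis insert_commute)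
  qed
  ultimately show "u \<in> internal_vertices E - {v}" by blast
qed

theorem koszul_regular_edge_ideal:
  assumes "graph_on n E" "Z \<subseteq> var_set n"
    and "\<And>e i. e \<in> E \<Longrightarrow> i \<in> e \<Longrightarrow> X i \<notin> Z \<and> Y i \<notin> Z"
    and "eta_le E r"
  shows "koszul_regular n (edge_ideal n E Z :: 'k::field pol set) r"
  using assms
proof (induction "card (internal_vertices E)" arbitrary: E Z r rule: less_induct)
  case less
  note E = less.prems(1) and Z = less.prems(2) and EZ = less.prems(3) and bound = less.prems(4)
  show ?case
  proof (cases "internal_vertices E = {}")
    case True
    have "{a, c} \<in> E" if "{a, b} \<in> E" "{b, c} \<in> E" "a \<noteq> c" for a b c
    proof (rule ccontr)
      assume "{a, c} \<notin> E"
      moreover have "{b, a} \<in> E" using that(1) by (simp add: insert_commute)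
      ultimately have "b \<in> internal_vertices E"
        using that(2,3) unfolding internal_vertices_def by blast
      with True show False by blast
    qed
    then have "transitive_edges E" unfolding transitive_edges_def by blast
    with less.prems show ?thesis by (intro koszul_regular_cliques)
  next
    case False
    then obtain v a b where v: "v \<in> internal_vertices E"
      and ab: "{v, a} \<in> E" "{v, b} \<in> E" "a \<noteq> b" "{a, b} \<notin> E"
      unfolding internal_vertices_def by blast
    have vn: "v \<in> {1..n}" using edge_in_range[OF E ab(1)] by blast
    have fin: "finite (internal_vertices E)"
    proof (rule finite_subset)
      show "internal_vertices E \<subseteq> {1..n}"
      proof
        fix w assume "w \<in> internal_vertices E"
        then obtain x where "{w, x} \<in> E" unfolding internal_vertices_def by blast
        then show "w \<in> {1..n}" using edge_in_range[OF E] by blast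
      qed
    qed simp
    have smaller: "card (internal_vertices F) < card (internal_vertices E)"
      if "internal_vertices F \<subseteq> internal_vertices E - {v}" for F
      using that v fin by (intro psubset_card_mono) auto
    have c: "internal_vertices (complete_nbhd v E) \<subseteq> internal_vertices E - {v}"
      by (rule internal_vertices_complete_nbhd[OF E])
    note E' = complete_nbhd_range[OF E]
    have Z': "Z \<union> {X v, Y v} \<subseteq> var_set n" using Z vn by auto
    have EZ': "X i \<notin> Z \<and> Y i \<notin> Z" if "e \<in> complete_nbhd v E" "i \<in> e" for e i
    proof -
      have "e \<in> E \<or> {v, i} \<in> E" using that by (auto simp: complete_nbhd_def)
      then show ?thesis using EZ[of e i] EZ[of "{v, i}" i] that(2) by auto
    qed
    have delZ: "X i \<notin> Z \<union> {X v, Y v} \<and> Y i \<notin> Z \<union> {X v, Y v}"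
      if "e \<in> del_vertex v (complete_nbhd v E)" "i \<in> e" for e i
      using that EZ'[of e i] by (auto simp: del_vertex_def)
    show ?thesis
    proof (rule koszul_regular_split[OF E Z vn])
      show "koszul_regular n (edge_ideal n (complete_nbhd v E) Z :: 'k pol set) r"
        by (rule less.hyps[OF smaller[OF c] E' Z EZ'])
           (assumption+, rule eta_le_complete_nbhd[OF E bound ab(1)])
      show "koszul_regular n (del_ideal n v E Z :: 'k pol set) r"
      proof (rule less.hyps[OF smaller[OF internal_vertices_del_vertex] del_vertex_range[OF E] Z'])
        show "X i \<notin> Z \<union> {X v, Y v} \<and> Y i \<notin> Z \<union> {X v, Y v}" if "e \<in> del_vertex v E" "i \<in> e" for e i
          using that delZ[of e i] by (auto simp: del_vertex_def complete_nbhd_def)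
      qed (rule eta_le_del_vertex[OF bound])
      have "internal_vertices (del_vertex v (complete_nbhd v E)) \<subseteq> internal_vertices E - {v}"
        using internal_vertices_del_vertex[of v "complete_nbhd v E"] c by blast
      then show "koszul_regular n (del_ideal n v (complete_nbhd v E) Z :: 'k pol set) (r - 1)"
        by (rule less.hyps[OF smaller del_vertex_range[OF E'] Z' delZ])
           (assumption+, rule eta_le_del_complete_nbhd[OF E bound ab])
    qed
  qed
qed

corollary koszul_regular_binomial_edge_ideal:
  assumes "graph_on n E"
  shows "koszul_regular n (binomial_edge_ideal n E :: 'k::field pol set)
    (int (card (maximal_cliques {1..n} E)))"
  unfolding binomial_edge_ideal_eq[OF assms]
  by (intro koszul_regular_edge_ideal eta_le_maximal_cliques assms) auto


section \<open>Koszul regularity of modules and their syzygies\<close>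

abbreviation (input) free_over :: "nat \<Rightarrow> int list \<Rightarrow> 'k::field pol vec set" where
  "free_over n d \<equiv> free_mod n (length d)"

definition homogeneous_vec :: "int list \<Rightarrow> int \<Rightarrow> 'k::field pol vec \<Rightarrow> bool" where
  "homogeneous_vec d a v \<longleftrightarrow> (\<forall>k < length d. homogeneous (a - d ! k) (v $ k))"

definition hom_part_vec :: "int list \<Rightarrow> int \<Rightarrow> 'k::field pol vec \<Rightarrow> 'k pol vec" where
  "hom_part_vec d a v = vec (length d) (\<lambda>k. hom_part (a - d ! k) (v $ k))"

definition bd_vec :: "nat \<Rightarrow> nat \<Rightarrow> (var set \<Rightarrow> 'k::field pol vec) \<Rightarrow> var set \<Rightarrow> 'k pol vec" where
  "bd_vec n r c T = vec r (\<lambda>k. bd n (\<lambda>T. c T $ k) T)"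

lemma dim_bd_vec [simp]: "dim_vec (bd_vec n r c T) = r"
  and index_bd_vec [simp]: "k < r \<Longrightarrow> bd_vec n r c T $ k = bd n (\<lambda>T. c T $ k) T"
  by (simp_all add: bd_vec_def)

lemma dim_hc_vec [simp]: "dim_vec (hom_part_vec d a v) = length d"
  and index_hc_vec [simp]: "k < length d \<Longrightarrow> hom_part_vec d a v $ k = hom_part (a - d ! k) (v $ k)"
  by (simp_all add: hom_part_vec_def)

lemma free_mod_iff: "v \<in> free_mod n r \<longleftrightarrow> dim_vec v = r \<and> (\<forall>k<r. v $ k \<in> polys n)"
  by (auto simp: free_mod_def)

lemma hom_part_vec_in_free_mod: "v \<in> free_over n d \<Longrightarrow> hom_part_vec d a v \<in> free_over n d"
  by (auto simp: free_mod_iff)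

lemma homogeneous_hc_vec: "homogeneous_vec d a (hom_part_vec d a v)"
  by (simp add: homogeneous_vec_def)

lemma hom_part_vec_homogeneous:
  "dim_vec v = length d \<Longrightarrow> homogeneous_vec d a v \<Longrightarrow> hom_part_vec d a v = v"
  by (intro eq_vecI) (auto simp: homogeneous_vec_def homogeneous_iff_hc)

lemma bd_vec_in_free_mod: "(\<And>T. c T \<in> free_mod n r) \<Longrightarrow> bd_vec n r c T \<in> free_mod n r"
  by (auto simp: free_mod_iff intro: bd_in_polys)

locale pol_submodule =
  fixes n r :: nat and U :: "'k::field pol vec set"
  assumes sub: "U \<subseteq> free_mod n r"
    and zero_mem: "0\<^sub>v r \<in> U"
    and add_mem: "u \<in> U \<Longrightarrow> v \<in> U \<Longrightarrow> u + v \<in> U"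
    and smult_mem: "p \<in> polys n \<Longrightarrow> u \<in> U \<Longrightarrow> p \<cdot>\<^sub>v u \<in> U"
begin

lemma dim_mem: "u \<in> U \<Longrightarrow> dim_vec u = r"
  using sub by (auto simp: free_mod_iff)

lemma lincomb_mem:
  assumes "finite A" "\<And>i. i \<in> A \<Longrightarrow> p i \<in> polys n" "\<And>i. i \<in> A \<Longrightarrow> u i \<in> U"
  shows "vec r (\<lambda>k. \<Sum>i\<in>A. p i * u i $ k) \<in> U"
  using assms
proof (induction A)
  case empty
  have "vec r (\<lambda>k. \<Sum>i\<in>{}. p i * u i $ k) = 0\<^sub>v r" by (intro eq_vecI) auto
  then show ?case using zero_mem by simp
next
  case (insert i A)
  have "vec r (\<lambda>k. \<Sum>i\<in>insert i A. p i * u i $ k) = p i \<cdot>\<^sub>v u i + vec r (\<lambda>k. \<Sum>i\<in>A. p i * u i $ k)"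
    using insert dim_mem[of "u i"] by (intro eq_vecI) auto
  then show ?case using insert by (auto intro!: add_mem smult_mem)
qed

lemma minus_mem:
  assumes "u \<in> U" "v \<in> U" shows "u - v \<in> U"
proof -
  have "u - v = u + (-1) \<cdot>\<^sub>v v"
    using assms dim_mem by (intro eq_vecI) auto
  then show ?thesis
    using add_mem[OF assms(1) smult_mem[OF polys_uminus[OF polys_one] assms(2)]] by simp
qed

end

text \<open>Koszul regularity of the quotient of the graded free module with basis degrees \<open>d\<close> by \<open>U\<close>.\<close>

definition module_regular :: "nat \<Rightarrow> int list \<Rightarrow> 'k::field pol vec set \<Rightarrow> int \<Rightarrow> bool" where
  "module_regular n d U r \<longleftrightarrow>
     (\<forall>a > r. \<forall>c. (\<forall>T. c T \<in> free_over n d \<and> homogeneous_vec d a (c T) \<and>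
          bd_vec n (length d) c T \<in> U) \<longrightarrow>
        (\<exists>e. \<forall>T. e T \<in> free_over n d \<and> c T - bd_vec n (length d) e T \<in> U))"

lemma module_regularD:
  assumes "module_regular n d U r" "a > r" "\<And>T. c T \<in> free_over n d"
    "\<And>T. homogeneous_vec d a (c T)" "\<And>T. bd_vec n (length d) c T \<in> U"
  shows "\<exists>e. \<forall>T. e T \<in> free_over n d \<and> c T - bd_vec n (length d) e T \<in> U"
  using assms(1)[unfolded module_regular_def, rule_format, of a c] assms(2-5) by simp

lemma scalar_prod_eq_sum: "dim_vec v = r \<Longrightarrow> g \<bullet> v = (\<Sum>k<r. g $ k * v $ k)"
  by (simp add: scalar_prod_def atLeast0LessThan)

lemma module_regular_cyclic:
  assumes I: "pol_ideal n I" and reg: "koszul_regular n I r"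
    and g: "g \<in> free_over n d" "\<And>k. k < length d \<Longrightarrow> homogeneous (d ! k) (g $ k)"
    and surj: "\<And>p. p \<in> polys n \<Longrightarrow> \<exists>v \<in> free_over n d. p - g \<bullet> v \<in> I"
  shows "module_regular n d {v \<in> free_over n d. g \<bullet> v \<in> I} r"
  unfolding module_regular_def
proof safe
  interpret I: pol_ideal n I by fact
  let ?r = "length d"
  fix a c assume a: "a > r" and "\<forall>T. c T \<in> free_mod n ?r \<and> homogeneous_vec d a (c T) \<and>
    bd_vec n ?r c T \<in> {v \<in> free_mod n ?r. g \<bullet> v \<in> I}"
  then have c: "\<And>T. c T \<in> free_mod n ?r" "\<And>T. homogeneous_vec d a (c T)"
      "\<And>T. g \<bullet> bd_vec n ?r c T \<in> I"
    by auto
  have bd_g: "bd n (\<lambda>T. g \<bullet> f T) T = g \<bullet> bd_vec n ?r f T"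
    if f: "\<And>T. f T \<in> free_mod n ?r" for f T
  proof -
    have "bd n (\<lambda>T. g \<bullet> f T) T = bd n (\<lambda>T. \<Sum>k<?r. g $ k * f T $ k) T"
      using f by (intro bd_cong scalar_prod_eq_sum) (simp add: free_mod_iff)
    also have "\<dots> = (\<Sum>k<?r. g $ k * bd_vec n ?r f T $ k)"
      by (simp add: bd_sum bd_mult)
    finally show ?thesis by (simp add: scalar_prod_eq_sum)
  qed
  have gp: "g \<bullet> v \<in> polys n" if "v \<in> free_mod n ?r" for v
    using that g(1) by (auto simp: scalar_prod_eq_sum free_mod_iff)
  have "homogeneous a (g \<bullet> c T)" for T
  proof -
    have "homogeneous (d ! k + (a - d ! k)) (g $ k * c T $ k)" if "k < ?r" for k
      using c(2)[of T] g(2) that by (intro homogeneous_mult) (auto simp: homogeneous_vec_def)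
    then show ?thesis
      using c(1)[of T] by (auto simp: scalar_prod_eq_sum free_mod_iff intro!: homogeneous_sum)
  qed
  then obtain e where "\<forall>T. e T \<in> polys n \<and> g \<bullet> c T - bd n e T \<in> I"
    using koszul_regularE[OF reg a, of "\<lambda>T. g \<bullet> c T"] gp[OF c(1)] c(3) bd_g[OF c(1)] by auto
  then have e: "\<And>T. e T \<in> polys n" "\<And>T. g \<bullet> c T - bd n e T \<in> I" by auto
  have "\<forall>T. \<exists>f. f \<in> free_mod n ?r \<and> e T - g \<bullet> f \<in> I"
    using surj[OF e(1)] by blast
  then obtain f where "\<forall>T. f T \<in> free_mod n ?r \<and> e T - g \<bullet> f T \<in> I" by metis
  then have f: "\<And>T. f T \<in> free_mod n ?r" "\<And>T. e T - g \<bullet> f T \<in> I" by auto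
  have "c T - bd_vec n ?r f T \<in> {v \<in> free_mod n ?r. g \<bullet> v \<in> I}" for T
  proof -
    have bf: "bd_vec n ?r f T \<in> free_mod n ?r" by (rule bd_vec_in_free_mod[OF f(1)])
    have m: "c T - bd_vec n ?r f T \<in> free_mod n ?r"
      using c(1)[of T] bf by (auto simp: free_mod_iff)
    have "g \<bullet> (c T - bd_vec n ?r f T) = g \<bullet> c T - g \<bullet> bd_vec n ?r f T"
      using c(1)[of T] bf g(1) by (intro scalar_prod_minus_distrib) (auto simp: free_mod_def)
    also have "\<dots> = (g \<bullet> c T - bd n e T) + bd n (\<lambda>T. e T - g \<bullet> f T) T"
      by (simp add: bd_diff bd_g[OF f(1)])
    also have "\<dots> \<in> I"
      by (intro I.add_mem I.bd_mem e(2) f(2))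
    finally show ?thesis using m by simp
  qed
  then show "\<exists>e. \<forall>T. e T \<in> free_mod n ?r \<and> c T - bd_vec n ?r e T \<in> {v \<in> free_mod n ?r. g \<bullet> v \<in> I}"
    using f(1) by blast
qed

lemma graded_zero_ideal: "graded_ideal n {0 :: 'k::field pol}"
proof -
  have "pol_ideal n {0 :: 'k pol}" by (rule pol_idealI) auto
  then show ?thesis by (simp add: graded_ideal_def graded_ideal_axioms_def)
qed

text \<open>This is the acyclicity of the Koszul complex of \<open>S\<close>, applied to each basis element separately. The
condition on \<open>d\<close> makes all coefficient degrees positive.\<close>

lemma free_module_acyclic:
  fixes c :: "var set \<Rightarrow> 'k::field pol vec"
  assumes d: "\<And>k. k < length d \<Longrightarrow> d ! k < a"
    and c: "\<And>T. c T \<in> free_over n d" "\<And>T. homogeneous_vec d a (c T)"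
      "\<And>T. bd_vec n (length d) c T = 0\<^sub>v (length d)"
  shows "\<exists>e. \<forall>T. e T \<in> free_over n d \<and> homogeneous_vec d (a - 1) (e T) \<and>
    bd_vec n (length d) e T = c T"
proof -
  let ?F = "free_over n d :: 'k pol vec set"
  let ?b = "bd_vec n (length d) :: (var set \<Rightarrow> 'k pol vec) \<Rightarrow> _"
  have "\<exists>e. \<forall>T. e T \<in> polys n \<and> homogeneous (a - d ! k - 1) (e T) \<and> c T $ k - bd n e T \<in> {0}"
    if k: "k < length d" for k
  proof (rule koszul_regularD[OF koszul_regular_zero_ideal graded_zero_ideal])
    show "0 < a - d ! k" using d[OF k] by simp
    fix T
    show "c T $ k \<in> polys n" using c(1)[of T] k by (simp add: free_mod_iff)
    show "homogeneous (a - d ! k) (c T $ k)" using c(2)[of T] k by (simp add: homogeneous_vec_def)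
    show "bd n (\<lambda>T. c T $ k) T \<in> {0}"
      using arg_cong[OF c(3)[of T], of "\<lambda>v. v $ k"] k by simp
  qed
  then obtain e where "\<forall>k. k < length d \<longrightarrow> (\<forall>T. e k T \<in> polys n \<and> homogeneous (a - d ! k - 1) (e k T) \<and>
      c T $ k - bd n (e k) T \<in> {0})" by metis
  then have e: "e k T \<in> polys n" "homogeneous (a - d ! k - 1) (e k T)" "bd n (e k) T = c T $ k"
    if "k < length d" for k T
    using that by auto
  define e' where "e' = (\<lambda>T. vec (length d) (\<lambda>k. e k T))"
  have "e' T \<in> ?F" for T
    by (simp add: e'_def free_mod_iff e)
  moreover have "homogeneous_vec d (a - 1) (e' T)" for T
    using e(2) by (simp add: homogeneous_vec_def e'_def algebra_simps)
  moreover have "?b e' T = c T" for T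
  proof (intro eq_vecI)
    show "dim_vec (?b e' T) = dim_vec (c T)"
      using c(1)[of T] by (simp add: free_mod_iff)
    fix k assume "k < dim_vec (c T)"
    then have k: "k < length d" using c(1)[of T] by (simp add: free_mod_iff)
    then have "bd n (\<lambda>T. e' T $ k) T = bd n (e k) T"
      by (intro bd_cong) (simp add: e'_def)
    then show "?b e' T $ k = c T $ k" using k e(3) by simp
  qed
  ultimately show ?thesis by blast
qed

definition graded_matrix :: "nat \<Rightarrow> int list \<Rightarrow> int list \<Rightarrow> 'k::field pol mat \<Rightarrow> bool" where
  "graded_matrix n d d' \<phi> \<longleftrightarrow> \<phi> \<in> carrier_mat (length d) (length d') \<and>
     (\<forall>k < length d. \<forall>l < length d'. \<phi> $$ (k, l) \<in> polys n \<and>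
        homogeneous (d' ! l - d ! k) (\<phi> $$ (k, l)))"

context
  fixes n d d' and \<phi> :: "'k::field pol mat"
  assumes \<phi>: "graded_matrix n d d' \<phi>"
begin

lemma graded_matrix_index:
  assumes "dim_vec w = length d'" "k < length d"
  shows "(\<phi> *\<^sub>v w) $ k = (\<Sum>l<length d'. \<phi> $$ (k, l) * w $ l)"
  using \<phi> assms by (auto simp: graded_matrix_def scalar_prod_def atLeast0LessThan)

lemma graded_matrix_dim [simp]: "dim_row \<phi> = length d" "dim_col \<phi> = length d'"
  using \<phi> by (auto simp: graded_matrix_def)

lemma graded_matrix_in_free_mod:
  assumes "w \<in> free_over n d'" shows "\<phi> *\<^sub>v w \<in> free_over n d"
  unfolding free_mod_iff
proof safe
  fix k assume "k < length d"
  moreover from this have "(\<Sum>l<length d'. \<phi> $$ (k, l) * w $ l) \<in> polys n"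
    using assms \<phi> by (intro polys_sum polys_mult) (auto simp: free_mod_iff graded_matrix_def)
  ultimately show "(\<phi> *\<^sub>v w) $ k \<in> polys n"
    using assms by (simp add: free_mod_iff graded_matrix_index del: index_mult_mat_vec)
qed simp

lemma graded_matrix_hc_vec:
  assumes "dim_vec w = length d'"
  shows "\<phi> *\<^sub>v hom_part_vec d' a w = hom_part_vec d a (\<phi> *\<^sub>v w)"
proof (intro eq_vecI)
  fix k assume "k < dim_vec (hom_part_vec d a (\<phi> *\<^sub>v w))"
  then have k: "k < length d" by simp
  have "hom_part (a - d ! k) (\<phi> $$ (k, l) * w $ l) = \<phi> $$ (k, l) * hom_part (a - d' ! l) (w $ l)"
    if "l < length d'" for l
  proof -
    have "homogeneous (d' ! l - d ! k) (\<phi> $$ (k, l))"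
      using \<phi> k that by (simp add: graded_matrix_def)
    from hom_part_mult_homogeneous[OF this, of "a - d ! k" "w $ l"] show ?thesis
      by (simp add: mult.commute)
  qed
  then show "(\<phi> *\<^sub>v hom_part_vec d' a w) $ k = hom_part_vec d a (\<phi> *\<^sub>v w) $ k"
    using k assms by (simp add: graded_matrix_index hom_part_sum del: index_mult_mat_vec)
qed simp

lemma graded_matrix_bd_vec:
  assumes "\<And>T. w T \<in> free_over n d'"
  shows "bd_vec n (length d) (\<lambda>T. \<phi> *\<^sub>v w T) T = \<phi> *\<^sub>v bd_vec n (length d') w T"
proof (intro eq_vecI)
  fix k assume "k < dim_vec (\<phi> *\<^sub>v bd_vec n (length d') w T)"
  then have k: "k < length d" by simp
  have "bd n (\<lambda>T. (\<phi> *\<^sub>v w T) $ k) T = bd n (\<lambda>T. \<Sum>l<length d'. \<phi> $$ (k, l) * w T $ l) T"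
    using assms k by (intro bd_cong graded_matrix_index) (auto simp: free_mod_iff)
  then show "bd_vec n (length d) (\<lambda>T. \<phi> *\<^sub>v w T) T $ k = (\<phi> *\<^sub>v bd_vec n (length d') w T) $ k"
    using k by (simp add: graded_matrix_index bd_sum bd_mult del: index_mult_mat_vec)
qed simp

lemma graded_matrix_minus:
  assumes "v \<in> free_over n d'" "w \<in> free_over n d'"
  shows "\<phi> *\<^sub>v (v - w) = \<phi> *\<^sub>v v - \<phi> *\<^sub>v w"
  using assms \<phi> by (intro mult_minus_distrib_mat_vec) (auto simp: free_mod_def graded_matrix_def)

lemma graded_matrix_smult:
  assumes "w \<in> free_over n d'"
  shows "\<phi> *\<^sub>v (p \<cdot>\<^sub>v w) = p \<cdot>\<^sub>v (\<phi> *\<^sub>v w)"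
proof (intro eq_vecI)
  fix k assume "k < dim_vec (p \<cdot>\<^sub>v (\<phi> *\<^sub>v w))"
  then have k: "k < length d" by simp
  have "(\<Sum>l<length d'. \<phi> $$ (k, l) * (p \<cdot>\<^sub>v w) $ l) = p * (\<Sum>l<length d'. \<phi> $$ (k, l) * w $ l)"
    using assms unfolding sum_distrib_left by (intro sum.cong) (auto simp: free_mod_iff mult_ac)
  then show "(\<phi> *\<^sub>v (p \<cdot>\<^sub>v w)) $ k = (p \<cdot>\<^sub>v (\<phi> *\<^sub>v w)) $ k"
    using k assms by (simp add: graded_matrix_index free_mod_iff del: index_mult_mat_vec)
qed simp

lemma pol_submodule_image: "pol_submodule n (length d) ((\<lambda>w. \<phi> *\<^sub>v w) ` free_over n d')"
  (is "pol_submodule _ _ ?M")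
proof
  show "?M \<subseteq> free_over n d"
    using graded_matrix_in_free_mod by blast
  have "\<phi> *\<^sub>v 0\<^sub>v (length d') = 0\<^sub>v (length d)"
    by (intro eq_vecI) (auto simp: graded_matrix_index simp del: index_mult_mat_vec)
  then show "0\<^sub>v (length d) \<in> ?M"
    by (intro image_eqI[of _ _ "0\<^sub>v (length d')"]) (auto simp: free_mod_iff)
  fix u v p
  assume "u \<in> ?M"
  then obtain u' where u': "u' \<in> free_over n d'" "u = \<phi> *\<^sub>v u'" by blast
  have "p \<cdot>\<^sub>v u = \<phi> *\<^sub>v (p \<cdot>\<^sub>v u')"
    using u' by (simp add: graded_matrix_smult)
  then show "p \<cdot>\<^sub>v u \<in> ?M" if "p \<in> polys n"
    using that u' by (intro image_eqI[of _ _ "p \<cdot>\<^sub>v u'"]) (auto simp: free_mod_iff)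
  assume "v \<in> ?M"
  then obtain v' where v': "v' \<in> free_over n d'" "v = \<phi> *\<^sub>v v'" by blast
  have "u + v = \<phi> *\<^sub>v (u' + v')"
    using u' v' \<phi> by (auto simp: free_mod_def graded_matrix_def mult_add_distrib_mat_vec)
  then show "u + v \<in> ?M"
    using u' v' by (intro image_eqI[of _ _ "u' + v'"]) (auto simp: free_mod_iff)
qed

lemma pol_submodule_kernel:
  "pol_submodule n (length d') {w \<in> free_over n d'. \<phi> *\<^sub>v w = 0\<^sub>v (length d)}"
  (is "pol_submodule _ _ ?M")
proof
  have "\<phi> *\<^sub>v 0\<^sub>v (length d') = 0\<^sub>v (length d)"
    by (intro eq_vecI) (auto simp: graded_matrix_index simp del: index_mult_mat_vec)
  then show "0\<^sub>v (length d') \<in> ?M"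
    by (auto simp: free_mod_iff)
  fix u v p
  assume u: "u \<in> ?M"
  have "\<phi> *\<^sub>v (p \<cdot>\<^sub>v u) = p \<cdot>\<^sub>v (\<phi> *\<^sub>v u)"
    using u by (intro graded_matrix_smult) simp
  then show "p \<cdot>\<^sub>v u \<in> ?M" if "p \<in> polys n"
    using u that by (auto simp: free_mod_iff)
  assume v: "v \<in> ?M"
  have "\<phi> *\<^sub>v (u + v) = \<phi> *\<^sub>v u + \<phi> *\<^sub>v v"
    using u v \<phi> by (auto simp: free_mod_def graded_matrix_def mult_add_distrib_mat_vec)
  then show "u + v \<in> ?M"
    using u v by (auto simp: free_mod_iff)
qed auto

text \<open>The quotient by the kernel of \<open>\<phi>\<close> is \<open>U\<close>. A cycle in \<open>U\<close> bounds a chain \<open>e\<close> in the free module, and \<open>e\<close> is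
a cycle modulo \<open>U\<close>, so regularity corrects \<open>e\<close> to a chain in \<open>U\<close>. The bound grows by one because
\<open>e\<close> has coefficient degree \<open>a - 1\<close>.\<close>

lemma module_regular_syzygy:
  assumes reg: "module_regular n d U r" and d: "\<And>k. k < length d \<Longrightarrow> d ! k \<le> r"
    and U: "U = (\<lambda>w. \<phi> *\<^sub>v w) ` free_over n d'"
  shows "module_regular n d' {w \<in> free_over n d'. \<phi> *\<^sub>v w = 0\<^sub>v (length d)} (r + 1)"
    (is "module_regular n d' ?K _")
  unfolding module_regular_def
proof safe
  let ?F = "free_over n d :: 'k pol vec set"
  let ?b = "bd_vec n (length d) :: (var set \<Rightarrow> 'k pol vec) \<Rightarrow> _"
  let ?F' = "free_over n d' :: 'k pol vec set"
  let ?b' = "bd_vec n (length d') :: (var set \<Rightarrow> 'k pol vec) \<Rightarrow> _"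
  interpret U: pol_submodule n "length d" U unfolding U by (rule pol_submodule_image)
  fix a c assume a: "a > r + 1" and "\<forall>T. c T \<in> ?F' \<and> homogeneous_vec d' a (c T) \<and>
    ?b' c T \<in> ?K"
  then have c: "\<And>T. c T \<in> ?F'" "\<And>T. homogeneous_vec d' a (c T)"
    "\<And>T. \<phi> *\<^sub>v ?b' c T = 0\<^sub>v (length d)" by auto
  have dima: "dim_vec (c T) = length d'" for T using c(1)[of T] by (simp add: free_mod_iff)
  have "\<exists>e. \<forall>T. e T \<in> ?F \<and> homogeneous_vec d (a - 1) (e T) \<and>
    ?b e T = \<phi> *\<^sub>v c T"
  proof (rule free_module_acyclic)
    show "d ! k < a" if "k < length d" for k using d[OF that] a by simp
    fix T
    show "\<phi> *\<^sub>v c T \<in> ?F" by (rule graded_matrix_in_free_mod[OF c(1)])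
    have "\<phi> *\<^sub>v c T = hom_part_vec d a (\<phi> *\<^sub>v c T)"
      using graded_matrix_hc_vec[OF dima, of a T] hom_part_vec_homogeneous[OF dima c(2)] by simp
    then show "homogeneous_vec d a (\<phi> *\<^sub>v c T)" using homogeneous_hc_vec by metis
    show "?b (\<lambda>T. \<phi> *\<^sub>v c T) T = 0\<^sub>v (length d)"
      using graded_matrix_bd_vec[OF c(1)] c(3) by simp
  qed
  then obtain e where "\<forall>T. e T \<in> ?F \<and> homogeneous_vec d (a - 1) (e T) \<and>
    ?b e T = \<phi> *\<^sub>v c T" ..
  then have e: "\<And>T. e T \<in> ?F" "\<And>T. homogeneous_vec d (a - 1) (e T)"
    "\<And>T. ?b e T = \<phi> *\<^sub>v c T" by auto
  have a': "a - 1 > r" using a by simp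
  have eU: "?b e T \<in> U" for T
    unfolding e(3) U using c(1) by blast
  obtain f where "\<forall>T. f T \<in> ?F \<and> e T - ?b f T \<in> U"
    using module_regularD[OF reg a' e(1,2) eU] by blast
  then have f: "\<And>T. f T \<in> ?F" "\<And>T. e T - ?b f T \<in> U" by auto
  have "\<forall>T. \<exists>h. h \<in> ?F' \<and> e T - ?b f T = \<phi> *\<^sub>v h"
    using f(2) unfolding U by blast
  then obtain h where "\<forall>T. h T \<in> ?F' \<and> e T - ?b f T = \<phi> *\<^sub>v h T"
    by metis
  then have h: "\<And>T. h T \<in> ?F'" "\<And>T. e T - ?b f T = \<phi> *\<^sub>v h T" by auto
  have "c T - ?b' h T \<in> ?K" for T
  proof -
    have bh: "?b' h T \<in> ?F'" by (rule bd_vec_in_free_mod[OF h(1)])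
    have "\<phi> *\<^sub>v ?b' h T = ?b (\<lambda>T. \<phi> *\<^sub>v h T) T"
      by (rule graded_matrix_bd_vec[OF h(1), symmetric])
    also have "\<dots> = ?b (\<lambda>T. e T - ?b f T) T"
      by (simp only: h(2))
    also have "\<dots> = ?b e T"
    proof (intro eq_vecI)
      fix k assume "k < dim_vec (?b e T)"
      then have k: "k < length d" by simp
      have "bd n (\<lambda>T. (e T - ?b f T) $ k) T =
          bd n (\<lambda>T. e T $ k - bd n (\<lambda>T. f T $ k) T) T"
        using k by (intro bd_cong) simp
      then show "?b (\<lambda>T. e T - ?b f T) T $ k = ?b e T $ k"
        using k by (simp add: bd_diff)
    qed simp
    also have "\<dots> = \<phi> *\<^sub>v c T" by (rule e(3))
    finally have "\<phi> *\<^sub>v (c T - ?b' h T) = 0\<^sub>v (length d)"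
      by (simp add: graded_matrix_minus[OF c(1) bh]) (intro eq_vecI, auto)
    then show ?thesis
      using c(1)[of T] bh by (auto simp: free_mod_iff)
  qed
  then show "\<exists>e. \<forall>T. e T \<in> ?F' \<and> c T - ?b' e T \<in> ?K"
    using h(1) by blast
qed

end

text \<open>A basis element of degree above \<open>r\<close> is a Koszul cycle of exterior degree zero, so modulo \<open>U\<close> it is a
combination of variables times vectors. As \<open>U\<close> is contained in the irrelevant ideal times the free
module, its own coordinate \<open>1\<close> would lie in the irrelevant ideal.\<close>

lemma module_regular_degree_bound:
  assumes reg: "module_regular n d U r" and sub: "U \<subseteq> free_over n d" and z: "0\<^sub>v (length d) \<in> U"
    and min: "\<And>u k. u \<in> U \<Longrightarrow> k < length d \<Longrightarrow> u $ k \<in> irrelevant_ideal n"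
    and k: "k < length d"
  shows "d ! k \<le> r"
proof (rule ccontr)
  assume "\<not> d ! k \<le> r"
  then have a: "d ! k > r" by simp
  define c where "c = (\<lambda>T::var set. if T = {} then unit_vec (length d) k else (0\<^sub>v (length d) :: 'a pol vec))"
  have bc: "bd_vec n (length d) c T = 0\<^sub>v (length d)" for T
    by (intro eq_vecI) (auto simp: bd_def c_def)
  have "\<exists>e. \<forall>T. e T \<in> free_over n d \<and> c T - bd_vec n (length d) e T \<in> U"
  proof (rule module_regularD[OF reg a])
    show "bd_vec n (length d) c T \<in> U" for T by (simp add: bc z)
  qed (auto simp: c_def free_mod_iff homogeneous_vec_def unit_vec_def)
  then obtain e where e: "e T \<in> free_over n d" "c T - bd_vec n (length d) e T \<in> U" for T
    by blast
  have "(c {} - bd_vec n (length d) e {}) $ k \<in> irrelevant_ideal n"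
    using min[OF e(2) k] .
  then have "1 - bd n (\<lambda>T. e T $ k) {} \<in> irrelevant_ideal n"
    using k by (simp add: c_def)
  moreover have "bd n (\<lambda>T. e T $ k) {} \<in> irrelevant_ideal n"
  proof -
    interpret I: pol_ideal n "irrelevant_ideal n :: 'a pol set"
      unfolding irrelevant_ideal_eq by (intro pol_ideal_edge_ideal) auto
    have "Var v \<in> (irrelevant_ideal n :: 'a pol set)" if "v \<in> var_set n" for v
      unfolding irrelevant_ideal_eq using that by (intro Var_in_edge_ideal) auto
    then show ?thesis
      unfolding bd_def using e(1) k
      by (intro I.sum_mem I.mult_mem' I.mult_mem) (auto simp: free_mod_iff)
  qed
  ultimately show False by (auto simp: irrelevant_ideal_iff lookup_minus)
qed


section \<open>Existence of minimal graded free resolutions\<close>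

lemma lookup_le_mdeg: "lookup m v \<le> mdeg m"
  unfolding mdeg_def by (cases "v \<in> keys m") (auto intro: member_le_sum simp: in_keys_iff)

lemma finite_monoms: "finite V \<Longrightarrow> finite {m :: monom. keys m \<subseteq> V \<and> mdeg m \<le> t}"
proof (rule finite_imageD)
  assume "finite V"
  have "lookup ` {m. keys m \<subseteq> V \<and> mdeg m \<le> t} \<subseteq>
      {f. \<forall>v. (v \<in> V \<longrightarrow> f v \<in> {..t}) \<and> (v \<notin> V \<longrightarrow> f v = 0)}"
    by (auto simp: in_keys_iff intro: order_trans[OF lookup_le_mdeg])
  moreover have "finite {f :: var \<Rightarrow> nat. \<forall>v. (v \<in> V \<longrightarrow> f v \<in> {..t}) \<and> (v \<notin> V \<longrightarrow> f v = 0)}"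
    using \<open>finite V\<close> by (rule finite_set_of_finite_funs) simp
  ultimately show "finite (lookup ` {m. keys m \<subseteq> V \<and> mdeg m \<le> t})"
    by (rule finite_subset)
qed (auto intro: inj_onI)

lemma lookup_const_mult: "lookup (single 0 \<kappa> * p) m = \<kappa> * lookup p m" for p :: "'k::field pol"
  by (induction p rule: poly_mapping_induct)
     (auto simp: mult_single lookup_single when_def distrib_left lookup_add)

text \<open>Generation is stated through all submodules that contain \<open>G\<close>, which avoids choosing coefficients.\<close>

definition generates :: "nat \<Rightarrow> nat \<Rightarrow> 'k::field pol vec set \<Rightarrow> 'k pol vec set \<Rightarrow> bool" where
  "generates n r G W \<longleftrightarrow> (\<forall>N. pol_submodule n r N \<and> G \<subseteq> N \<longrightarrow> W \<subseteq> N)"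

text \<open>Gaussian elimination: \<open>W\<close> is a \<open>K\<close>-subspace of vectors supported on the finite set \<open>B\<close> of pairs of a
coordinate and a monomial, and elements of \<open>B\<close> are eliminated one by one.\<close>

lemma generates_finite_support:
  fixes W :: "'k::field pol vec set"
  assumes "finite B" "W \<subseteq> free_mod n r"
    and "\<And>u v \<kappa>. u \<in> W \<Longrightarrow> v \<in> W \<Longrightarrow> u - single 0 \<kappa> \<cdot>\<^sub>v v \<in> W"
    and "\<And>u k m. u \<in> W \<Longrightarrow> k < r \<Longrightarrow> (k, m) \<notin> B \<Longrightarrow> lookup (u $ k) m = 0"
  shows "\<exists>G \<subseteq> W. finite G \<and> generates n r G W"
  using assms
proof (induction B arbitrary: W)
  case empty
  have "u = 0\<^sub>v r" if "u \<in> W" for u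
    using empty.prems(1,3) that
    by (intro eq_vecI poly_mapping_eqI) (auto simp: free_mod_iff)
  then have "generates n r {} W"
    unfolding generates_def using pol_submodule.zero_mem by blast
  then show ?case by blast
next
  case (insert b B)
  obtain k0 m0 where b: "b = (k0, m0)" by (cases b)
  show ?case
  proof (cases "k0 < r \<and> (\<exists>u\<in>W. lookup (u $ k0) m0 \<noteq> 0)")
    case False
    have "lookup (u $ k) m = 0" if "u \<in> W" "k < r" "(k, m) \<notin> B" for u k m
      using that insert.prems(3)[OF that(1,2), of m] False b by (cases "(k, m) = b") auto
    then show ?thesis
      using insert.prems by (intro insert.IH) auto
  next
    case True
    then obtain u0 where k0: "k0 < r" and u0: "u0 \<in> W" "lookup (u0 $ k0) m0 \<noteq> 0" by blast
    define W0 where "W0 = {u \<in> W. lookup (u $ k0) m0 = 0}"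
    have dim: "dim_vec u = r" if "u \<in> W" for u
      using that insert.prems(1) by (auto simp: free_mod_iff)
    have "\<exists>G\<subseteq>W0. finite G \<and> generates n r G W0"
    proof (rule insert.IH)
      show "W0 \<subseteq> free_mod n r" using insert.prems(1) by (auto simp: W0_def)
      show "u - single 0 \<kappa> \<cdot>\<^sub>v v \<in> W0" if "u \<in> W0" "v \<in> W0" for u v \<kappa>
        using that insert.prems(2)[of u v \<kappa>] k0 dim
        by (auto simp: W0_def lookup_minus lookup_const_mult)
      show "lookup (u $ k) m = 0" if "u \<in> W0" "k < r" "(k, m) \<notin> B" for u k m
        using that insert.prems(3)[of u k m] b by (cases "(k, m) = b") (auto simp: W0_def)
    qed
    then obtain G where G: "G \<subseteq> W0" "finite G" "generates n r G W0" by blast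
    have "generates n r (insert u0 G) W"
      unfolding generates_def
    proof (intro allI impI subsetI)
      fix N u assume N: "pol_submodule n r N \<and> insert u0 G \<subseteq> N" and u: "u \<in> W"
      then interpret N: pol_submodule n r N by simp
      define \<kappa> where "\<kappa> = lookup (u $ k0) m0 / lookup (u0 $ k0) m0"
      define u1 where "u1 = u - single 0 \<kappa> \<cdot>\<^sub>v u0"
      have "u1 \<in> W0"
        using insert.prems(2)[OF u u0(1), of \<kappa>] k0 u0 dim[OF u] dim[OF u0(1)]
        by (simp add: W0_def u1_def lookup_minus lookup_const_mult \<kappa>_def)
      then have "u1 \<in> N" using G(3) N unfolding generates_def by blast
      moreover have "single 0 \<kappa> \<cdot>\<^sub>v u0 \<in> N"
        using N by (intro N.smult_mem) (auto simp: polys_single)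
      moreover have "u = u1 + single 0 \<kappa> \<cdot>\<^sub>v u0"
        using dim[OF u] dim[OF u0(1)] by (intro eq_vecI) (auto simp: u1_def)
      ultimately show "u \<in> N" using N.add_mem by simp
    qed
    then show ?thesis
      using G u0 by (intro exI[of _ "insert u0 G"]) (auto simp: W0_def)
  qed
qed

text \<open>The induction hypothesis of the construction of a minimal resolution: \<open>U\<close> is the module of relations
still to be resolved.\<close>

locale regular_submodule = pol_submodule n "length d" U
  for n d and U :: "'k::field pol vec set" +
  fixes r :: int
  assumes hom_part_vec_mem: "u \<in> U \<Longrightarrow> hom_part_vec d a u \<in> U"
    and minimal: "u \<in> U \<Longrightarrow> k < length d \<Longrightarrow> u $ k \<in> irrelevant_ideal n"
    and regular: "module_regular n d U r"
begin

lemma degree_bound: "k < length d \<Longrightarrow> d ! k \<le> r"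
  using module_regular_degree_bound[OF regular sub zero_mem minimal] .

text \<open>The element \<open>z\<close>, seen as a cycle of exterior degree zero, is the boundary of a chain in the free
module; regularity moves that chain into \<open>U\<close>.\<close>

lemma high_degree_decomposable:
  assumes z: "z \<in> U" "homogeneous_vec d a z" and a: "a > r + 1"
  shows "\<exists>u. (\<forall>v. u v \<in> U \<and> homogeneous_vec d (a - 1) (u v)) \<and>
    z = vec (length d) (\<lambda>k. \<Sum>v\<in>var_set n. Var v * u v $ k)"
proof -
  let ?r = "length d"
  have zf: "z \<in> free_mod n ?r" using z sub by blast
  define c where "c = (\<lambda>T::var set. if T = {} then z else 0\<^sub>v ?r)"
  have "\<exists>e. \<forall>T. e T \<in> free_mod n ?r \<and> homogeneous_vec d (a - 1) (e T) \<and> bd_vec n ?r e T = c T"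
  proof (rule free_module_acyclic)
    show "d ! k < a" if "k < ?r" for k using degree_bound[OF that] a by simp
    fix T
    show "c T \<in> free_mod n ?r" using zf by (auto simp: c_def free_mod_iff)
    show "homogeneous_vec d a (c T)" using z by (auto simp: c_def homogeneous_vec_def)
    show "bd_vec n ?r c T = 0\<^sub>v ?r"
      by (intro eq_vecI) (auto simp: bd_def c_def)
  qed
  then obtain e where "\<forall>T. e T \<in> free_mod n ?r \<and> homogeneous_vec d (a - 1) (e T) \<and> bd_vec n ?r e T = c T" ..
  then have e: "\<And>T. e T \<in> free_mod n ?r" "\<And>T. homogeneous_vec d (a - 1) (e T)"
    "\<And>T. bd_vec n ?r e T = c T" by auto
  have a': "a - 1 > r" using a by simp
  have eU: "bd_vec n ?r e T \<in> U" for T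
    unfolding e(3) using z zero_mem by (simp add: c_def)
  obtain f where "\<forall>T. f T \<in> free_mod n ?r \<and> e T - bd_vec n ?r f T \<in> U"
    using module_regularD[OF regular a' e(1,2) eU] by blast
  then have f: "\<And>T. f T \<in> free_mod n ?r" "\<And>T. e T - bd_vec n ?r f T \<in> U" by auto
  define u where "u = (\<lambda>v. hom_part_vec d (a - 1) (e {v} - bd_vec n ?r f {v}))"
  have "u v \<in> U \<and> homogeneous_vec d (a - 1) (u v)" for v
    using f(2) by (simp add: u_def hom_part_vec_mem homogeneous_hc_vec)
  moreover have "z = vec ?r (\<lambda>k. \<Sum>v\<in>var_set n. Var v * u v $ k)"
  proof (intro eq_vecI)
    fix k assume "k < dim_vec (vec ?r (\<lambda>k. \<Sum>v\<in>var_set n. Var v * u v $ k))"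
    then have k: "k < ?r" by simp
    have "z $ k = bd n (\<lambda>T. e T $ k) {}"
      using arg_cong[OF e(3)[of "{}"], of "\<lambda>v. v $ k"] k by (simp add: c_def)
    also have "\<dots> = bd n (\<lambda>T. e T $ k - bd n (\<lambda>T. f T $ k) T) {}"
      by (simp add: bd_diff)
    also have "\<dots> = (\<Sum>v\<in>var_set n. Var v * (e {v} $ k - bd n (\<lambda>T. f T $ k) {v}))"
      by (simp add: bd_def[of n _ "{}"] ksign_def)
    finally have zk: "z $ k = (\<Sum>v\<in>var_set n. Var v * (e {v} $ k - bd n (\<lambda>T. f T $ k) {v}))" .
    have "z $ k = hom_part (a - d ! k) (z $ k)"
      using z(2) k by (simp add: homogeneous_vec_def homogeneous_iff_hc)
    also have "\<dots> = (\<Sum>v\<in>var_set n. Var v * hom_part (a - d ! k - 1) (e {v} $ k - bd n (\<lambda>T. f T $ k) {v}))"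
      unfolding zk by (simp add: hom_part_sum hom_part_Var_mult)
    also have "\<dots> = (\<Sum>v\<in>var_set n. Var v * u v $ k)"
      using k by (simp add: u_def algebra_simps)
    finally show "z $ k = vec ?r (\<lambda>k. \<Sum>v\<in>var_set n. Var v * u v $ k) $ k"
      using k by simp
  qed (use zf in \<open>simp add: free_mod_iff\<close>)
  ultimately show ?thesis by blast
qed

lemma finitely_generated_degree:
  "\<exists>G \<subseteq> {u \<in> U. homogeneous_vec d a u}. finite G \<and> generates n (length d) G {u \<in> U. homogeneous_vec d a u}"
proof (rule generates_finite_support)
  let ?t = "\<lambda>k. nat (a - d ! k)"
  show "finite (SIGMA k:{..<length d}. {m. keys m \<subseteq> var_set n \<and> mdeg m \<le> ?t k})"
    by (intro finite_SigmaI finite_monoms) auto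
  show "{u \<in> U. homogeneous_vec d a u} \<subseteq> free_over n d" using sub by blast
  fix u v \<kappa> k m
  assume u: "u \<in> {u \<in> U. homogeneous_vec d a u}"
  show "lookup (u $ k) m = 0"
    if "k < length d" "(k, m) \<notin> (SIGMA k:{..<length d}. {m. keys m \<subseteq> var_set n \<and> mdeg m \<le> ?t k})"
  proof (rule ccontr)
    assume m: "lookup (u $ k) m \<noteq> 0"
    then have "int (mdeg m) = a - d ! k"
      using u that by (auto simp: homogeneous_vec_def homogeneous_iff)
    moreover have "u $ k \<in> polys n" using u that sub by (auto simp: free_mod_iff)
    with m have "keys m \<subseteq> var_set n" by (simp add: polys_iff in_keys_iff)
    ultimately show False using that by auto
  qed
  assume v: "v \<in> {u \<in> U. homogeneous_vec d a u}"
  have "u - single 0 \<kappa> \<cdot>\<^sub>v v \<in> U"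
    using u v by (intro minus_mem smult_mem) (auto simp: polys_single)
  moreover have "homogeneous_vec d a (u - single 0 \<kappa> \<cdot>\<^sub>v v)"
    using u v dim_mem[of v]
    by (auto simp: homogeneous_vec_def homogeneous_iff lookup_minus lookup_const_mult, metis mult_zero_right)
  ultimately show "u - single 0 \<kappa> \<cdot>\<^sub>v v \<in> {u \<in> U. homogeneous_vec d a u}" by simp
qed

text \<open>Each element of \<open>U\<close> is the sum of its homogeneous components, which lie in \<open>U\<close>.\<close>

lemma homogeneous_components_generate:
  assumes N: "pol_submodule n (length d) N" and h: "\<And>a u. u \<in> U \<Longrightarrow> homogeneous_vec d a u \<Longrightarrow> u \<in> N"
  shows "U \<subseteq> N"
proof
  interpret N: pol_submodule n "length d" N by fact
  fix u assume u: "u \<in> U"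
  define D where "D = (\<Union>k<length d. (\<lambda>m. d ! k + int (mdeg m)) ` keys (u $ k))"
  have D: "finite D" by (simp add: D_def)
  have "vec (length d) (\<lambda>k. \<Sum>a\<in>D. 1 * hom_part_vec d a u $ k) \<in> N"
    using u D by (intro N.lincomb_mem h[OF hom_part_vec_mem homogeneous_hc_vec]) auto
  also have "vec (length d) (\<lambda>k. \<Sum>a\<in>D. 1 * hom_part_vec d a u $ k) = u"
  proof (intro eq_vecI)
    fix k assume "k < dim_vec u"
    then have k: "k < length d" using dim_mem[OF u] by simp
    have "(\<Sum>a\<in>D. hom_part (a - d ! k) (u $ k)) = (\<Sum>b\<in>(\<lambda>a. a - d ! k) ` D. hom_part b (u $ k))"
      by (subst sum.reindex) (auto intro: inj_onI)
    also have "\<dots> = u $ k"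
    proof (rule sum_hc)
      fix m assume "m \<in> keys (u $ k)"
      then have "d ! k + int (mdeg m) \<in> D" using k by (auto simp: D_def)
      then show "int (mdeg m) \<in> (\<lambda>a. a - d ! k) ` D" by (rule rev_image_eqI) simp
    qed (simp add: D)
    finally show "vec (length d) (\<lambda>k. \<Sum>a\<in>D. 1 * hom_part_vec d a u $ k) $ k = u $ k"
      using k by simp
  qed (simp add: dim_mem[OF u])
  finally show "u \<in> N" .
qed

text \<open>By \<open>high_degree_decomposable\<close> the elements of degree at most \<open>r + 1\<close> generate \<open>U\<close>, and there are
none below the least basis degree; each of the finitely many remaining degrees is a
finite-dimensional vector space.\<close>

lemma finite_homogeneous_generators:
  "\<exists>G \<subseteq> U. finite G \<and> (\<forall>g\<in>G. \<exists>a. homogeneous_vec d a g) \<and> generates n (length d) G U"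
proof -
  let ?H = "\<lambda>a. {u \<in> U. homogeneous_vec d a u}"
  have "\<forall>a. \<exists>G. G \<subseteq> ?H a \<and> finite G \<and> generates n (length d) G (?H a)"
    using finitely_generated_degree by blast
  from choice[OF this] obtain G
    where "\<forall>a. G a \<subseteq> ?H a \<and> finite (G a) \<and> generates n (length d) (G a) (?H a)" ..
  then have G: "\<And>a. G a \<subseteq> ?H a" "\<And>a. finite (G a)" "\<And>a. generates n (length d) (G a) (?H a)" by auto
  \<comment> \<open>The element \<open>0\<close> only makes the minimum meaningful for an empty \<open>d\<close>.\<close>
  define lo where "lo = Min (insert 0 (set d))"
  have lo: "lo \<le> d ! k" if "k < length d" for k
    unfolding lo_def using that by (intro Min_le) auto
  define GG where "GG = (\<Union>a\<in>{lo..r + 1}. G a)"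
  have "generates n (length d) GG U"
    unfolding generates_def
  proof (intro allI impI)
    fix N assume N: "pol_submodule n (length d) N \<and> GG \<subseteq> N"
    then interpret N: pol_submodule n "length d" N by simp
    have low: "?H a \<subseteq> N" if "a \<le> r + 1" for a
    proof (cases "a < lo")
      case True
      have "u = 0\<^sub>v (length d)" if "u \<in> ?H a" for u
        using that lo True dim_mem[of u]
        by (intro eq_vecI homogeneous_negative[of "a - d ! k" for k])
           (auto simp: homogeneous_vec_def, smt (verit) homogeneous_negative)
      then show ?thesis using N.zero_mem by blast
    next
      case False
      then have "a \<in> {lo..r + 1}" using that by simp
      then have "G a \<subseteq> N" using N unfolding GG_def by blast
      then show ?thesis using G(3)[of a] N unfolding generates_def by blast
    qed
    have "?H a \<subseteq> N" for a
    proof (induction "nat (a - r - 1)" arbitrary: a)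
      case 0
      then show ?case by (intro low) simp
    next
      case (Suc t)
      then have a: "a > r + 1" "t = nat (a - 1 - r - 1)" by auto
      have IH: "?H (a - 1) \<subseteq> N" using a(2) by (rule Suc.hyps(1))
      show ?case
      proof
        fix z assume "z \<in> ?H a"
        then obtain u where u: "\<forall>v. u v \<in> U \<and> homogeneous_vec d (a - 1) (u v)"
          and z: "z = vec (length d) (\<lambda>k. \<Sum>v\<in>var_set n. Var v * u v $ k)"
          using high_degree_decomposable[of z a] a(1) by auto
        show "z \<in> N" unfolding z using u IH by (intro N.lincomb_mem) auto
      qed
    qed
    then show "U \<subseteq> N" using N by (intro homogeneous_components_generate) auto
  qed
  moreover have "GG \<subseteq> U" "finite GG" "\<forall>g\<in>GG. \<exists>a. homogeneous_vec d a g"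
    using G(1,2) by (auto simp: GG_def)
  ultimately show ?thesis by blast
qed

text \<open>The columns of \<open>\<phi>\<close> are a generating set of least size. A relation among them with a nonzero constant
coefficient would make one generator redundant, so the kernel satisfies the minimality condition.\<close>

lemma minimal_presentation:
  "\<exists>d' \<phi>. graded_matrix n d d' \<phi> \<and> U = (\<lambda>w. \<phi> *\<^sub>v w) ` free_over n d' \<and>
    regular_submodule n d' {w \<in> free_over n d'. \<phi> *\<^sub>v w = 0\<^sub>v (length d)} (r + 1)"
proof -
  let ?P = "\<lambda>G. G \<subseteq> U \<and> finite G \<and> (\<forall>g\<in>G. \<exists>a. homogeneous_vec d a g) \<and> generates n (length d) G U"
  obtain G0 where "?P G0" using finite_homogeneous_generators by blast
  from ex_has_least_nat[of ?P, OF this, of card]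
  obtain G where PG: "?P G" and "\<forall>G'. ?P G' \<longrightarrow> card G \<le> card G'" by (elim exE conjE) blast
  then have least: "card G \<le> card G'" if "?P G'" for G' using that by blast
  from PG have G: "G \<subseteq> U" "finite G" "\<And>g. g \<in> G \<Longrightarrow> \<exists>a. homogeneous_vec d a g" "generates n (length d) G U"
    by auto
  obtain gs where gs: "set gs = G" "distinct gs" using finite_distinct_list[OF G(2)] by blast
  have "\<forall>g\<in>G. \<exists>a. homogeneous_vec d a g" using G(3) by blast
  from bchoice[OF this] obtain dg where dg: "\<forall>g\<in>G. homogeneous_vec d (dg g) g" ..
  define d' where "d' = map dg gs"
  define \<phi> where "\<phi> = mat (length d) (length d') (\<lambda>(k, l). gs ! l $ k)"
  have len: "length d' = length gs" by (simp add: d'_def)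
  have gsU: "gs ! l \<in> U" if "l < length d'" for l using that gs G(1) by (auto simp: len)
  have \<phi>i: "\<phi> $$ (k, l) = gs ! l $ k" if "k < length d" "l < length d'" for k l
    using that by (simp add: \<phi>_def)
  have \<phi>: "graded_matrix n d d' \<phi>"
    unfolding graded_matrix_def
  proof (intro conjI allI impI)
    fix k l assume kl: "k < length d" "l < length d'"
    show "\<phi> $$ (k, l) \<in> polys n"
      using gsU[OF kl(2)] sub kl by (auto simp: \<phi>i free_mod_iff)
    show "homogeneous (d' ! l - d ! k) (\<phi> $$ (k, l))"
    proof -
      have "gs ! l \<in> G" using gs(1) kl(2) by (auto simp: len)
      then show ?thesis
        using dg kl by (simp add: \<phi>i homogeneous_vec_def d'_def)
    qed
  qed (simp add: \<phi>_def)
  note \<phi>idx = graded_matrix_index[OF \<phi>]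
  let ?im = "(\<lambda>w. \<phi> *\<^sub>v w) ` free_over n d'"
  let ?K = "{w \<in> free_over n d'. \<phi> *\<^sub>v w = 0\<^sub>v (length d)}"
  have im_vec: "\<phi> *\<^sub>v w = vec (length d) (\<lambda>k. \<Sum>l<length d'. w $ l * gs ! l $ k)"
    if "w \<in> free_over n d'" for w
    using that graded_matrix_dim[OF \<phi>]
    by (intro eq_vecI) (auto simp: \<phi>idx free_mod_iff \<phi>i mult.commute simp del: index_mult_mat_vec)
  have "U = ?im"
  proof
    show "?im \<subseteq> U"
      using gsU by (auto simp: im_vec free_mod_iff intro!: lincomb_mem)
    have "G \<subseteq> ?im"
    proof
      fix g assume "g \<in> G"
      then obtain l where l: "l < length d'" "g = gs ! l"
        using gs(1) by (metis in_set_conv_nth len)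
      have u: "unit_vec (length d') l \<in> free_over n d'"
        by (auto simp: free_mod_iff unit_vec_def)
      have "\<phi> *\<^sub>v unit_vec (length d') l = g"
        unfolding im_vec[OF u] using l dim_mem[OF gsU[OF l(1)]]
        by (intro eq_vecI) (auto simp: unit_vec_def if_distrib[of "\<lambda>x. x * _"] cong: if_cong)
      then show "g \<in> ?im" using u by blast
    qed
    then show "U \<subseteq> ?im"
      using G(4) pol_submodule_image[OF \<phi>] unfolding generates_def by blast
  qed
  interpret K: pol_submodule n "length d'" ?K by (rule pol_submodule_kernel[OF \<phi>])
  have Khc: "hom_part_vec d' a w \<in> ?K" if w: "w \<in> ?K" for a w
  proof -
    have "\<phi> *\<^sub>v hom_part_vec d' a w = hom_part_vec d a (\<phi> *\<^sub>v w)"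
      using w by (intro graded_matrix_hc_vec[OF \<phi>]) (simp add: free_mod_iff)
    also have "\<dots> = 0\<^sub>v (length d)" using w by (intro eq_vecI) auto
    finally show ?thesis using w hom_part_vec_in_free_mod[of w n d' a] by simp
  qed
  have Kmin: "w $ l \<in> irrelevant_ideal n" if w: "w \<in> ?K" and l: "l < length d'" for w l
  proof (rule ccontr)
    assume "w $ l \<notin> irrelevant_ideal n"
    then have \<kappa>: "lookup (w $ l) 0 \<noteq> 0"
      using w l by (auto simp: irrelevant_ideal_iff free_mod_iff)
    \<comment> \<open>In the component of degree \<open>d' ! l\<close>, the coefficient at \<open>l\<close> is the constant \<open>\<kappa>\<close>.\<close>
    define w0 where "w0 = hom_part_vec d' (d' ! l) w"
    define \<kappa> where "\<kappa> = lookup (w $ l) 0"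
    have w0: "w0 \<in> ?K" unfolding w0_def using w by (rule Khc)
    have w0l: "w0 $ l = single 0 \<kappa>"
      using l by (intro poly_mapping_eqI) (auto simp: w0_def lookup_hc lookup_single \<kappa>_def when_def)
    let ?s = "\<lambda>k. \<Sum>i\<in>{..<length d'} - {l}. (- single 0 (1 / \<kappa>) * w0 $ i) * gs ! i $ k"
    have "generates n (length d) (G - {gs ! l}) U"
      unfolding generates_def
    proof (intro allI impI)
      fix N assume N: "pol_submodule n (length d) N \<and> G - {gs ! l} \<subseteq> N"
      then interpret N: pol_submodule n "length d" N by simp
      have "gs ! i \<in> N" if "i \<in> {..<length d'} - {l}" for i
        using that N gs l by (auto simp: len nth_eq_iff_index_eq)
      then have "vec (length d) ?s \<in> N"
        using w0 by (intro N.lincomb_mem polys_mult polys_uminus) (auto simp: free_mod_iff polys_single)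
      also have "vec (length d) ?s = gs ! l"
      proof (intro eq_vecI)
        fix k assume "k < dim_vec (gs ! l)"
        then have k: "k < length d" using dim_mem[OF gsU[OF l]] by simp
        have "0 = (\<phi> *\<^sub>v w0) $ k" using w0 k by simp
        also have "\<phi> *\<^sub>v w0 = vec (length d) (\<lambda>k. \<Sum>i<length d'. w0 $ i * gs ! i $ k)"
          using w0 by (intro im_vec) simp
        also have "\<dots> $ k = (\<Sum>i<length d'. w0 $ i * gs ! i $ k)"
          using k by simp
        also have "\<dots> = w0 $ l * gs ! l $ k + (\<Sum>i\<in>{..<length d'} - {l}. w0 $ i * gs ! i $ k)"
          using l by (simp add: sum.remove)
        finally have s: "(\<Sum>i\<in>{..<length d'} - {l}. w0 $ i * gs ! i $ k) = - (single 0 \<kappa> * gs ! l $ k)"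
          by (simp add: w0l eq_neg_iff_add_eq_0 add.commute)
        have "?s k =
            - single 0 (1 / \<kappa>) * (\<Sum>i\<in>{..<length d'} - {l}. w0 $ i * gs ! i $ k)"
          unfolding sum_distrib_left by (simp add: mult.assoc)
        also have "\<dots> = (single 0 (1 / \<kappa>) * single 0 \<kappa>) * gs ! l $ k"
          unfolding s by (simp add: mult.assoc)
        also have "\<dots> = gs ! l $ k"
          using \<kappa> by (simp add: mult_single \<kappa>_def)
        finally show "vec (length d) ?s $ k = gs ! l $ k"
          using k by simp
      qed (simp add: dim_mem[OF gsU[OF l]])
      finally have "G \<subseteq> N" using N by blast
      then show "U \<subseteq> N" using G(4) N unfolding generates_def by blast
    qed
    then have "card G \<le> card (G - {gs ! l})"
      using G(1-3) by (intro least) auto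
    moreover have "card (G - {gs ! l}) < card G"
      using l gs by (intro card_Diff1_less G(2)) (auto simp: len)
    ultimately show False by simp
  qed
  have "module_regular n d' ?K (r + 1)"
    using \<phi> regular degree_bound \<open>U = ?im\<close> by (rule module_regular_syzygy)
  then have "regular_submodule n d' ?K (r + 1)"
    using Khc Kmin by unfold_locales auto
  then show ?thesis using \<phi> \<open>U = ?im\<close> by blast
qed

end

lemma minimal_graded_free_resolution_exists:
  fixes I :: "'k::field pol set"
  assumes I: "graded_ideal n I" and sub: "I \<subseteq> irrelevant_ideal n" and reg: "koszul_regular n I r"
  shows "\<exists>d g \<phi>. minimal_graded_free_resolution n I d g \<phi>"
proof -
  interpret I: graded_ideal n I by fact
  let ?g = "vec 1 (\<lambda>_. 1) :: 'k pol vec"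
  let ?U0 = "{v \<in> free_over n [0]. ?g \<bullet> v \<in> I}"
  let ?K = "\<lambda>d d' \<phi>. {w \<in> free_mod n (length (d' :: int list)). \<phi> *\<^sub>v w = (0\<^sub>v (length (d :: int list)) :: 'k pol vec)}"
  have gv: "?g \<bullet> v = v $ 0" if "dim_vec v = 1" for v
    using that by (simp add: scalar_prod_eq_sum)
  have gp: "?g \<bullet> vec 1 (\<lambda>_. p) = p" for p
    by (simp add: gv del: One_nat_def)
  have U0: "v \<in> ?U0 \<longleftrightarrow> dim_vec v = 1 \<and> v $ 0 \<in> polys n \<and> v $ 0 \<in> I" for v
    using gv[of v] by (auto simp: free_mod_iff)
  have "regular_submodule n [0] ?U0 r"
  proof
    show "module_regular n [0] ?U0 r"
    proof (rule module_regular_cyclic[OF I.pol_ideal_axioms reg])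
      fix p :: "'k pol" assume "p \<in> polys n"
      then show "\<exists>v\<in>free_over n [0]. p - ?g \<bullet> v \<in> I"
        by (intro bexI[of _ "vec 1 (\<lambda>_. p)"]) (simp_all add: gp free_mod_iff del: One_nat_def)
    qed (auto simp: free_mod_iff)
    show "?U0 \<subseteq> free_over n [0]" by blast
    fix u v :: "'k pol vec" and p :: "'k pol" and a :: int and k
    show "0\<^sub>v (length [0::int]) \<in> ?U0" unfolding U0 by simp
    assume u: "u \<in> ?U0"
    then have u': "dim_vec u = 1" "u $ 0 \<in> polys n" "u $ 0 \<in> I" unfolding U0 by simp_all
    show "u + v \<in> ?U0" if "v \<in> ?U0"
      using u that unfolding U0 by (simp add: I.add_mem polys_add)
    show "p \<cdot>\<^sub>v u \<in> ?U0" if "p \<in> polys n"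
      using u' that unfolding U0 by (simp add: I.mult_mem polys_mult)
    show "hom_part_vec [0] a u \<in> ?U0"
      using u' unfolding U0 by (simp add: I.hom_part_mem hom_part_in_polys)
    show "u $ k \<in> irrelevant_ideal n" if "k < length [0::int]"
      using u' sub that by auto
  qed
  then have base: "\<exists>s. s = ([0], ?U0) \<and> regular_submodule n (fst s) (snd s) (r + int 0)"
    by simp
  let ?step = "\<lambda>s s'. \<exists>\<phi>. graded_matrix n (fst s) (fst s') \<phi> \<and>
      snd s = (\<lambda>w. \<phi> *\<^sub>v w) ` free_mod n (length (fst s')) \<and> snd s' = ?K (fst s) (fst s') \<phi>"
  let ?P = "\<lambda>i s. (i = 0 \<longrightarrow> s = ([0], ?U0)) \<and> regular_submodule n (fst s) (snd s) (r + int i)"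
  have "\<exists>s. \<forall>i. ?P i (s i) \<and> ?step (s i) (s (Suc i))"
  proof (rule dependent_nat_choice[where P = ?P and Q = "\<lambda>i. ?step"])
    show "\<exists>s. ?P 0 s"
      using base by simp
    fix s i assume "?P i s"
    then interpret S: regular_submodule n "fst s" "snd s" "r + int i" by simp
    obtain d' \<phi> where "graded_matrix n (fst s) d' \<phi>" "snd s = (\<lambda>w. \<phi> *\<^sub>v w) ` free_over n d'"
      "regular_submodule n d' (?K (fst s) d' \<phi>) (r + int i + 1)"
      using S.minimal_presentation by blast
    then show "\<exists>s'. ?P (Suc i) s' \<and> ?step s s'"
      by (intro exI[of _ "(d', ?K (fst s) d' \<phi>)"]) (auto simp: algebra_simps)
  qed
  then obtain s where s: "\<forall>i. ?P i (s i) \<and> ?step (s i) (s (Suc i))" ..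
  have "\<forall>i. \<exists>\<phi>. graded_matrix n (fst (s i)) (fst (s (Suc i))) \<phi> \<and>
      snd (s i) = (\<lambda>w. \<phi> *\<^sub>v w) ` free_mod n (length (fst (s (Suc i)))) \<and>
      snd (s (Suc i)) = ?K (fst (s i)) (fst (s (Suc i))) \<phi>"
    using s by blast
  from choice[OF this] obtain \<phi> where \<phi>: "\<forall>i. graded_matrix n (fst (s i)) (fst (s (Suc i))) (\<phi> i) \<and>
      snd (s i) = (\<lambda>w. \<phi> i *\<^sub>v w) ` free_mod n (length (fst (s (Suc i)))) \<and>
      snd (s (Suc i)) = ?K (fst (s i)) (fst (s (Suc i))) (\<phi> i)" ..
  define d where "d = (\<lambda>i. fst (s i))"
  have s0: "s 0 = ([0], ?U0)" using s by blast
  have d0: "d 0 = [0]" by (simp add: d_def s0)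
  have gm: "graded_matrix n (d i) (d (Suc i)) (\<phi> i)" for i using \<phi> by (simp add: d_def)
  have im: "snd (s i) = (\<lambda>w. \<phi> i *\<^sub>v w) ` free_over n (d (Suc i))" for i using \<phi> unfolding d_def by blast
  have ker: "snd (s (Suc i)) = ?K (d i) (d (Suc i)) (\<phi> i)" for i using \<phi> unfolding d_def by blast
  have "regular_submodule n (d i) (snd (s i)) (r + int i)" for i
    unfolding d_def using s[THEN spec, of i] by (elim conjE)
  from regular_submodule.minimal[OF this]
  have mini: "u $ k \<in> irrelevant_ideal n" if "u \<in> snd (s i)" "k < length (d i)" for i u k
    using that .
  have "minimal_graded_free_resolution n I d ?g \<phi>"
    unfolding minimal_graded_free_resolution_def
  proof (intro conjI allI impI ballI)
    show "?g \<in> free_over n (d 0)" by (simp add: d0 free_mod_iff)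
    show "homogeneous (d 0 ! k) (?g $ k)" if "k < length (d 0)" for k using that by (simp add: d0)
    show "\<phi> i \<in> carrier_mat (length (d i)) (length (d (Suc i)))" for i
      using gm by (simp add: graded_matrix_def)
    show "\<phi> i $$ (k, l) \<in> polys n" "homogeneous (d (Suc i) ! l - d i ! k) (\<phi> i $$ (k, l))"
      if "k < length (d i)" "l < length (d (Suc i))" for i k l
      using gm[of i] that by (auto simp: graded_matrix_def)
    show "\<exists>v\<in>free_over n (d 0). p - ?g \<bullet> v \<in> I" if "p \<in> polys n" for p
      using that by (intro bexI[of _ "vec 1 (\<lambda>_. p)"]) (simp_all add: d0 gp free_mod_iff del: One_nat_def)
    show "{v \<in> free_over n (d 0). ?g \<bullet> v \<in> I} = (\<lambda>w. \<phi> 0 *\<^sub>v w) ` free_mod n (length (d 1))"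
      using im[of 0] by (simp add: s0 d0)
    show "{v \<in> free_over n (d (Suc i)). \<phi> i *\<^sub>v v = 0\<^sub>v (length (d i))} =
        (\<lambda>w. \<phi> (Suc i) *\<^sub>v w) ` free_mod n (length (d (Suc (Suc i))))" for i
      using im[of "Suc i"] ker[of i] by simp
    show "(\<phi> i *\<^sub>v w) $ k \<in> irrelevant_ideal n"
      if "w \<in> free_over n (d (Suc i))" "k < length (d i)" for i w k
      using that im[of i] by (intro mini) auto
  qed
  then show ?thesis by blast
qed

text \<open>Both facts about regular modules are applied alternately along the resolution: the degree bound for
\<open>F\<^sub>i\<close> is what allows the step to the next syzygy module.\<close>

lemma minimal_resolution_degree_bound:
  fixes I :: "'k::field pol set"
  assumes I: "pol_ideal n I" and reg: "koszul_regular n I r"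
    and res: "minimal_graded_free_resolution n I d g \<phi>"
  shows "k < length (d i) \<Longrightarrow> d i ! k \<le> r + int i"
proof -
  have gm: "graded_matrix n (d i) (d (Suc i)) (\<phi> i)" for i
    using res by (auto simp: minimal_graded_free_resolution_def graded_matrix_def)
  define U where "U i = (case i of 0 \<Rightarrow> {v \<in> free_over n (d 0). g \<bullet> v \<in> I}
    | Suc j \<Rightarrow> {v \<in> free_mod n (length (d (Suc j))). \<phi> j *\<^sub>v v = 0\<^sub>v (length (d j))})" for i
  have U: "U i = (\<lambda>w. \<phi> i *\<^sub>v w) ` free_over n (d (Suc i))" for i
    using res unfolding minimal_graded_free_resolution_def U_def by (cases i) auto
  have mini: "u $ k \<in> irrelevant_ideal n" if "u \<in> U i" "k < length (d i)" for u k i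
    using res that unfolding minimal_graded_free_resolution_def U by blast
  have bound: "d i ! k \<le> r + int i" if "module_regular n (d i) (U i) (r + int i)" "k < length (d i)" for i k
  proof -
    interpret S: pol_submodule n "length (d i)" "U i" unfolding U by (rule pol_submodule_image[OF gm])
    show ?thesis using module_regular_degree_bound[OF that(1) S.sub S.zero_mem mini that(2)] .
  qed
  have "module_regular n (d i) (U i) (r + int i)" for i
  proof (induction i)
    case 0
    have "module_regular n (d 0) {v \<in> free_over n (d 0). g \<bullet> v \<in> I} r"
      by (rule module_regular_cyclic[OF I reg]) (use res in \<open>auto simp: minimal_graded_free_resolution_def\<close>)
    then show ?case by (simp add: U_def)
  next
    case (Suc i)
    have "module_regular n (d (Suc i)) (U (Suc i)) (r + int i + 1)"
      using module_regular_syzygy[OF gm Suc bound[OF Suc] U] by (simp add: U_def)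
    then show ?case by (simp add: algebra_simps)
  qed
  then show "k < length (d i) \<Longrightarrow> d i ! k \<le> r + int i" using bound by blast
qed

theorem regularity_le_koszul_regular:
  fixes I :: "'k::field pol set"
  assumes I: "graded_ideal n I" and sub: "I \<subseteq> irrelevant_ideal n" and reg: "koszul_regular n I r"
  shows "regularity n I \<le> ereal (real_of_int r)"
  unfolding regularity_def
proof (rule Sup_least)
  fix x assume "x \<in> {ereal (real_of_int (j - int i)) | i j. betti n I i j \<noteq> 0}"
  then obtain i j where x: "x = ereal (real_of_int (j - int i))" and b: "betti n I i j \<noteq> 0" by blast
  define d where "d = (SOME d. \<exists>g \<phi>. minimal_graded_free_resolution n I d g \<phi>)"
  have "\<exists>g \<phi>. minimal_graded_free_resolution n I d g \<phi>"
    unfolding d_def using someI_ex[OF minimal_graded_free_resolution_exists[OF assms]] .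
  then obtain g \<phi> where res: "minimal_graded_free_resolution n I d g \<phi>" by blast
  have "j \<in> set (d i)"
    using b by (auto simp: betti_def d_def[symmetric] count_list_0_iff)
  then obtain k where "k < length (d i)" "d i ! k = j" by (metis in_set_conv_nth)
  then have "j \<le> r + int i"
    using minimal_resolution_degree_bound[OF graded_ideal.axioms(1)[OF I] reg res] by blast
  then show "x \<le> ereal (real_of_int r)" by (simp add: x)
qed


theorem corollary2p7:
  fixes n :: nat and E :: "nat set set"
  assumes "E \<subseteq> [{1..n}]\<^bsup>2\<^esup>"
  shows "regularity n (binomial_edge_ideal n E :: 'k::field pol set)
           \<le> ereal (real (card (maximal_cliques {1..n} E)))"
proof -
  let ?I = "binomial_edge_ideal n E :: 'k pol set" and ?c = "int (card (maximal_cliques {1..n} E))"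
  have I: "graded_ideal n ?I"
    unfolding binomial_edge_ideal_eq[OF assms] using assms by (intro graded_edge_ideal) auto
  have "?I \<subseteq> edge_ideal n {} (var_set n)"
    unfolding binomial_edge_ideal_eq[OF assms]
  proof (rule edge_ideal_subset)
    show J: "pol_ideal n (edge_ideal n {} (var_set n) :: 'k pol set)"
      by (intro pol_ideal_edge_ideal) auto
    fix i j assume "{i, j} \<in> E"
    then have "i \<in> {1..n}" "j \<in> {1..n}" using edge_in_range[OF assms] by auto
    then have "Var (X i) \<in> (edge_ideal n {} (var_set n) :: 'k pol set)"
      "Var (X j) \<in> (edge_ideal n {} (var_set n) :: 'k pol set)"
      "Var (Y i) \<in> (polys n :: 'k pol set)" "Var (Y j) \<in> (polys n :: 'k pol set)"
      by (auto intro: Var_in_edge_ideal)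
    then show "bin i j \<in> (edge_ideal n {} (var_set n) :: 'k pol set)"
      unfolding bin_def by (intro pol_ideal.diff_mem[OF J] pol_ideal.mult_mem'[OF J])
  qed simp
  then have "?I \<subseteq> irrelevant_ideal n" by (simp only: irrelevant_ideal_eq)
  moreover have "koszul_regular n ?I ?c"
    using assms by (rule koszul_regular_binomial_edge_ideal)
  ultimately have "regularity n ?I \<le> ereal (real_of_int ?c)"
    using I by (intro regularity_le_koszul_regular) auto
  then show ?thesis by simp
qed

end
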